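(* In the fluid queue setting described in the context, the distribution of $W$ is the convolution of two distributions, one of which is the distribution of $R$ (the limiting distribution of the reflected Lévy process associated with $Y$), and the other is the mixture of the distribution of $U$ with probability $p$ and the stationary residual life distribution of $\eta_1$ with probability $1-p$.
   Context: Model. $(\Omega,\mathcal{F},\mathbb{P})$ is a complete probability space with a filtration $\{\mathcal{F}_t\}_{t\ge 0}$ satisfying the usual conditions; adaptedness, stopping times and martingales are with respect to it. Lévy processes have càdlàg paths. $X=\{X_t,t\ge0\}$ (cumulative fluid input) is a subordinator with $\mathbb{E}e^{-\theta X_t}=e^{t\phi(\theta)}$, $\phi(\theta)=-a\theta+\int_{\mathbb{R}_+}(e^{-\theta x}-1)\,\nu(dx)$, where $a\ge0$ and $\int_{\mathbb{R}_+}x\,\nu(dx)<\infty$. The server processes fluid at constant rate $r$. Set $Y_t=X_t-rt$, a spectrally positive Lévy process with exponent $\varphi(\theta)=\phi(\theta)+r\theta$, i.e. $\mathbb{E}e^{-\theta Y_t}=e^{t\varphi(\theta)}$. Standing assumptions: $\rho:=-\phi'(0)<r$ and $\mathbb{E}|Y_t|<\infty$ for all $t\ge0$ (so $\varphi'(0)=-\mathbb{E}Y_1=r-\rho>0$). The server fails at a strictly increasing sequence of stopping times $\{\tau_n,n\ge1\}$; the $n$th repair time $\xi_n$ is a positive $\mathcal{F}_{\tau_n}$-measurable random variable. Whenever the system becomes empty, the server takes a vacation; vacations continue until, on return, the server finds the system non-empty. The vacation starting times form a strictly increasing sequence of stopping times $\{\sigma_n,n\ge1\}$, and the $n$th vacation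 length $\eta_n$ is a positive $\mathcal{F}_{\sigma_n}$-measurable random variable. Let $W_0\ge0$ be $\mathcal{F}_0$-measurable. The virtual waiting time process is $$W_t=W_0+X_t-rt+\sum_{i=1}^{N_t^R}\xi_i+\sum_{i=1}^{N_t^V}\eta_i,\quad t\ge0,$$ (empty sums are zero), where $N_t^R=\sup\{n\mid\tau_n\le t\}$, $N_t^V=\sup\{n\mid\sigma_n\le t\}$ and $\sigma_n=\inf\{t\ge0\mid W_0+X_t-rt+\sum_{i=1}^{N_t^R}\xi_i+\sum_{i=1}^{n-1}\eta_i=0\}$, $n\ge1$. Steady-state setting. As $t\to\infty$, $W_t$ converges in distribution to a random variable $W$ and $t^{-1}\mathbb{E}W_t\to0$. The sequences $\{\xi_n\}$ and $\{\eta_n\}$ are positive and i.i.d. with $\mathbb{E}\xi_1<\infty$, $\mathbb{E}\eta_1<\infty$; $n^{-1}\tau_n\to\lambda_R^{-1}$ and $n^{-1}\sigma_n\to\lambda_V^{-1}$ in probability with $0<\lambda_R^{-1}<\infty$, $0<\lambda_V^{-1}<\infty$; $\{W_{\tau_k},k\ge1\}$ and $\{W_{\tau_k}-\xi_k,k\ge1\}$ are stationary and ergodic, with $(W_{\tau_k}-\xi_k,W_{\tau_k})$ converging in distribution to $(W^-,W^+)$ for proper random variables $W^-,W^+$; $\xi_n$ is independent of $\mathbf{1}_{\{N_1^R\ge n\}}$ and $\eta_n$ is independent of $\mathbf{1}_{\{N_1^V\ge n\}}$. The constant $p\in[0,1]$ is the one determined by $\lambda_R=p\varphi'(0)/\mathbb{E}\xi_1$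 and $\lambda_V=(1-p)\varphi'(0)/\mathbb{E}\eta_1$. Further notation. The reflected process is $R_t=R_0+Y_t+I_t$ with $I_t=(-\inf_{0\le s\le t}Y_s-R_0)^+$ and $0\le R_0\in\mathcal{F}_0$; its limiting distribution as $t\to\infty$ (the distribution of $R$) has Laplace–Stieltjes transform $\theta\varphi'(0)/\varphi(\theta)$, $\theta>0$ (generalized Pollaczek–Khinchine formula). $U$ is a random variable with $\mathbb{E}e^{-\theta U}=\dfrac{\mathbb{E}e^{-\theta W^-}-\mathbb{E}e^{-\theta W^+}}{\theta\,\mathbb{E}\xi_1}$, i.e. with density $\big(\mathbb{P}(W^+>x)-\mathbb{P}(W^->x)\big)/\mathbb{E}\xi_1$. The stationary residual life distribution of $\eta_1$ has density $\mathbb{P}(\eta_1>x)/\mathbb{E}\eta_1$ on $[0,\infty)$. *)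

theory Defs
  imports "HOL-Probability.Probability"
begin

subsection \<open>Filtered probability space\<close>

text \<open>The time set is \<open>[0,\<infinity>]\<close>, rendered by \<^typ>\<open>ennreal\<close>, so that stopping times may take the value
  \<open>\<infinity>\<close>. The \<open>\<sigma>\<close>-algebra \<open>F \<infinity>\<close> may be any one between all the \<open>F t\<close>, \<open>t < \<infinity>\<close>, and \<open>M\<close>.
  The two assumptions after \<open>subalg\<close> are the usual conditions.\<close>

locale filtered_prob_space =
  prob_space M + complete_measure M + filtration "space M" F
  for M :: "'a measure" and F :: "ennreal \<Rightarrow> 'a measure" +
  assumes subalg: "sets (F t) \<subseteq> sets M"
    and null_sets_initial: "null_sets M \<subseteq> sets (F 0)"
    and right_continuous: "t < \<infinity> \<Longrightarrow> (\<Inter>s\<in>{t<..}. sets (F s)) = sets (F t)"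

subsection \<open>Notions of convergence, stationarity and ergodicity\<close>

definition converges_in_distribution ::
  "'a measure \<Rightarrow> ('i \<Rightarrow> 'a \<Rightarrow> 'c::topological_space) \<Rightarrow> 'i filter \<Rightarrow> 'b measure \<Rightarrow> ('b \<Rightarrow> 'c) \<Rightarrow> bool"
where
  "converges_in_distribution M Z G N Z' \<longleftrightarrow>
     (\<forall>f :: 'c \<Rightarrow> real. continuous_on UNIV f \<and> bounded (range f) \<longrightarrow>
        ((\<lambda>i. \<integral>\<omega>. f (Z i \<omega>) \<partial>M) \<longlongrightarrow> (\<integral>\<omega>. f (Z' \<omega>) \<partial>N)) G)"

definition converges_in_probability :: "'a measure \<Rightarrow> (nat \<Rightarrow> 'a \<Rightarrow> ereal) \<Rightarrow> real \<Rightarrow> bool" where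
  "converges_in_probability M Z c \<longleftrightarrow>
     (\<forall>\<epsilon>>0. (\<lambda>n. measure M {\<omega> \<in> space M. \<bar>Z n \<omega> - ereal c\<bar> > ereal \<epsilon>}) \<longlonglongrightarrow> 0)"

definition stationary_sequence :: "'a measure \<Rightarrow> (nat \<Rightarrow> 'a \<Rightarrow> real) \<Rightarrow> bool" where
  "stationary_sequence M Z \<longleftrightarrow>
     (\<forall>k. Z k \<in> borel_measurable M) \<and>
     distr M (\<Pi>\<^sub>M k\<in>UNIV. borel) (\<lambda>\<omega> k. Z (Suc k) \<omega>) = distr M (\<Pi>\<^sub>M k\<in>UNIV. borel) (\<lambda>\<omega> k. Z k \<omega>)"

text \<open>Ergodicity: every shift-invariant measurable set of sequences has probability 0 or 1.\<close>

definition ergodic_sequence :: "'a measure \<Rightarrow> (nat \<Rightarrow> 'a \<Rightarrow> real) \<Rightarrow> bool" where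
  "ergodic_sequence M Z \<longleftrightarrow>
     (\<forall>A \<in> sets (\<Pi>\<^sub>M k\<in>UNIV. borel :: real measure). {x. (\<lambda>k. x (Suc k)) \<in> A} = A \<longrightarrow>
        measure M {\<omega> \<in> space M. (\<lambda>k. Z k \<omega>) \<in> A} \<in> {0, 1})"

subsection \<open>The subordinator and the associated net input process\<close>

definition cadlag :: "(real \<Rightarrow> real) \<Rightarrow> bool" where
  "cadlag f \<longleftrightarrow> (\<forall>t\<ge>0. continuous (at_right t) f) \<and> (\<forall>t>0. \<exists>l. (f \<longlongrightarrow> l) (at_left t))"

text \<open>The process is a Levy process relative to the filtration \<open>F\<close>: it is adapted and its increments
  are independent of the past \<open>F s\<close>. Only times \<open>t \<ge> 0\<close> matter.\<close>

definition levy_process :: "'a measure \<Rightarrow> (ennreal \<Rightarrow> 'a measure) \<Rightarrow> (real \<Rightarrow> 'a \<Rightarrow> real) \<Rightarrow> bool" where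
  "levy_process M F X \<longleftrightarrow>
     (\<forall>t\<ge>0. X t \<in> borel_measurable (F (ennreal t))) \<and>
     (AE \<omega> in M. X 0 \<omega> = 0) \<and>
     (\<forall>s t. 0 \<le> s \<and> s \<le> t \<longrightarrow>
        prob_space.indep_set M
          (sets (vimage_algebra (space M) (\<lambda>\<omega>. X t \<omega> - X s \<omega>) borel)) (sets (F (ennreal s)))) \<and>
     (\<forall>s t. 0 \<le> s \<and> s \<le> t \<longrightarrow>
        distr M borel (\<lambda>\<omega>. X t \<omega> - X s \<omega>) = distr M borel (X (t - s))) \<and>
     (AE \<omega> in M. cadlag (\<lambda>t. X t \<omega>))"

definition subordinator :: "'a measure \<Rightarrow> (ennreal \<Rightarrow> 'a measure) \<Rightarrow> (real \<Rightarrow> 'a \<Rightarrow> real) \<Rightarrow> bool" where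
  "subordinator M F X \<longleftrightarrow>
     levy_process M F X \<and> (AE \<omega> in M. \<forall>s t. 0 \<le> s \<and> s \<le> t \<longrightarrow> X s \<omega> \<le> X t \<omega>)"

definition sub_exponent :: "real \<Rightarrow> real measure \<Rightarrow> real \<Rightarrow> real" where
  "sub_exponent a \<nu> \<theta> = - a * \<theta> + (\<integral>x. (exp (- \<theta> * x) - 1) \<partial>\<nu>)"

definition net_exponent :: "real \<Rightarrow> real measure \<Rightarrow> real \<Rightarrow> real \<Rightarrow> real" where
  "net_exponent a \<nu> r \<theta> = sub_exponent a \<nu> \<theta> + r * \<theta>"

text \<open>Exponents are only meaningful on \<open>[0,\<infinity>)\<close>, so derivatives at 0 are one-sided.\<close>

definition right_deriv_0 :: "(real \<Rightarrow> real) \<Rightarrow> real" where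
  "right_deriv_0 f = vector_derivative f (at 0 within {0..})"

definition net_input :: "(real \<Rightarrow> 'a \<Rightarrow> real) \<Rightarrow> real \<Rightarrow> real \<Rightarrow> 'a \<Rightarrow> real" where
  "net_input X r t \<omega> = X t \<omega> - r * t"

definition reflected :: "(real \<Rightarrow> 'a \<Rightarrow> real) \<Rightarrow> ('a \<Rightarrow> real) \<Rightarrow> real \<Rightarrow> 'a \<Rightarrow> real" where
  "reflected Y R0 t \<omega> = R0 \<omega> + Y t \<omega> + max 0 (- (INF s\<in>{0..t}. Y s \<omega>) - R0 \<omega>)"

subsection \<open>The fluid queue\<close>

text \<open>Failures, repairs and vacations are numbered from 1; index 0 is never used.\<close>

definition num_until :: "(nat \<Rightarrow> 'a \<Rightarrow> ennreal) \<Rightarrow> real \<Rightarrow> 'a \<Rightarrow> nat" where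
  "num_until T t \<omega> = Sup {n. 1 \<le> n \<and> T n \<omega> \<le> ennreal t}"

definition waiting_time ::
  "(real \<Rightarrow> 'a \<Rightarrow> real) \<Rightarrow> real \<Rightarrow> ('a \<Rightarrow> real) \<Rightarrow> (nat \<Rightarrow> 'a \<Rightarrow> ennreal) \<Rightarrow> (nat \<Rightarrow> 'a \<Rightarrow> real) \<Rightarrow>
   (nat \<Rightarrow> 'a \<Rightarrow> ennreal) \<Rightarrow> (nat \<Rightarrow> 'a \<Rightarrow> real) \<Rightarrow> real \<Rightarrow> 'a \<Rightarrow> real"
where
  "waiting_time X r W0 \<tau> \<xi> \<sigma> \<eta> t \<omega> =
     W0 \<omega> + X t \<omega> - r * t + (\<Sum>i=1..num_until \<tau> t \<omega>. \<xi> i \<omega>) + (\<Sum>i=1..num_until \<sigma> t \<omega>. \<eta> i \<omega>)"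

text \<open>The Levy measure \<open>\<nu>\<close> lives on \<open>(0,\<infinity>)\<close>. Pathwise requirements are almost sure.
  The infimum defining \<open>\<sigma> n\<close> is taken in \<open>[0,\<infinity>]\<close>, hence is \<open>\<infinity>\<close> if level 0 is never hit.\<close>

locale fluid_queue = filtered_prob_space M F
  for M :: "'a measure" and F :: "ennreal \<Rightarrow> 'a measure" +
  fixes X :: "real \<Rightarrow> 'a \<Rightarrow> real" and a :: real and \<nu> :: "real measure" and r :: real
    and W0 :: "'a \<Rightarrow> real"
    and \<tau> :: "nat \<Rightarrow> 'a \<Rightarrow> ennreal" and \<xi> :: "nat \<Rightarrow> 'a \<Rightarrow> real"
    and \<sigma> :: "nat \<Rightarrow> 'a \<Rightarrow> ennreal" and \<eta> :: "nat \<Rightarrow> 'a \<Rightarrow> real"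
  assumes subordinator_X: "subordinator M F X"
    and a_nonneg: "0 \<le> a"
    and levy_measure: "sets \<nu> = sets borel" "emeasure \<nu> {..0} = 0"
    and levy_measure_mean: "integrable \<nu> (\<lambda>x. x)"
    and laplace_X: "\<lbrakk>0 \<le> t; 0 \<le> \<theta>\<rbrakk> \<Longrightarrow>
      expectation (\<lambda>\<omega>. exp (- \<theta> * X t \<omega>)) = exp (t * sub_exponent a \<nu> \<theta>)"
    and rho_less: "- right_deriv_0 (sub_exponent a \<nu>) < r"
    and net_input_integrable: "0 \<le> t \<Longrightarrow> integrable M (net_input X r t)"
    and tau_stopping: "1 \<le> n \<Longrightarrow> stopping_time F (\<tau> n)"
    and tau_strict: "AE \<omega> in M. \<forall>n\<ge>1. \<tau> n \<omega> < \<tau> (Suc n) \<omega>"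
    and xi_measurable: "1 \<le> n \<Longrightarrow> \<xi> n \<in> borel_measurable (pre_sigma (\<tau> n))"
    and xi_pos: "1 \<le> n \<Longrightarrow> AE \<omega> in M. 0 < \<xi> n \<omega>"
    and W0_measurable: "W0 \<in> borel_measurable (F 0)"
    and W0_nonneg: "AE \<omega> in M. 0 \<le> W0 \<omega>"
    and sigma_stopping: "1 \<le> n \<Longrightarrow> stopping_time F (\<sigma> n)"
    and sigma_strict: "AE \<omega> in M. \<forall>n\<ge>1. \<sigma> n \<omega> < \<sigma> (Suc n) \<omega>"
    and sigma_eq: "AE \<omega> in M. \<forall>n\<ge>1. \<sigma> n \<omega> =
      Inf {ennreal t | t. 0 \<le> t \<and>
        W0 \<omega> + X t \<omega> - r * t + (\<Sum>i=1..num_until \<tau> t \<omega>. \<xi> i \<omega>) + (\<Sum>i=1..n-1. \<eta> i \<omega>) = 0}"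
    and eta_measurable: "1 \<le> n \<Longrightarrow> \<eta> n \<in> borel_measurable (pre_sigma (\<sigma> n))"
    and eta_pos: "1 \<le> n \<Longrightarrow> AE \<omega> in M. 0 < \<eta> n \<omega>"
begin

abbreviation "Wt \<equiv> waiting_time X r W0 \<tau> \<xi> \<sigma> \<eta>"

end

text \<open>The limit variables \<open>W\<close>, \<open>Wminus\<close>, \<open>Wplus\<close> may live on a probability space \<open>N\<close> of their own.
  The times \<open>\<tau> k\<close> are almost surely finite by \<open>tau_rate\<close>, so the value 0 of \<^const>\<open>enn2real\<close> at
  \<open>\<infinity>\<close> is immaterial. The sequences indexed from 1 are re-indexed from 0 by \<^const>\<open>Suc\<close>.\<close>

locale fluid_queue_steady_state = fluid_queue M F X a \<nu> r W0 \<tau> \<xi> \<sigma> \<eta>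
  for M :: "'a measure" and F X a \<nu> r W0 \<tau> \<xi> \<sigma> \<eta> +
  fixes N :: "'b measure" and W Wminus Wplus :: "'b \<Rightarrow> real"
    and lamR lamV p :: real
  assumes prob_space_N: "prob_space N"
    and W_measurable: "W \<in> borel_measurable N"
    and Wminus_measurable: "Wminus \<in> borel_measurable N"
    and Wplus_measurable: "Wplus \<in> borel_measurable N"
    and W_limit: "converges_in_distribution M Wt at_top N W"
    and Wt_integrable: "0 \<le> t \<Longrightarrow> integrable M (Wt t)"
    and Wt_mean: "((\<lambda>t. expectation (Wt t) / t) \<longlongrightarrow> 0) at_top"
    and xi_indep: "indep_vars (\<lambda>_. borel) \<xi> {1..}"
    and xi_ident: "1 \<le> n \<Longrightarrow> distr M borel (\<xi> n) = distr M borel (\<xi> 1)"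
    and xi_integrable: "integrable M (\<xi> 1)"
    and eta_indep: "indep_vars (\<lambda>_. borel) \<eta> {1..}"
    and eta_ident: "1 \<le> n \<Longrightarrow> distr M borel (\<eta> n) = distr M borel (\<eta> 1)"
    and eta_integrable: "integrable M (\<eta> 1)"
    and rates_pos: "0 < lamR" "0 < lamV"
    and tau_rate: "converges_in_probability M (\<lambda>n \<omega>. enn2ereal (\<tau> n \<omega>) / ereal (real n)) (1 / lamR)"
    and sigma_rate: "converges_in_probability M (\<lambda>n \<omega>. enn2ereal (\<sigma> n \<omega>) / ereal (real n)) (1 / lamV)"
    and Wplus_stationary:
      "stationary_sequence M (\<lambda>k \<omega>. Wt (enn2real (\<tau> (Suc k) \<omega>)) \<omega>)"
    and Wplus_ergodic:
      "ergodic_sequence M (\<lambda>k \<omega>. Wt (enn2real (\<tau> (Suc k) \<omega>)) \<omega>)"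
    and Wminus_stationary:
      "stationary_sequence M (\<lambda>k \<omega>. Wt (enn2real (\<tau> (Suc k) \<omega>)) \<omega> - \<xi> (Suc k) \<omega>)"
    and Wminus_ergodic:
      "ergodic_sequence M (\<lambda>k \<omega>. Wt (enn2real (\<tau> (Suc k) \<omega>)) \<omega> - \<xi> (Suc k) \<omega>)"
    and Wminus_Wplus_limit:
      "converges_in_distribution M
         (\<lambda>k \<omega>. (Wt (enn2real (\<tau> k \<omega>)) \<omega> - \<xi> k \<omega>, Wt (enn2real (\<tau> k \<omega>)) \<omega>)) sequentially
         N (\<lambda>x. (Wminus x, Wplus x))"
    and xi_indep_count:
      "1 \<le> n \<Longrightarrow> indep_var borel (\<xi> n) borel (\<lambda>\<omega>. of_bool (n \<le> num_until \<tau> 1 \<omega>) :: real)"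
    and eta_indep_count:
      "1 \<le> n \<Longrightarrow> indep_var borel (\<eta> n) borel (\<lambda>\<omega>. of_bool (n \<le> num_until \<sigma> 1 \<omega>) :: real)"
    and p_range: "0 \<le> p" "p \<le> 1"
    and p_lambdaR: "lamR = p * right_deriv_0 (net_exponent a \<nu> r) / expectation (\<xi> 1)"
    and p_lambdaV: "lamV = (1 - p) * right_deriv_0 (net_exponent a \<nu> r) / expectation (\<eta> 1)"

subsection \<open>Distributions in the decomposition\<close>

text \<open>The stationary residual life distribution of a nonnegative random variable.\<close>

definition residual_life :: "'a measure \<Rightarrow> ('a \<Rightarrow> real) \<Rightarrow> real measure" where
  "residual_life M Z = density lborel
     (\<lambda>x. ennreal (indicator {0..} x * measure M {\<omega> \<in> space M. Z \<omega> > x} / (\<integral>\<omega>. Z \<omega> \<partial>M)))"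

text \<open>Choose \<open>A\<close> with probability \<open>p\<close> and \<open>B\<close> with probability \<open>1 - p\<close>.\<close>

definition mixture :: "real \<Rightarrow> real measure \<Rightarrow> real measure \<Rightarrow> real measure" where
  "mixture p A B = measure_pmf (bernoulli_pmf p) \<bind> (\<lambda>b. if b then A else B)"

end

theory Submission
  imports Defs "HOL-Real_Asymp.Real_Asymp"
begin

text \<open>
  The proof computes Laplace transforms. Write \<open>\<phi>\<close> for the exponent of the net input \<open>Y\<close> and let \<open>V\<close> be
  either the waiting time or the reflected process. On the grid of mesh \<open>t / n\<close> one has
  \<open>V = V\<^sub>k + \<Delta>Y + \<Delta>D\<close>, where \<open>\<Delta>Y\<close> is independent of the past and \<open>D\<close> collects what is added to the net
  input (repairs and vacations, or the reflection). Telescoping \<open>E exp (- \<theta> V)\<close> over the grid, the part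
  due to \<open>\<Delta>Y\<close> is \<open>\<phi> \<theta>\<close> times a Riemann sum of \<open>E exp (- \<theta> V)\<close>. If \<open>V\<close> converges in distribution to \<open>Z\<close>,
  this sum is asymptotic to \<open>t E exp (- \<theta> Z)\<close>, while \<open>E exp (- \<theta> V)\<close> itself is bounded; so the
  contribution \<open>B t\<close> of \<open>D\<close> satisfies \<open>B t / t \<longlongrightarrow> - \<phi> \<theta> E exp (- \<theta> Z)\<close> (\<open>laplace_balance\<close>). This
  is a discrete form of the Kella--Whitt martingale argument.

  For the reflected process the regulator grows only while the process is near \<open>0\<close>, hence
  \<open>B t\<close> is \<open>- \<theta>\<close> times its mean growth. The growth rate does not depend on \<open>\<theta>\<close>, and \<open>\<theta> \<rightarrow> 0\<close>
  identifies it as \<open>\<phi>' 0\<close>. This is the Pollaczek--Khinchine formula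
  \<open>\<phi> \<theta> E exp (- \<theta> R) = \<theta> \<phi>' 0\<close> (\<open>generalized_Pollaczek_Khinchine\<close>).

  For the waiting time the jumps of \<open>D\<close> are the repairs and the vacations. A vacation starts at level
  \<open>0\<close>, so each one contributes \<open>exp (- \<theta> \<eta>) - 1\<close>; a repair contributes
  \<open>exp (- \<theta> W\<^sup>+) - exp (- \<theta> W\<^sup>-)\<close>. The long-run averages of these contributions follow from a squeeze.
  If the \<open>n\<close>-th event occurs at time \<open>T n\<close> with \<open>T n / n \<longlongrightarrow> 1 / \<lambda>\<close> and
  carries a bounded nonnegative reward, with means tending to \<open>m\<close>, the mean reward collected up to \<open>t\<close> has
  lower growth rate at least \<open>\<lambda> m\<close> (\<open>renewal_reward_lower_bound\<close>), because at least \<open>(\<lambda> - \<epsilon>) t\<close> events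
  have happened with high probability. By truncation this gives lower rates \<open>\<lambda>\<^sub>R E \<xi>\<close> and \<open>\<lambda>\<^sub>V E \<eta>\<close> for
  the total repair and vacation work. Since \<open>E W\<^sub>t / t \<longlongrightarrow> 0\<close>, the two works together grow at rate exactly
  \<open>\<phi>' 0 = \<lambda>\<^sub>R E \<xi> + \<lambda>\<^sub>V E \<eta>\<close>, so both lower bounds are attained (\<open>work_rates\<close>). The same squeeze applied to
  the loss \<open>h \<le> \<theta> \<xi>\<close> and its complement \<open>\<theta> \<xi> - h\<close> gives the rate of \<open>h\<close> (\<open>dominated_reward_rate\<close>). Hence
  \<open>\<phi> \<theta> E exp (- \<theta> W) = \<lambda>\<^sub>R (E exp (- \<theta> W\<^sup>-) - E exp (- \<theta> W\<^sup>+)) + \<lambda>\<^sub>V (1 - E exp (- \<theta> \<eta>))\<close>.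
  Dividing by the Pollaczek--Khinchine formula, the right-hand side becomes the transform of the mixture,
  and a distribution on the half-line is determined by its transform.
\<close>

section \<open>Laplace transforms of distributions on the half-line\<close>

text \<open>Transport both measures by \<open>x \<mapsto> exp (- x)\<close> into the unit interval. The values of the transform at
  the positive integers are the moments of the image, whose characteristic function is the power series
  of these moments; it therefore coincides for the two images.\<close>

lemma Laplace_transform_unique:
  assumes "prob_space A" "prob_space B"
    and sA[measurable_cong]: "sets A = sets borel" and sB[measurable_cong]: "sets B = sets borel"
    and nnA: "AE x in A. 0 \<le> x" and nnB: "AE x in B. (0::real) \<le> x"
    and eq: "\<And>k::nat. k \<noteq> 0 \<Longrightarrow> (\<integral>x. exp (- real k * x) \<partial>A) = (\<integral>x. exp (- real k * x) \<partial>B)"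
  shows "A = B"
proof -
  let ?e = "\<lambda>x::real. exp (- x)"
  have char_series: "(\<lambda>k. (\<i> * complex_of_real t) ^ k / fact k * complex_of_real (\<integral>x. exp (- real k * x) \<partial>C))
      sums char (distr C borel ?e) t"
    if C: "prob_space C" and sC[measurable_cong]: "sets C = sets borel" and nn: "AE x in C. 0 \<le> x"
    for C t
  proof -
    interpret C: prob_space C by fact
    let ?f = "\<lambda>k x. (\<i> * complex_of_real t) ^ k / fact k * complex_of_real (exp (- x) ^ k)"
    have le1: "AE x in C. norm (?f k x) \<le> \<bar>t\<bar> ^ k / fact k" for k
      using nn
      by eventually_elim
         (auto simp: norm_mult norm_power norm_divide power_mult_distrib intro!: divide_right_mono mult_left_le power_le_one)
    have int: "integrable C (?f k)" for k
      by (rule C.integrable_const_bound[OF le1]) measurable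
    have summ: "summable (\<lambda>k. \<bar>t\<bar> ^ k / fact k)"
      using summable_exp[of "\<bar>t\<bar>"] by (simp add: divide_inverse mult.commute)
    have "(\<lambda>k. \<integral>x. ?f k x \<partial>C) sums (\<integral>x. (\<Sum>k. ?f k x) \<partial>C)"
    proof (rule sums_integral)
      show "integrable C (?f k)" for k by (rule int)
      have "AE x in C. \<forall>k. norm (?f k x) \<le> \<bar>t\<bar> ^ k / fact k"
        using le1 by (simp add: AE_all_countable)
      then show "AE x in C. summable (\<lambda>k. norm (?f k x))"
        by eventually_elim (rule summable_comparison_test'[OF summ], auto)
      show "summable (\<lambda>k. \<integral>x. norm (?f k x) \<partial>C)"
      proof (rule summable_comparison_test'[OF summ])
        fix k :: nat
        have "(\<integral>x. norm (?f k x) \<partial>C) \<le> (\<integral>x. \<bar>t\<bar> ^ k / fact k \<partial>C)"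
          by (rule integral_mono_AE[OF _ _ le1]) (use int in auto)
        then show "norm (\<integral>x. norm (?f k x) \<partial>C) \<le> \<bar>t\<bar> ^ k / fact k"
          by (simp add: C.prob_space)
      qed
    qed
    moreover have "(\<Sum>k. ?f k x) = iexp (t * exp (- x))" for x
    proof -
      have "(\<lambda>k. (\<i> * complex_of_real (t * exp (-x))) ^ k /\<^sub>R fact k) sums iexp (t * exp (- x))"
        using exp_converges[of "\<i> * complex_of_real (t * exp (-x))"] by simp
      also have "(\<lambda>k. (\<i> * complex_of_real (t * exp (-x))) ^ k /\<^sub>R fact k) = (\<lambda>k. ?f k x)"
        by (auto simp: fun_eq_iff scaleR_conv_of_real power_mult_distrib divide_inverse)
      finally show ?thesis by (simp add: sums_iff)
    qed
    moreover have "(\<integral>x. ?f k x \<partial>C) = (\<i> * complex_of_real t) ^ k / fact k * complex_of_real (\<integral>x. exp (- real k * x) \<partial>C)" for k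
      by (simp flip: exp_of_nat_mult of_real_power)
    ultimately have "(\<lambda>k. (\<i> * complex_of_real t) ^ k / fact k * complex_of_real (\<integral>x. exp (- real k * x) \<partial>C))
        sums (\<integral>x. iexp (t * exp (- x)) \<partial>C)"
      by (simp only:)
    then show ?thesis
      unfolding char_def by (subst integral_distr) simp_all
  qed
  have "char (distr A borel ?e) t = char (distr B borel ?e) t" for t
  proof -
    have "(\<integral>x. exp (- real k * x) \<partial>A) = (\<integral>x. exp (- real k * x) \<partial>B)" for k
      by (cases "k = 0") (use eq[of k] assms(1,2) in \<open>auto simp: prob_space.prob_space\<close>)
    then show ?thesis
      using char_series[OF assms(1) sA nnA, of t] char_series[OF assms(2) sB nnB, of t]
      by (simp add: sums_iff)
  qed
  moreover have rd: "real_distribution (distr C borel ?e)" if "prob_space C" "sets C = sets borel" for C :: "real measure"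
  proof -
    note [measurable_cong] = that(2)
    show ?thesis
      unfolding real_distribution_def real_distribution_axioms_def
      by (auto intro!: prob_space.prob_space_distr that(1))
  qed
  ultimately have "distr A borel ?e = distr B borel ?e"
    using assms by (intro Levy_uniqueness rd) auto
  then have "distr (distr A borel ?e) borel (\<lambda>y. - ln y) = distr (distr B borel ?e) borel (\<lambda>y. - ln y)"
    by simp
  then have "distr A borel (\<lambda>x. x) = distr B borel (\<lambda>x. x)"
    by (simp add: distr_distr comp_def)
  moreover have "distr C borel (\<lambda>x. x) = C" if "sets C = sets borel" for C :: "real measure"
    using that by (intro distr_id2) simp
  ultimately show ?thesis using sA sB by simp
qed

lemma one_minus_exp_bounds:
  fixes x :: real assumes "0 \<le> x"
  shows "0 \<le> 1 - exp (- x)" "1 - exp (- x) \<le> x" "1 - exp (- x) \<le> 1"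
  using exp_ge_add_one_self[of "- x"] assms by auto

text \<open>Dominated convergence for the difference quotients, which lie between \<open>- Z\<close> and \<open>0\<close>.\<close>

lemma (in prob_space) laplace_transform_right_derivative:
  assumes int: "integrable M Z" and nn: "AE \<omega> in M. 0 \<le> Z \<omega>"
  shows "((\<lambda>\<theta>. expectation (\<lambda>\<omega>. exp (- \<theta> * Z \<omega>))) has_real_derivative - expectation Z) (at 0 within {0..})"
proof -
  have [measurable]: "Z \<in> borel_measurable M" using int by auto
  have intexp: "integrable M (\<lambda>\<omega>. exp (- \<theta> * Z \<omega>))" if "0 \<le> \<theta>" for \<theta>
    by (rule integrable_const_bound[where B=1]) (use nn that in \<open>auto elim!: eventually_mono\<close>)
  have "((\<lambda>\<theta>. (expectation (\<lambda>\<omega>. exp (- \<theta> * Z \<omega>)) - 1) / \<theta>) \<longlongrightarrow> - expectation Z) (at_right 0)"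
  proof (rule tendsto_at_right_sequentially[of 0 1])
    fix S :: "nat \<Rightarrow> real"
    assume S: "\<And>n. 0 < S n" "S \<longlonglongrightarrow> 0"
    have S0: "filterlim S (at 0) sequentially"
      using S by (auto simp: filterlim_at intro!: always_eventually less_imp_neq[THEN not_sym])
    have "(\<lambda>n. expectation (\<lambda>\<omega>. (exp (- S n * Z \<omega>) - 1) / S n)) \<longlonglongrightarrow> expectation (\<lambda>\<omega>. - Z \<omega>)"
    proof (rule integral_dominated_convergence[where w=Z])
      show "AE \<omega> in M. (\<lambda>n. (exp (- S n * Z \<omega>) - 1) / S n) \<longlonglongrightarrow> - Z \<omega>"
      proof (rule AE_I2)
        fix \<omega>
        have "((\<lambda>\<theta>. exp (- \<theta> * Z \<omega>)) has_real_derivative - Z \<omega>) (at 0)"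
          by (auto intro!: derivative_eq_intros)
        then have "((\<lambda>\<theta>. (exp (- \<theta> * Z \<omega>) - 1) / \<theta>) \<longlongrightarrow> - Z \<omega>) (at 0)"
          by (simp add: has_field_derivative_iff)
        then show "(\<lambda>n. (exp (- S n * Z \<omega>) - 1) / S n) \<longlonglongrightarrow> - Z \<omega>"
          by (rule filterlim_compose[OF _ S0])
      qed
      show "AE \<omega> in M. norm ((exp (- S n * Z \<omega>) - 1) / S n) \<le> Z \<omega>" for n
        using nn
      proof eventually_elim
        case (elim \<omega>)
        have "0 \<le> S n * Z \<omega>" using elim S(1)[of n] by simp
        then show ?case
          using one_minus_exp_bounds[of "S n * Z \<omega>"] S(1)[of n] by (simp add: field_simps)
      qed
    qed (use int in auto)
    moreover have "expectation (\<lambda>\<omega>. (exp (- S n * Z \<omega>) - 1) / S n) = (expectation (\<lambda>\<omega>. exp (- S n * Z \<omega>)) - 1) / S n" for n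
      using Bochner_Integration.integral_diff[OF intexp[of "S n"] integrable_const[of 1]] S(1)[of n] by (simp add: prob_space)
    ultimately show "(\<lambda>n. (expectation (\<lambda>\<omega>. exp (- S n * Z \<omega>)) - 1) / S n) \<longlonglongrightarrow> - expectation Z"
      by (simp only: Bochner_Integration.integral_minus)
  qed simp
  then show ?thesis
    by (simp add: has_field_derivative_iff at_within_Ici_at_right prob_space)
qed

lemma (in prob_space) laplace_transform_at_0:
  assumes [measurable]: "Z \<in> borel_measurable M" and nn: "AE \<omega> in M. (0::real) \<le> Z \<omega>"
  shows "((\<lambda>\<theta>. expectation (\<lambda>\<omega>. exp (- \<theta> * Z \<omega>))) \<longlongrightarrow> 1) (at_right 0)"
proof (rule tendsto_at_right_sequentially[of 0 1])
  fix S :: "nat \<Rightarrow> real"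
  assume S: "\<And>n. 0 < S n" "S \<longlonglongrightarrow> 0"
  have "(\<lambda>n. expectation (\<lambda>\<omega>. exp (- S n * Z \<omega>))) \<longlonglongrightarrow> expectation (\<lambda>\<omega>. exp (- 0 * Z \<omega>))"
  proof (rule integral_dominated_convergence[where w="\<lambda>_. 1"])
    show "AE \<omega> in M. (\<lambda>n. exp (- S n * Z \<omega>)) \<longlonglongrightarrow> exp (- 0 * Z \<omega>)"
      by (intro AE_I2 tendsto_intros S)
    show "AE \<omega> in M. norm (exp (- S n * Z \<omega>)) \<le> 1" for n
      using nn by eventually_elim (use S(1)[of n] in simp)
  qed auto
  then show "(\<lambda>n. expectation (\<lambda>\<omega>. exp (- S n * Z \<omega>))) \<longlonglongrightarrow> 1"
    by (simp add: prob_space)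
qed simp

text \<open>Convolutions, mixtures and densities are computed with the nonnegative integral, where Tonelli's
  theorem is available; this lemma converts the result.\<close>

lemma enn_laplace:
  assumes [measurable_cong]: "sets A = sets borel"
  shows "(\<integral>x. exp (- \<theta> * x) \<partial>A) = enn2real (\<integral>\<^sup>+x. ennreal (exp (- \<theta> * x)) \<partial>A)"
  by (rule integral_eq_nn_integral) auto

lemma AE_nonneg_iff_nn_integral:
  assumes [measurable_cong]: "sets A = sets borel"
  shows "(AE x in A. (0::real) \<le> x) \<longleftrightarrow> (\<integral>\<^sup>+x. indicator {..<0} x \<partial>A) = 0"
  by (subst nn_integral_0_iff_AE) (auto simp: indicator_def not_less split: if_splits)

lemma laplace_convolution:
  fixes A B :: "real measure"
  assumes A: "prob_space A" "sets A = sets borel" and B: "prob_space B" "sets B = sets borel"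
  shows "(\<integral>x. exp (- \<theta> * x) \<partial>(A \<star> B)) = (\<integral>x. exp (- \<theta> * x) \<partial>A) * (\<integral>x. exp (- \<theta> * x) \<partial>B)"
proof -
  note [measurable_cong] = A(2) B(2)
  have fin: "finite_measure A" "finite_measure B" using A B by (auto simp: prob_space_def)
  have "(\<integral>\<^sup>+x. ennreal (exp (- \<theta> * x)) \<partial>(A \<star> B)) = (\<integral>\<^sup>+x. \<integral>\<^sup>+y. ennreal (exp (- \<theta> * (x + y))) \<partial>B \<partial>A)"
    by (rule nn_integral_convolution[OF fin B(2) A(2)]) measurable
  also have "\<dots> = (\<integral>\<^sup>+x. \<integral>\<^sup>+y. ennreal (exp (- \<theta> * x)) * ennreal (exp (- \<theta> * y)) \<partial>B \<partial>A)"
    by (simp add: distrib_left exp_diff exp_minus field_simps flip: ennreal_mult exp_add)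
  also have "\<dots> = (\<integral>\<^sup>+x. ennreal (exp (- \<theta> * x)) \<partial>A) * (\<integral>\<^sup>+x. ennreal (exp (- \<theta> * x)) \<partial>B)"
    by (simp add: nn_integral_cmult nn_integral_multc)
  finally show ?thesis
    by (simp only: enn_laplace A(2) B(2) sets_convolution enn2real_mult)
qed

lemma prob_space_convolution:
  fixes A B :: "real measure"
  assumes A: "prob_space A" "sets A = sets borel" and B: "prob_space B" "sets B = sets borel"
  shows "prob_space (A \<star> B)"
proof -
  note [measurable_cong] = A(2) B(2)
  interpret A: prob_space A by fact
  interpret B: prob_space B by fact
  interpret pair_prob_space A B ..
  show ?thesis unfolding convolution_def by (rule P.prob_space_distr) measurable
qed

lemma convolution_nonneg:
  fixes A B :: "real measure"
  assumes A: "prob_space A" "sets A = sets borel" "AE x in A. 0 \<le> x"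
    and B: "prob_space B" "sets B = sets borel" "AE x in B. 0 \<le> x"
  shows "AE x in A \<star> B. 0 \<le> x"
proof -
  have fin: "finite_measure A" "finite_measure B" using A B by (auto simp: prob_space_def)
  have "(\<integral>\<^sup>+x. indicator {..<0} x \<partial>(A \<star> B)) = (\<integral>\<^sup>+x. \<integral>\<^sup>+y. indicator {..<0} (x + y) \<partial>B \<partial>A)"
    by (rule nn_integral_convolution[OF fin B(2) A(2)]) measurable
  also have "\<dots> = (\<integral>\<^sup>+x. 0 \<partial>A)"
  proof (rule nn_integral_cong_AE)
    show "AE x in A. (\<integral>\<^sup>+y. indicator {..<0} (x + y) \<partial>B) = 0"
      using A(3)
    proof eventually_elim
      case (elim x)
      have "(\<integral>\<^sup>+y. indicator {..<0} (x + y) \<partial>B) = (\<integral>\<^sup>+y. 0 \<partial>B)"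
        by (rule nn_integral_cong_AE) (use B(3) in eventually_elim, use elim in simp)
      then show ?case by simp
    qed
  qed
  finally show ?thesis by (simp add: AE_nonneg_iff_nn_integral)
qed

lemma sets_mixture:
  assumes "sets A = sets borel" "sets B = sets borel" shows "sets (mixture p A B) = sets borel"
  unfolding mixture_def using assms by (subst sets_bind[where N=borel]) auto

lemma nn_integral_mixture:
  assumes A: "prob_space A" "sets A = sets borel" and B: "prob_space B" "sets B = sets borel"
    and p: "0 \<le> p" "p \<le> 1" and f: "f \<in> borel_measurable borel"
  shows "(\<integral>\<^sup>+x. f x \<partial>mixture p A B) = ennreal p * (\<integral>\<^sup>+x. f x \<partial>A) + ennreal (1 - p) * (\<integral>\<^sup>+x. f x \<partial>B)"
proof -
  have "(\<lambda>b. if b then A else B) \<in> measurable (measure_pmf (bernoulli_pmf p)) (subprob_algebra borel)"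
    using A B by (auto simp: space_subprob_algebra prob_space_imp_subprob_space)
  from nn_integral_bind[OF f this]
  have "(\<integral>\<^sup>+x. f x \<partial>mixture p A B) = (\<integral>\<^sup>+b. \<integral>\<^sup>+x. f x \<partial>(if b then A else B) \<partial>measure_pmf (bernoulli_pmf p))"
    unfolding mixture_def .
  also have "\<dots> = ennreal p * (\<integral>\<^sup>+x. f x \<partial>A) + ennreal (1 - p) * (\<integral>\<^sup>+x. f x \<partial>B)"
    using p by (subst nn_integral_bernoulli_pmf) (auto simp: mult.commute)
  finally show ?thesis .
qed

lemma
  assumes A: "prob_space A" "sets A = sets borel" and B: "prob_space B" "sets B = sets borel"
    and p: "0 \<le> p" "p \<le> 1"
  shows prob_space_mixture: "prob_space (mixture p A B)"
    and laplace_mixture: "AE x in A. 0 \<le> x \<Longrightarrow> AE x in B. 0 \<le> x \<Longrightarrow> 0 \<le> \<theta> \<Longrightarrow> (\<integral>x. exp (- \<theta> * x) \<partial>mixture p A B) =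
      p * (\<integral>x. exp (- \<theta> * x) \<partial>A) + (1 - p) * (\<integral>x. exp (- \<theta> * x) \<partial>B)"
    and mixture_nonneg: "AE x in A. 0 \<le> x \<Longrightarrow> AE x in B. 0 \<le> x \<Longrightarrow> AE x in mixture p A B. 0 \<le> x"
proof -
  interpret A: prob_space A by fact
  interpret B: prob_space B by fact
  note sets = sets_mixture[OF A(2) B(2), of p]
  have "emeasure (mixture p A B) (space (mixture p A B)) = (\<integral>\<^sup>+x. 1 \<partial>mixture p A B)" by simp
  also have "\<dots> = ennreal p + ennreal (1 - p)"
    by (subst nn_integral_mixture[OF A B p]) (auto simp: A.emeasure_space_1 B.emeasure_space_1)
  also have "\<dots> = 1" using p by (simp flip: ennreal_plus)
  finally show "prob_space (mixture p A B)" by (rule prob_spaceI)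
  assume nA: "AE x in A. 0 \<le> x" and nB: "AE x in B. 0 \<le> x"
  show "AE x in mixture p A B. 0 \<le> x"
    using nA nB by (simp add: AE_nonneg_iff_nn_integral[OF sets] AE_nonneg_iff_nn_integral[OF A(2)]
        AE_nonneg_iff_nn_integral[OF B(2)] nn_integral_mixture[OF A B p])
  assume th: "0 \<le> \<theta>"
  have fin: "(\<integral>\<^sup>+x. ennreal (exp (- \<theta> * x)) \<partial>C) < \<infinity>" if C: "prob_space C" and n: "AE x in C. 0 \<le> x" for C
  proof -
    interpret C: prob_space C by fact
    have "(\<integral>\<^sup>+x. ennreal (exp (- \<theta> * x)) \<partial>C) \<le> (\<integral>\<^sup>+x. 1 \<partial>C)"
      by (rule nn_integral_mono_AE) (use n in eventually_elim, use th in simp)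
    also have "\<dots> = 1" by (simp add: C.emeasure_space_1)
    finally show ?thesis by (auto simp: less_top[symmetric] top_unique)
  qed
  show "(\<integral>x. exp (- \<theta> * x) \<partial>mixture p A B) = p * (\<integral>x. exp (- \<theta> * x) \<partial>A) + (1 - p) * (\<integral>x. exp (- \<theta> * x) \<partial>B)"
    unfolding enn_laplace[OF sets] enn_laplace[OF A(2)] enn_laplace[OF B(2)]
    using p fin[OF A(1) nA] fin[OF B(1) nB]
    by (subst nn_integral_mixture[OF A B p]) (auto simp: enn2real_plus enn2real_mult ennreal_mult_less_top)
qed

lemma sets_residual_life: "sets (residual_life M Z) = sets borel"
  by (simp add: residual_life_def)

text \<open>By Tonelli, integrating \<open>f x\<close> against \<open>P (Z > x)\<close> is the mean of \<open>\<integral> f\<close> over \<open>[0, Z]\<close>, that is of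
  \<open>G Z\<close> for the antiderivative \<open>G\<close>. The choices \<open>f = 1\<close> and \<open>f x = exp (- \<theta> x)\<close> give total mass and
  Laplace transform.\<close>

lemma (in prob_space) nn_integral_residual_life:
  fixes Z :: "'a \<Rightarrow> real" and f G :: "real \<Rightarrow> real"
  assumes Z[measurable]: "Z \<in> borel_measurable M" and nn: "AE \<omega> in M. 0 \<le> Z \<omega>" and pos: "0 < expectation Z"
    and f[measurable]: "f \<in> borel_measurable borel" and f0: "\<And>x. 0 \<le> f x"
    and G: "\<And>x. (G has_real_derivative f x) (at x)" "G 0 = 0"
  shows "(\<integral>\<^sup>+x. ennreal (f x) \<partial>residual_life M Z) = (\<integral>\<^sup>+\<omega>. ennreal (G (Z \<omega>)) \<partial>M) / ennreal (expectation Z)"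
proof -
  let ?c = "expectation Z"
  let ?i = "\<lambda>x \<omega>. ennreal (f x) * indicator {0..} x * indicator {x<..} (Z \<omega>)"
  interpret L: pair_sigma_finite lborel M ..
  have [measurable]: "(\<lambda>x. measure M {\<omega> \<in> space M. Z \<omega> > x}) \<in> borel_measurable borel"
    by measurable
  have [measurable]: "Measurable.pred (borel \<Otimes>\<^sub>M M) (\<lambda>p. Z (snd p) \<in> {fst p<..})"
    unfolding greaterThan_iff by measurable
  have "(\<integral>\<^sup>+x. ennreal (f x) \<partial>residual_life M Z)
      = (\<integral>\<^sup>+x. ennreal (indicator {0..} x * measure M {\<omega> \<in> space M. Z \<omega> > x} / ?c) * ennreal (f x) \<partial>lborel)"
    unfolding residual_life_def by (subst nn_integral_density) auto
  also have "\<dots> = (\<integral>\<^sup>+x. (\<integral>\<^sup>+\<omega>. ?i x \<omega> \<partial>M) / ennreal ?c \<partial>lborel)"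
  proof (rule nn_integral_cong)
    fix x :: real
    have "(\<integral>\<^sup>+\<omega>. ?i x \<omega> \<partial>M)
        = ennreal (f x) * indicator {0..} x * (\<integral>\<^sup>+\<omega>. indicator {x<..} (Z \<omega>) \<partial>M)"
      by (rule nn_integral_cmult) measurable
    also have "(\<integral>\<^sup>+\<omega>. indicator {x<..} (Z \<omega>) \<partial>M) = (\<integral>\<^sup>+\<omega>. indicator {\<omega> \<in> space M. Z \<omega> > x} \<omega> \<partial>M)"
      by (rule nn_integral_cong) (auto simp: indicator_def)
    also have "\<dots> = ennreal (measure M {\<omega> \<in> space M. Z \<omega> > x})"
      by (simp add: emeasure_eq_measure)
    finally show "ennreal (indicator {0..} x * measure M {\<omega> \<in> space M. Z \<omega> > x} / ?c) * ennreal (f x)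
        = (\<integral>\<^sup>+\<omega>. ?i x \<omega> \<partial>M) / ennreal ?c"
      using pos f0[of x] by (auto simp: indicator_def divide_ennreal mult.commute simp flip: ennreal_mult)
  qed
  also have "\<dots> = (\<integral>\<^sup>+x. \<integral>\<^sup>+\<omega>. ?i x \<omega> \<partial>M \<partial>lborel) / ennreal ?c"
    by (rule nn_integral_divide) measurable
  also have "(\<integral>\<^sup>+x. \<integral>\<^sup>+\<omega>. ?i x \<omega> \<partial>M \<partial>lborel)
      = (\<integral>\<^sup>+\<omega>. \<integral>\<^sup>+x. ?i x \<omega> \<partial>lborel \<partial>M)"
    by (rule L.Fubini'[symmetric]) measurable
  also have "\<dots> = (\<integral>\<^sup>+\<omega>. ennreal (G (Z \<omega>)) \<partial>M)"
  proof (rule nn_integral_cong_AE)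
    show "AE \<omega> in M. (\<integral>\<^sup>+x. ?i x \<omega> \<partial>lborel) = ennreal (G (Z \<omega>))"
      using nn
    proof eventually_elim
      case (elim \<omega>)
      have "(\<integral>\<^sup>+x. ?i x \<omega> \<partial>lborel) =
          (\<integral>\<^sup>+x. ennreal (f x) * indicator {0..Z \<omega>} x \<partial>lborel)"
      proof (rule nn_integral_cong_AE)
        show "AE x in lborel. ?i x \<omega> = ennreal (f x) * indicator {0..Z \<omega>} x"
          using AE_lborel_singleton[of "Z \<omega>"] by eventually_elim (auto simp: indicator_def)
      qed
      also have "\<dots> = ennreal (G (Z \<omega>) - G 0)"
        by (rule nn_integral_FTC_Icc) (use elim f0 G(1) in \<open>auto intro: has_field_derivative_at_within\<close>)
      finally show ?case using G(2) by simp
    qed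
  qed
  finally show ?thesis .
qed

lemma (in prob_space)
  fixes Z :: "'a \<Rightarrow> real"
  assumes Z: "integrable M Z" and nn: "AE \<omega> in M. 0 \<le> Z \<omega>" and pos: "0 < expectation Z"
  shows prob_space_residual_life: "prob_space (residual_life M Z)"
    and residual_life_nonneg: "AE x in residual_life M Z. 0 \<le> x"
    and laplace_residual_life: "0 < \<theta> \<Longrightarrow> (\<integral>x. exp (- \<theta> * x) \<partial>residual_life M Z) =
      (1 - expectation (\<lambda>\<omega>. exp (- \<theta> * Z \<omega>))) / (\<theta> * expectation Z)"
proof -
  have [measurable]: "Z \<in> borel_measurable M" using Z by auto
  have "emeasure (residual_life M Z) (space (residual_life M Z)) = (\<integral>\<^sup>+x. ennreal 1 \<partial>residual_life M Z)" by simp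
  also have "\<dots> = (\<integral>\<^sup>+\<omega>. ennreal (Z \<omega>) \<partial>M) / ennreal (expectation Z)"
    by (rule nn_integral_residual_life[OF _ nn pos, of "\<lambda>_. 1" "\<lambda>x. x"]) (auto intro!: derivative_eq_intros)
  also have "(\<integral>\<^sup>+\<omega>. ennreal (Z \<omega>) \<partial>M) = ennreal (expectation Z)"
    by (rule nn_integral_eq_integral[OF Z nn])
  also have "ennreal (expectation Z) / ennreal (expectation Z) = 1"
    using pos by (simp add: divide_ennreal)
  finally show "prob_space (residual_life M Z)" by (rule prob_spaceI)
  show "AE x in residual_life M Z. 0 \<le> x"
    unfolding residual_life_def by (subst AE_density) (auto simp: indicator_def)
  assume th: "0 < \<theta>"
  let ?G = "\<lambda>x. (1 - exp (- \<theta> * x)) / \<theta>"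
  have int: "integrable M (\<lambda>\<omega>. exp (- \<theta> * Z \<omega>))"
    by (rule integrable_const_bound[where B=1]) (use nn in eventually_elim, use th in auto)
  have "(\<integral>\<^sup>+x. ennreal (exp (- \<theta> * x)) \<partial>residual_life M Z) = (\<integral>\<^sup>+\<omega>. ennreal (?G (Z \<omega>)) \<partial>M) / ennreal (expectation Z)"
    by (rule nn_integral_residual_life[OF _ nn pos]) (use th in \<open>auto intro!: derivative_eq_intros\<close>)
  also have "(\<integral>\<^sup>+\<omega>. ennreal (?G (Z \<omega>)) \<partial>M) = ennreal (expectation (\<lambda>\<omega>. ?G (Z \<omega>)))"
    by (rule nn_integral_eq_integral) (use int in simp, use nn in eventually_elim, use th in simp)
  also have "expectation (\<lambda>\<omega>. ?G (Z \<omega>)) = (1 - expectation (\<lambda>\<omega>. exp (- \<theta> * Z \<omega>))) / \<theta>"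
    using int by (simp add: prob_space)
  finally have L: "(\<integral>\<^sup>+x. ennreal (exp (- \<theta> * x)) \<partial>residual_life M Z) =
    ennreal ((1 - expectation (\<lambda>\<omega>. exp (- \<theta> * Z \<omega>))) / \<theta>) / ennreal (expectation Z)" .
  have "expectation (\<lambda>\<omega>. exp (- \<theta> * Z \<omega>)) \<le> expectation (\<lambda>_. 1)"
    by (rule integral_mono_AE[OF int]) (simp, use nn in eventually_elim, use th in simp)
  then have A: "0 \<le> 1 - expectation (\<lambda>\<omega>. exp (- \<theta> * Z \<omega>))" by (simp add: prob_space)
  have "ennreal ((1 - expectation (\<lambda>\<omega>. exp (- \<theta> * Z \<omega>))) / \<theta>) / ennreal (expectation Z)
      = ennreal ((1 - expectation (\<lambda>\<omega>. exp (- \<theta> * Z \<omega>))) / (\<theta> * expectation Z))"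
    using divide_ennreal[OF divide_nonneg_pos[OF A th] pos] by simp
  moreover have "0 \<le> (1 - expectation (\<lambda>\<omega>. exp (- \<theta> * Z \<omega>))) / (\<theta> * expectation Z)"
    using A th pos by (intro divide_nonneg_pos mult_pos_pos) auto
  ultimately show "(\<integral>x. exp (- \<theta> * x) \<partial>residual_life M Z) = (1 - expectation (\<lambda>\<omega>. exp (- \<theta> * Z \<omega>))) / (\<theta> * expectation Z)"
    unfolding enn_laplace[OF sets_residual_life] L by (simp only: enn2real_ennreal)
qed

section \<open>Convergence in distribution\<close>

text \<open>The bounded continuous function \<open>min 1 (max 0 (- x))\<close> vanishes exactly on the half-line.\<close>

lemma converges_in_distribution_nonneg:
  fixes Z :: "'i \<Rightarrow> 'a \<Rightarrow> real"
  assumes "prob_space N" and Z'[measurable]: "Z' \<in> borel_measurable N"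
    and conv: "converges_in_distribution M Z G N Z'" and G: "G \<noteq> bot"
    and nn: "eventually (\<lambda>i. AE \<omega> in M. 0 \<le> Z i \<omega>) G"
  shows "AE x in N. 0 \<le> Z' x"
proof -
  interpret N: prob_space N by fact
  let ?f = "\<lambda>x::real. min 1 (max 0 (- x))"
  have "((\<lambda>i. \<integral>\<omega>. ?f (Z i \<omega>) \<partial>M) \<longlongrightarrow> (\<integral>x. ?f (Z' x) \<partial>N)) G"
  proof (rule conv[unfolded converges_in_distribution_def, rule_format])
    show "continuous_on UNIV ?f \<and> bounded (range ?f)"
      by (auto intro!: continuous_intros boundedI[where B=1])
  qed
  moreover have "eventually (\<lambda>i. (\<integral>\<omega>. ?f (Z i \<omega>) \<partial>M) = 0) G"
    using nn
  proof eventually_elim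
    case (elim i)
    then have "AE \<omega> in M. ?f (Z i \<omega>) = 0" by eventually_elim simp
    then show ?case by (rule integral_eq_zero_AE)
  qed
  ultimately have "((\<lambda>i. 0::real) \<longlongrightarrow> (\<integral>x. ?f (Z' x) \<partial>N)) G"
    by (rule Lim_transform_eventually)
  then have "(\<integral>x. ?f (Z' x) \<partial>N) = 0"
    using G by (simp add: tendsto_const_iff)
  moreover have "integrable N (\<lambda>x. ?f (Z' x))"
    by (rule N.integrable_const_bound[where B=1]) auto
  ultimately have "AE x in N. ?f (Z' x) = 0"
    by (subst (asm) integral_nonneg_eq_0_iff_AE) auto
  then show ?thesis by eventually_elim (auto simp: min_def max_def split: if_splits)
qed

text \<open>The function \<open>exp (- \<theta> x)\<close> is unbounded on the negative axis. As all variables, including the limit,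
  are almost surely nonnegative, it may be replaced by \<open>exp (- \<theta> (max 0 x))\<close>.\<close>

lemma converges_in_distribution_laplace:
  fixes Z :: "'i \<Rightarrow> 'a \<Rightarrow> real"
  assumes N: "prob_space N" and Z'[measurable]: "Z' \<in> borel_measurable N"
    and conv: "converges_in_distribution M Z G N Z'" and G: "G \<noteq> bot"
    and nn: "eventually (\<lambda>i. Z i \<in> borel_measurable M \<and> (AE \<omega> in M. 0 \<le> Z i \<omega>)) G"
    and th: "0 \<le> \<theta>"
  shows "((\<lambda>i. \<integral>\<omega>. exp (- \<theta> * Z i \<omega>) \<partial>M) \<longlongrightarrow> (\<integral>x. exp (- \<theta> * Z' x) \<partial>N)) G"
proof -
  let ?f = "\<lambda>x::real. exp (- \<theta> * max 0 x)"
  have "((\<lambda>i. \<integral>\<omega>. ?f (Z i \<omega>) \<partial>M) \<longlongrightarrow> (\<integral>x. ?f (Z' x) \<partial>N)) G"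
  proof (rule conv[unfolded converges_in_distribution_def, rule_format])
    show "continuous_on UNIV ?f \<and> bounded (range ?f)"
      using th by (auto intro!: continuous_intros boundedI[where B=1])
  qed
  moreover have "eventually (\<lambda>i. (\<integral>\<omega>. ?f (Z i \<omega>) \<partial>M) = (\<integral>\<omega>. exp (- \<theta> * Z i \<omega>) \<partial>M)) G"
    using nn
  proof eventually_elim
    case (elim i)
    then have [measurable]: "Z i \<in> borel_measurable M" by simp
    have "AE \<omega> in M. ?f (Z i \<omega>) = exp (- \<theta> * Z i \<omega>)"
      using elim[THEN conjunct2] by eventually_elim simp
    then show ?case by (intro integral_cong_AE) auto
  qed
  moreover have "(\<integral>x. ?f (Z' x) \<partial>N) = (\<integral>x. exp (- \<theta> * Z' x) \<partial>N)"
  proof (rule integral_cong_AE)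
    have "AE x in N. 0 \<le> Z' x"
      by (rule converges_in_distribution_nonneg[OF N Z' conv G]) (use nn in \<open>eventually_elim, simp\<close>)
    then show "AE x in N. ?f (Z' x) = exp (- \<theta> * Z' x)" by eventually_elim simp
  qed auto
  ultimately show ?thesis by (simp only:) (rule Lim_transform_eventually)
qed

lemma converges_in_distribution_continuous_map:
  fixes Z :: "'i \<Rightarrow> 'a \<Rightarrow> 'c :: topological_space" and g :: "'c \<Rightarrow> 'd :: topological_space"
  assumes conv: "converges_in_distribution M Z G N Z'" and g: "continuous_on UNIV g"
  shows "converges_in_distribution M (\<lambda>i \<omega>. g (Z i \<omega>)) G N (\<lambda>x. g (Z' x))"
  unfolding converges_in_distribution_def
proof (intro allI impI, elim conjE)
  fix f :: "'d \<Rightarrow> real" assume f: "continuous_on UNIV f" "bounded (range f)"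
  have "continuous_on UNIV (\<lambda>z. f (g z))"
    by (rule continuous_on_compose2[OF f(1) g]) simp
  moreover have "bounded (range (\<lambda>z. f (g z)))"
    by (rule bounded_subset[OF f(2)]) auto
  ultimately show "((\<lambda>i. \<integral>\<omega>. f (g (Z i \<omega>)) \<partial>M) \<longlongrightarrow> (\<integral>x. f (g (Z' x)) \<partial>N)) G"
    using conv[unfolded converges_in_distribution_def, rule_format, of "\<lambda>z. f (g z)"] by blast
qed

section \<open>Event counts and renewal rewards\<close>

text \<open>Divergence of the event times makes the set inside \<^const>\<open>num_until\<close> finite, so that its supremum is
  its maximum and not a default value.\<close>

lemma num_until_range:
  fixes T :: "nat \<Rightarrow> 'a \<Rightarrow> ennreal"
  assumes inc: "\<And>n. 1 \<le> n \<Longrightarrow> T n \<omega> < T (Suc n) \<omega>" and unb: "\<exists>n\<ge>1. ennreal t < T n \<omega>"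
  shows "{1..num_until T t \<omega>} = {i. 1 \<le> i \<and> T i \<omega> \<le> ennreal t}"
proof -
  let ?S = "{i. 1 \<le> i \<and> T i \<omega> \<le> ennreal t}"
  have mono: "T i \<omega> \<le> T j \<omega>" if "1 \<le> i" "i \<le> j" for i j
    using that(2)
  proof (induction rule: dec_induct)
    case (step k)
    with inc[of k] that(1) show ?case by (simp add: order_less_imp_le order_trans)
  qed simp
  obtain n where n: "1 \<le> n" "ennreal t < T n \<omega>" using unb by auto
  have "?S \<subseteq> {..n}"
  proof
    fix i assume i: "i \<in> ?S"
    show "i \<in> {..n}"
    proof (rule ccontr)
      assume "i \<notin> {..n}"
      then have "T n \<omega> \<le> T i \<omega>" using mono[OF n(1), of i] by simp
      with i n show False by auto
    qed
  qed
  then have fin: "finite ?S" by (rule finite_subset) simp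
  show ?thesis
  proof (cases "?S = {}")
    case True
    then show ?thesis unfolding num_until_def Sup_nat_def by simp
  next
    case False
    have "T i \<omega> \<le> ennreal t" if "1 \<le> i" "i \<le> Max ?S" for i
      using Max_in[OF fin False] mono[OF that] by (auto intro: order_trans)
    then have "{1..Max ?S} = ?S" using Max_ge[OF fin] by force
    with False show ?thesis unfolding num_until_def Sup_nat_def by simp
  qed
qed

lemma num_until_measurable[measurable]:
  assumes [measurable]: "\<And>n. 1 \<le> n \<Longrightarrow> T n \<in> borel_measurable M"
  shows "(\<lambda>\<omega>. num_until T t \<omega>) \<in> M \<rightarrow>\<^sub>M count_space UNIV"
proof -
  have "Measurable.pred M (\<lambda>\<omega>. i \<in> {n. 1 \<le> n \<and> T n \<omega> \<le> ennreal t})" for i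
    by (cases "1 \<le> i") simp_all
  then show ?thesis unfolding num_until_def by (intro measurable_Sup_nat)
qed

text \<open>Measurability on all of \<^term>\<open>space M\<close>, also where the event times accumulate and \<^const>\<open>num_until\<close>
  is arbitrary, since the number of summands is always a measurable natural number.\<close>

lemma random_sum_measurable:
  fixes g :: "nat \<Rightarrow> 'a \<Rightarrow> real"
  assumes "\<And>n. 1 \<le> n \<Longrightarrow> T n \<in> borel_measurable M" and [measurable]: "\<And>n. 1 \<le> n \<Longrightarrow> g n \<in> borel_measurable M"
  shows "(\<lambda>\<omega>. \<Sum>i=1..num_until T t \<omega>. g i \<omega>) \<in> borel_measurable M"
proof (rule measurable_compose_countable[where f="\<lambda>n \<omega>. \<Sum>i=1..n. g i \<omega>"])
  show "(\<lambda>\<omega>. \<Sum>i=1..n. g i \<omega>) \<in> borel_measurable M" for n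
    by (intro borel_measurable_sum) simp
qed (rule num_until_measurable[OF assms(1)])

text \<open>The point \<open>\<omega>\<close> is fixed: the facts of this locale are pathwise and are later used almost surely.\<close>

locale arrival_times =
  fixes T :: "nat \<Rightarrow> 'a \<Rightarrow> ennreal" and \<omega> :: 'a
  assumes inc: "1 \<le> n \<Longrightarrow> T n \<omega> < T (Suc n) \<omega>" and unb: "\<exists>n\<ge>1. ennreal t < T n \<omega>"
begin

abbreviation "cnt t \<equiv> num_until T t \<omega>"

lemma in_range_iff: "i \<in> {1..cnt t} \<longleftrightarrow> 1 \<le> i \<and> T i \<omega> \<le> ennreal t"
  using num_until_range[of T \<omega> t, OF inc unb] by simp

lemma cnt_ge_iff: "1 \<le> i \<Longrightarrow> i \<le> cnt t \<longleftrightarrow> T i \<omega> \<le> ennreal t"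
  using in_range_iff[of i t] by simp

lemma finite_time: "1 \<le> i \<Longrightarrow> ennreal (enn2real (T i \<omega>)) = T i \<omega>"
  by (rule ennreal_enn2real) (rule less_le_trans[OF inc top_greatest])

lemma strict: "1 \<le> i \<Longrightarrow> i < j \<Longrightarrow> T i \<omega> < T j \<omega>"
proof (induction j)
  case (Suc j)
  show ?case
  proof (cases "i = j")
    case False
    then have "T i \<omega> < T j \<omega>" using Suc by simp
    also have "T j \<omega> < T (Suc j) \<omega>" using Suc.prems by (intro inc) simp
    finally show ?thesis .
  qed (use Suc.prems in \<open>simp add: inc\<close>)
qed simp

lemma inj: "inj_on (\<lambda>i. enn2real (T i \<omega>)) {1..}"
proof (rule inj_onI)
  fix i j assume ij: "i \<in> {1..}" "j \<in> {1..}" and eq: "enn2real (T i \<omega>) = enn2real (T j \<omega>)"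
  have "T i \<omega> = ennreal (enn2real (T i \<omega>))" using ij by (intro finite_time[symmetric]) simp
  also have "\<dots> = T j \<omega>" unfolding eq using ij by (intro finite_time) simp
  finally have "\<not> T i \<omega> < T j \<omega>" "\<not> T j \<omega> < T i \<omega>" by simp_all
  then have "\<not> i < j" "\<not> j < i" using strict[of i j] strict[of j i] ij by auto
  then show "i = j" by simp
qed

lemma cnt_mono: "s \<le> t \<Longrightarrow> cnt s \<le> cnt t"
proof (cases "cnt s = 0")
  case False
  assume "s \<le> t"
  then have "ennreal s \<le> ennreal t" by (rule ennreal_leI)
  moreover have "T (cnt s) \<omega> \<le> ennreal s" using False cnt_ge_iff[of "cnt s" s] by simp
  ultimately show ?thesis using False cnt_ge_iff[of "cnt s" t] by simp
qed simp

lemma cnt_at: assumes "1 \<le> i" shows "cnt (enn2real (T i \<omega>)) = i"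
proof (rule antisym)
  let ?t = "enn2real (T i \<omega>)"
  show "i \<le> cnt ?t" using cnt_ge_iff[OF assms, of ?t] finite_time[OF assms] by simp
  show "cnt ?t \<le> i"
  proof (rule ccontr)
    assume "\<not> cnt ?t \<le> i"
    then have "T (Suc i) \<omega> \<le> T i \<omega>"
      using cnt_ge_iff[of "Suc i" ?t] finite_time[OF assms] by simp
    then show False using inc[OF assms] by simp
  qed
qed

lemma next_after: "ennreal t < T (Suc (cnt t)) \<omega>"
  using cnt_ge_iff[of "Suc (cnt t)" t] by (simp add: not_le)

lemma cnt_right_constant:
  assumes "0 \<le> t" shows "eventually (\<lambda>s. cnt s = cnt t) (at_right t)"
proof -
  let ?u = "enn2real (T (Suc (cnt t)) \<omega>)"
  have u: "ennreal ?u = T (Suc (cnt t)) \<omega>" by (rule finite_time) simp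
  have "ennreal t < ennreal ?u" unfolding u by (rule next_after)
  then have "t < ?u" using assms by (simp add: ennreal_less_iff)
  then have "eventually (\<lambda>s. s < ?u) (at_right t)"
    by (intro order_tendstoD(2)[OF tendsto_ident_at])
  with eventually_at_right_less[of t] show ?thesis
  proof eventually_elim
    case (elim s)
    have "ennreal s < ennreal ?u" using elim assms by (intro ennreal_lessI) auto
    then have "\<not> Suc (cnt t) \<le> cnt s" using cnt_ge_iff[of "Suc (cnt t)" s] u by simp
    then show ?case using cnt_mono[of t s] elim by simp
  qed
qed

end

text \<open>In the series every summand is known at time \<open>s\<close> when \<open>g i\<close> is known at the \<open>i\<close>-th event time; this
  form shows that the random sum is adapted.\<close>

lemma (in arrival_times) random_sum_as_series:
  "(\<Sum>i=1..cnt s. g i) = (\<Sum>i. if T (Suc i) \<omega> \<le> ennreal s then g (Suc i) else (0::real))"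
proof -
  have "(\<Sum>i. if T (Suc i) \<omega> \<le> ennreal s then g (Suc i) else 0)
      = (\<Sum>i<cnt s. if T (Suc i) \<omega> \<le> ennreal s then g (Suc i) else 0)"
  proof (rule suminf_finite)
    fix i assume "i \<notin> {..<cnt s}"
    then show "(if T (Suc i) \<omega> \<le> ennreal s then g (Suc i) else 0) = 0"
      using cnt_ge_iff[of "Suc i" s] by auto
  qed simp
  also have "\<dots> = (\<Sum>i<cnt s. g (Suc i))"
  proof (rule sum.cong[OF refl])
    fix i assume "i \<in> {..<cnt s}"
    then show "(if T (Suc i) \<omega> \<le> ennreal s then g (Suc i) else 0) = g (Suc i)"
      using cnt_ge_iff[of "Suc i" s] by simp
  qed
  also have "\<dots> = (\<Sum>i=1..cnt s. g i)"
    by (simp add: sum.atLeast1_atMost_eq)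
  finally show ?thesis by simp
qed

text \<open>These two facts translate \<open>T n > t\<close> and \<open>T n \<le> t\<close> into a deviation of \<open>T n / n\<close> from its limit
  \<open>c\<close>, including the case of an infinite event time.\<close>

lemma late_event_deviates:
  assumes "1 \<le> n" "0 \<le> t" "ennreal t < x" "c + \<epsilon> < t / real n"
  shows "ereal \<epsilon> < \<bar>enn2ereal x / ereal (real n) - ereal c\<bar>"
proof (cases x)
  case (real u)
  with assms have "t < u" by (simp add: ennreal_less_iff)
  then have "t / real n \<le> u / real n" by (intro divide_right_mono) auto
  with assms have "\<epsilon> < \<bar>u / real n - c\<bar>" by linarith
  with real assms(1) show ?thesis by simp
next
  case top
  then show ?thesis using assms by simp
qed

lemma early_event_deviates:
  assumes "1 \<le> n" "0 \<le> t" "x \<le> ennreal t" "t / real n < c - \<epsilon>"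
  shows "ereal \<epsilon> < \<bar>enn2ereal x / ereal (real n) - ereal c\<bar>"
proof (cases x)
  case (real u)
  with assms have "u \<le> t" by (simp add: ennreal_le_iff)
  then have "u / real n \<le> t / real n" by (intro divide_right_mono) auto
  with assms have "\<epsilon> < \<bar>u / real n - c\<bar>" by linarith
  with real assms(1) show ?thesis by simp
next
  case top
  then show ?thesis using assms by (simp add: top_unique)
qed

context prob_space begin

text \<open>If all events happened before \<open>m\<close>, then \<open>T n / n\<close> would stay below half of its limit for all large
  \<open>n\<close>; the probability of this is smaller than a null sequence.\<close>

lemma AE_unbounded_of_rate:
  fixes T :: "nat \<Rightarrow> 'a \<Rightarrow> ennreal"
  assumes lam: "0 < lam" and [measurable]: "\<And>n. 1 \<le> n \<Longrightarrow> T n \<in> borel_measurable M"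
    and rate: "converges_in_probability M (\<lambda>n \<omega>. enn2ereal (T n \<omega>) / ereal (real n)) (1 / lam)"
  shows "AE \<omega> in M. \<forall>t. \<exists>n\<ge>1. ennreal t < T n \<omega>"
proof -
  let ?B = "\<lambda>m::nat. {\<omega>\<in>space M. \<forall>n\<ge>1. T n \<omega> \<le> ennreal (real m)}"
  have [measurable]: "?B m \<in> sets M" for m
  proof -
    have "?B m = (\<Inter>n. {\<omega>\<in>space M. T (Suc n) \<omega> \<le> ennreal (real m)})"
      by (auto simp: Suc_le_eq gr0_conv_Suc)
    also have "\<dots> \<in> sets M" by measurable
    finally show ?thesis .
  qed
  have "prob (?B m) = 0" for m
  proof -
    define \<epsilon> where "\<epsilon> = 1 / (2 * lam)"
    let ?D = "\<lambda>n. {\<omega> \<in> space M. \<bar>enn2ereal (T n \<omega>) / ereal (real n) - ereal (1 / lam)\<bar> > ereal \<epsilon>}"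
    have lim: "(\<lambda>n. prob (?D n)) \<longlonglongrightarrow> 0"
      using rate lam by (auto simp: converges_in_probability_def \<epsilon>_def)
    have "eventually (\<lambda>n. real m / real n < 1 / lam - \<epsilon>) sequentially"
      by (rule order_tendstoD[where y=0]) (use lam in \<open>auto simp: \<epsilon>_def field_simps intro!: tendsto_divide_0[OF tendsto_const] filterlim_at_top_imp_at_infinity filterlim_real_sequentially\<close>)
    then have "eventually (\<lambda>n. prob (?B m) \<le> prob (?D n)) sequentially"
      using eventually_ge_at_top[of 1]
    proof eventually_elim
      case (elim n)
      then have [measurable]: "T n \<in> borel_measurable M" by auto
      show ?case
        by (rule finite_measure_mono) (use elim in \<open>auto intro!: early_event_deviates[of n "real m"]\<close>)
    qed
    then have "prob (?B m) \<le> 0"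
      by (rule tendsto_lowerbound[OF lim]) simp
    then show ?thesis by (simp add: measure_le_0_iff)
  qed
  then have "AE \<omega> in M. \<omega> \<notin> ?B m" for m
    by (subst prob_eq_0[symmetric]) auto
  then have "AE \<omega> in M. \<forall>m. \<omega> \<notin> ?B m"
    by (simp only: AE_all_countable) auto
  with AE_space show ?thesis
  proof eventually_elim
    case (elim \<omega>)
    show ?case
    proof
      fix t :: real
      obtain m :: nat where "t \<le> real m" using real_arch_simple by auto
      then have "ennreal t \<le> ennreal (real m)" by (simp add: ennreal_leI)
      moreover obtain n where "1 \<le> n" "ennreal (real m) < T n \<omega>"
        using elim by (auto simp: not_le)
      ultimately show "\<exists>n\<ge>1. ennreal t < T n \<omega>" using le_less_trans by blast
    qed
  qed
qed

text \<open>For \<open>l < lam\<close> put \<open>n = \<lfloor>l t\<rfloor>\<close>. The first \<open>n\<close> events have happened by time \<open>t\<close> except on an event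
  whose probability tends to \<open>0\<close>, and there the first \<open>n\<close> rewards are at most \<open>n K\<close>. So the mean reward
  is at least the sum of the first \<open>n\<close> means minus \<open>n K\<close> times that probability. Rewards may be
  correlated with the counts, so a matching upper bound has to come from elsewhere.\<close>

lemma renewal_reward_lower_bound:
  fixes T :: "nat \<Rightarrow> 'a \<Rightarrow> ennreal" and g :: "nat \<Rightarrow> 'a \<Rightarrow> real"
  assumes lam: "0 < lam" and T[measurable]: "\<And>n. 1 \<le> n \<Longrightarrow> T n \<in> borel_measurable M"
    and inc: "AE \<omega> in M. \<forall>n\<ge>1. T n \<omega> < T (Suc n) \<omega>"
    and rate: "converges_in_probability M (\<lambda>n \<omega>. enn2ereal (T n \<omega>) / ereal (real n)) (1 / lam)"
    and g[measurable]: "\<And>n. 1 \<le> n \<Longrightarrow> g n \<in> borel_measurable M"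
    and g_bounds: "AE \<omega> in M. \<forall>n\<ge>1. 0 \<le> g n \<omega> \<and> g n \<omega> \<le> K"
    and g_mean: "(\<lambda>n. expectation (g n)) \<longlonglongrightarrow> m"
    and int: "\<And>t. 0 \<le> t \<Longrightarrow> integrable M (\<lambda>\<omega>. \<Sum>i=1..num_until T t \<omega>. g i \<omega>)"
    and c: "c < lam * m"
  shows "eventually (\<lambda>t. c < expectation (\<lambda>\<omega>. \<Sum>i=1..num_until T t \<omega>. g i \<omega>) / t) at_top"
proof -
  let ?G = "\<lambda>t \<omega>. \<Sum>i=1..num_until T t \<omega>. g i \<omega>"
  have nn: "0 \<le> expectation (?G t)" for t
    by (rule integral_nonneg_AE) (use g_bounds in \<open>eventually_elim, auto intro!: sum_nonneg\<close>)
  show ?thesis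
  proof (cases "c < 0")
    case True
    show ?thesis
      using eventually_gt_at_top[of 0]
      by eventually_elim (use True nn in \<open>auto intro: less_le_trans\<close>)
  next
    case False
    have "AE \<omega> in M. 0 \<le> K"
      using g_bounds by eventually_elim (meson order_trans order_refl)
    then have K: "0 \<le> K" by simp
    have unb: "AE \<omega> in M. \<forall>t. \<exists>n\<ge>1. ennreal t < T n \<omega>"
      by (rule AE_unbounded_of_rate[OF lam T rate])
    have gint: "integrable M (g i)" if "1 \<le> i" for i
      by (rule integrable_const_bound[where B=K]) (use g_bounds that in \<open>auto elim!: eventually_mono\<close>)
    \<comment> \<open>Choose \<open>m2 < m1 < m\<close> and \<open>l < lam\<close> with \<open>c < l m2\<close>; the gap between \<open>m2\<close> and \<open>m1\<close> absorbs the exceptional event.\<close>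
    obtain m2 where m2: "c / lam < m2" "m2 < m"
      using dense[of "c / lam" m] c lam by (auto simp: field_simps)
    then have m2p: "0 < m2" using False lam by (smt (verit) divide_nonneg_pos)
    obtain l where l: "c / m2 < l" "l < lam"
      using dense[of "c / m2" lam] m2 m2p lam by (auto simp: field_simps)
    then have lp: "0 < l" using False m2p by (smt (verit) divide_nonneg_pos)
    define m1 where "m1 = (m2 + m) / 2"
    have m1: "m2 < m1" "m1 < m" using m2 by (auto simp: m1_def)
    define n where "n t = nat \<lfloor>l * t\<rfloor>" for t
    have n_top: "filterlim n sequentially at_top"
      unfolding n_def using lp
      by (intro filterlim_compose[OF filterlim_nat_sequentially] filterlim_compose[OF filterlim_floor_sequentially] filterlim_tendsto_pos_mult_at_top[OF tendsto_const]) (auto intro: filterlim_ident)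
    obtain i0 where i0: "\<And>i. i0 \<le> i \<Longrightarrow> m1 \<le> expectation (g i)"
      using order_tendstoD(1)[OF g_mean m1(2)] by (auto simp: eventually_sequentially intro: less_imp_le)
    define \<epsilon> where "\<epsilon> = (1 / l - 1 / lam) / 2"
    have ep: "0 < \<epsilon>" using l lp by (auto simp: \<epsilon>_def field_simps)
    let ?P = "\<lambda>n. prob {\<omega> \<in> space M. \<bar>enn2ereal (T n \<omega>) / ereal (real n) - ereal (1 / lam)\<bar> > ereal \<epsilon>}"
    have "?P \<longlonglongrightarrow> 0"
      using rate ep by (auto simp: converges_in_probability_def)
    then have "(\<lambda>n. K * ?P n) \<longlonglongrightarrow> 0" by (rule tendsto_mult_right_zero)
    then have "eventually (\<lambda>n. K * ?P n < m1 - m2) sequentially"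
      using m1 by (intro order_tendstoD) auto
    then have ev1: "eventually (\<lambda>t. K * ?P (n t) < m1 - m2) at_top"
      by (rule eventually_compose_filterlim[OF _ n_top])
    have ev2: "eventually (\<lambda>t. Suc i0 \<le> n t) at_top"
      using eventually_compose_filterlim[OF eventually_ge_at_top n_top] by blast
    from ev1 ev2 eventually_gt_at_top[of 0]
      eventually_gt_at_top[of "(m2 + i0 * m1) / (l * m2 - c)"]
    show ?thesis
    proof eventually_elim
      case (elim t)
      let ?n = "n t"
      let ?E = "{\<omega> \<in> space M. \<bar>enn2ereal (T ?n \<omega>) / ereal (real ?n) - ereal (1 / lam)\<bar> > ereal \<epsilon>}"
      have n1: "1 \<le> ?n" using elim by auto
      then have [measurable]: "T ?n \<in> borel_measurable M" by auto
      have nle: "real ?n \<le> l * t" "l * t - 1 \<le> real ?n"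
        unfolding n_def using lp elim by (auto simp: of_nat_nat)
      have large: "1 / lam + \<epsilon> < t / real ?n"
      proof -
        have "1 / lam + \<epsilon> < 1 / l" using ep by (auto simp: \<epsilon>_def field_simps)
        also have "1 / l \<le> t / real ?n" using nle n1 lp by (simp add: field_simps)
        finally show ?thesis .
      qed
      have "AE \<omega> in M. (\<Sum>i=1..?n. g i \<omega>) - real ?n * K * indicator ?E \<omega> \<le> ?G t \<omega>"
        using g_bounds inc unb AE_space
      proof eventually_elim
        case (elim \<omega>)
        have rng: "{1..num_until T t \<omega>} = {i. 1 \<le> i \<and> T i \<omega> \<le> ennreal t}"
          by (rule num_until_range) (use elim in auto)
        show ?case
        proof (cases "\<omega> \<in> ?E")
          case False
          then have "T ?n \<omega> \<le> ennreal t"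
            using late_event_deviates[OF n1 _ _ large, of "T ?n \<omega>"] \<open>0 < t\<close> elim by (auto simp: not_less intro: leI)
          then have "?n \<in> {1..num_until T t \<omega>}" using n1 unfolding rng by simp
          then have "(\<Sum>i=1..?n. g i \<omega>) \<le> ?G t \<omega>"
            using elim by (intro sum_mono2) auto
          with False show ?thesis by simp
        next
          case True
          have "(\<Sum>i=1..?n. g i \<omega>) \<le> (\<Sum>i=1..?n. K)" using elim by (intro sum_mono) auto
          moreover have "0 \<le> ?G t \<omega>" using elim by (intro sum_nonneg) auto
          ultimately show ?thesis using True by simp
        qed
      qed
      then have "expectation (\<lambda>\<omega>. (\<Sum>i=1..?n. g i \<omega>) - real ?n * K * indicator ?E \<omega>) \<le> expectation (?G t)"
        by (intro integral_mono_AE int)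
           (use \<open>0 < t\<close> in \<open>auto intro!: Bochner_Integration.integrable_diff Bochner_Integration.integrable_sum
              integrable_mult_right integrable_real_indicator gint simp: emeasure_eq_measure\<close>)
      also have "expectation (\<lambda>\<omega>. (\<Sum>i=1..?n. g i \<omega>) - real ?n * K * indicator ?E \<omega>)
          = expectation (\<lambda>\<omega>. \<Sum>i=1..?n. g i \<omega>) - expectation (\<lambda>\<omega>. real ?n * K * indicator ?E \<omega>)"
        by (rule Bochner_Integration.integral_diff)
           (auto intro!: Bochner_Integration.integrable_sum integrable_mult_right integrable_real_indicator gint simp: emeasure_eq_measure)
      also have "\<dots> = (\<Sum>i=1..?n. expectation (g i)) - real ?n * K * prob ?E"
        by (subst Bochner_Integration.integral_sum) (auto intro: gint)
      finally have 1: "(\<Sum>i=1..?n. expectation (g i)) - real ?n * K * prob ?E \<le> expectation (?G t)" .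
      have "real (?n - i0) * m1 \<le> (\<Sum>i\<in>{Suc i0..?n}. expectation (g i))"
        using sum_mono[of "{Suc i0..?n}" "\<lambda>_. m1" "\<lambda>i. expectation (g i)"] i0 by auto
      also have "\<dots> \<le> (\<Sum>i=1..?n. expectation (g i))"
      proof (rule sum_mono2)
        fix b assume "b \<in> {1..?n} - {Suc i0..?n}"
        then show "0 \<le> expectation (g b)"
          using g_bounds by (intro integral_nonneg_AE) (auto elim!: eventually_mono)
      qed auto
      finally have 2: "(real ?n - real i0) * m1 \<le> (\<Sum>i=1..?n. expectation (g i))"
        using elim by (simp add: of_nat_diff)
      have "real ?n * (K * prob ?E) \<le> real ?n * (m1 - m2)"
        using elim by (intro mult_left_mono) auto
      with 1 2 have "real ?n * m2 - real i0 * m1 \<le> expectation (?G t)"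
        by (simp add: algebra_simps)
      moreover have "(l * t - 1) * m2 \<le> real ?n * m2" using nle m2p by (intro mult_right_mono) auto
      moreover have "0 < l * m2 - c" using l m2p by (simp add: field_simps)
      then have "m2 + real i0 * m1 < (l * m2 - c) * t" using elim by (simp add: field_simps)
      ultimately have "c * t < expectation (?G t)" by (simp add: algebra_simps)
      then show ?case using elim by (simp add: field_simps)
    qed
  qed
qed

end

text \<open>The upper bound for one part comes from the lower bound for the other.\<close>

lemma two_part_squeeze:
  fixes x y :: real
  assumes sum: "((\<lambda>t. A t + B t) \<longlongrightarrow> x + y) G"
    and A: "\<And>c. c < x \<Longrightarrow> eventually (\<lambda>t. c < A t) G"
    and B: "\<And>c. c < y \<Longrightarrow> eventually (\<lambda>t. c < B t) G"
  shows "(A \<longlongrightarrow> x) G" "(B \<longlongrightarrow> y) G"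
proof -
  show A': "(A \<longlongrightarrow> x) G"
  proof (rule order_tendstoI)
    fix c assume "x < c"
    then have "eventually (\<lambda>t. A t + B t < x + y + (c - x) / 2) G" "eventually (\<lambda>t. y - (c - x) / 2 < B t) G"
      using order_tendstoD(2)[OF sum, of "x + y + (c - x) / 2"] B[of "y - (c - x) / 2"] by auto
    then show "eventually (\<lambda>t. A t < c) G"
      by eventually_elim (simp add: field_simps)
  qed (rule A)
  show "(B \<longlongrightarrow> y) G"
    using tendsto_diff[OF sum A'] by simp
qed

text \<open>Integrable, identically distributed sizes attached to events of rate \<open>lam\<close>. For the queue,
  the growth rate of the total size comes out for repairs and vacations together; therefore it enters
  as a hypothesis of \<open>dominated_reward_rate\<close>.\<close>

locale renewal_reward = prob_space M for M :: "'a measure" +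
  fixes T :: "nat \<Rightarrow> 'a \<Rightarrow> ennreal" and x :: "nat \<Rightarrow> 'a \<Rightarrow> real" and lam :: real
  assumes lam_pos: "0 < lam"
    and T_measurable: "1 \<le> n \<Longrightarrow> T n \<in> borel_measurable M"
    and T_strict: "AE \<omega> in M. \<forall>n\<ge>1. T n \<omega> < T (Suc n) \<omega>"
    and T_rate: "converges_in_probability M (\<lambda>n \<omega>. enn2ereal (T n \<omega>) / ereal (real n)) (1 / lam)"
    and x_measurable: "1 \<le> n \<Longrightarrow> x n \<in> borel_measurable M"
    and x_nonneg: "AE \<omega> in M. \<forall>n\<ge>1. 0 \<le> x n \<omega>"
    and x_ident: "1 \<le> n \<Longrightarrow> distr M borel (x n) = distr M borel (x 1)"
    and x_integrable: "integrable M (x 1)"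
    and total_integrable: "0 \<le> t \<Longrightarrow> integrable M (\<lambda>\<omega>. \<Sum>i=1..num_until T t \<omega>. x i \<omega>)"
begin

abbreviation total :: "(nat \<Rightarrow> 'a \<Rightarrow> real) \<Rightarrow> real \<Rightarrow> 'a \<Rightarrow> real" where
  "total g t \<omega> \<equiv> \<Sum>i=1..num_until T t \<omega>. g i \<omega>"

lemma dominated_total_integrable:
  assumes g: "\<And>n. 1 \<le> n \<Longrightarrow> g n \<in> borel_measurable M"
    and dom: "AE \<omega> in M. \<forall>n\<ge>1. 0 \<le> g n \<omega> \<and> g n \<omega> \<le> \<theta> * x n \<omega>" and t: "0 \<le> t"
  shows "integrable M (total g t)"
proof (rule Bochner_Integration.integrable_bound)
  show "integrable M (\<lambda>\<omega>. \<theta> * total x t \<omega>)" using total_integrable[OF t] by simp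
  show "total g t \<in> borel_measurable M" by (rule random_sum_measurable[OF T_measurable g])
  show "AE \<omega> in M. norm (total g t \<omega>) \<le> norm (\<theta> * total x t \<omega>)"
    using dom
  proof eventually_elim
    case (elim \<omega>)
    have "0 \<le> total g t \<omega>" using elim by (intro sum_nonneg) auto
    moreover have "total g t \<omega> \<le> \<theta> * total x t \<omega>"
      unfolding sum_distrib_left using elim by (intro sum_mono) auto
    ultimately show ?case by simp
  qed
qed

text \<open>The rewards \<open>\<theta> x n - h n\<close> are unbounded; truncating only \<open>\<theta> x n\<close> at a level \<open>K \<ge> 1\<close> keeps the
  difference nonnegative, because \<open>h n \<le> 1\<close>, and its mean is the difference of two known means.\<close>

lemma reward_complement_lower_bound:
  assumes th: "0 \<le> \<theta>" and h[measurable]: "\<And>n. 1 \<le> n \<Longrightarrow> h n \<in> borel_measurable M"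
    and h_bounds: "AE \<omega> in M. \<forall>n\<ge>1. 0 \<le> h n \<omega> \<and> h n \<omega> \<le> \<theta> * x n \<omega> \<and> h n \<omega> \<le> 1"
    and h_mean: "(\<lambda>n. expectation (h n)) \<longlonglongrightarrow> m"
    and c: "c < lam * (\<theta> * expectation (x 1) - m)"
  shows "eventually (\<lambda>t. c < expectation (total (\<lambda>n \<omega>. \<theta> * x n \<omega> - h n \<omega>) t) / t) at_top"
proof -
  note [measurable] = x_measurable
  define y where "y K n \<omega> = min (\<theta> * x n \<omega>) K" for K n \<omega>
  have [measurable]: "y K n \<in> borel_measurable M" if "1 \<le> n" for K n
    unfolding y_def using that by measurable
  have x1: "AE \<omega> in M. 0 \<le> \<theta> * x 1 \<omega>" using x_nonneg by eventually_elim (use th in auto)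
  have "(\<lambda>K. expectation (y (real K) 1)) \<longlonglongrightarrow> expectation (\<lambda>\<omega>. \<theta> * x 1 \<omega>)"
  proof (rule integral_dominated_convergence[where w="\<lambda>\<omega>. \<theta> * x 1 \<omega>"])
    show "AE \<omega> in M. (\<lambda>K. y (real K) 1 \<omega>) \<longlonglongrightarrow> \<theta> * x 1 \<omega>"
    proof (rule AE_I2)
      fix \<omega>
      obtain K0 :: nat where K0: "\<theta> * x 1 \<omega> \<le> real K0" using real_arch_simple by blast
      have "eventually (\<lambda>K. \<theta> * x 1 \<omega> = y (real K) 1 \<omega>) sequentially"
        using eventually_ge_at_top[of K0] by eventually_elim (use K0 in \<open>simp add: y_def\<close>)
      then show "(\<lambda>K. y (real K) 1 \<omega>) \<longlonglongrightarrow> \<theta> * x 1 \<omega>"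
        by (rule Lim_transform_eventually[OF tendsto_const])
    qed
    show "AE \<omega> in M. norm (y (real K) 1 \<omega>) \<le> \<theta> * x 1 \<omega>" for K
      using x1 by eventually_elim (auto simp: y_def min_def)
  qed (use x_integrable in \<open>auto simp: y_def\<close>)
  then have "(\<lambda>K. lam * (expectation (y (real K) 1) - m)) \<longlonglongrightarrow> lam * (expectation (\<lambda>\<omega>. \<theta> * x 1 \<omega>) - m)"
    by (intro tendsto_intros)
  then have "eventually (\<lambda>K. c < lam * (expectation (y (real K) 1) - m)) sequentially"
    by (rule order_tendstoD) (use c in simp)
  then obtain K :: nat where K: "c < lam * (expectation (y (real K) 1) - m)" "1 \<le> K"
    using eventually_ge_at_top[of "1::nat"] by (metis (no_types, lifting) eventually_conj eventually_sequentially order_refl)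
  have ey: "expectation (y K n) = expectation (y K 1)" if "1 \<le> n" for n
  proof -
    have "expectation (y K n) = integral\<^sup>L (distr M borel (x n)) (\<lambda>z. min (\<theta> * z) K)"
      unfolding y_def using that by (subst integral_distr) auto
    also have "\<dots> = expectation (y K 1)"
      unfolding y_def x_ident[OF that] by (subst integral_distr) auto
    finally show ?thesis .
  qed
  have yint: "integrable M (y K n)" if "1 \<le> n" for n
    by (rule integrable_const_bound[where B=K])
       (use x_nonneg in eventually_elim, use that th in \<open>auto simp: y_def min_def\<close>)
  have hint: "integrable M (h n)" if "1 \<le> n" for n
    by (rule integrable_const_bound[where B=1])
       (use h_bounds in eventually_elim, use that in auto)
  define g where "g n \<omega> = y K n \<omega> - h n \<omega>" for n \<omega>
  have [measurable]: "g n \<in> borel_measurable M" if "1 \<le> n" for n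
    unfolding g_def using that by measurable
  have g_bounds: "AE \<omega> in M. \<forall>n\<ge>1. 0 \<le> g n \<omega> \<and> g n \<omega> \<le> K \<and> g n \<omega> \<le> \<theta> * x n \<omega> - h n \<omega> \<and> g n \<omega> \<le> \<theta> * x n \<omega>"
    using h_bounds
  proof (eventually_elim, intro allI impI)
    fix \<omega> and n :: nat assume "\<forall>n\<ge>1. 0 \<le> h n \<omega> \<and> h n \<omega> \<le> \<theta> * x n \<omega> \<and> h n \<omega> \<le> 1" "1 \<le> n"
    then have "0 \<le> h n \<omega>" "h n \<omega> \<le> \<theta> * x n \<omega>" "h n \<omega> \<le> 1" by auto
    then show "0 \<le> g n \<omega> \<and> g n \<omega> \<le> K \<and> g n \<omega> \<le> \<theta> * x n \<omega> - h n \<omega> \<and> g n \<omega> \<le> \<theta> * x n \<omega>"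
      using K(2) by (auto simp: g_def y_def min_def)
  qed
  have gint: "integrable M (total g t)" if "0 \<le> t" for t
    by (rule dominated_total_integrable[of g \<theta>, OF _ _ that])
       (simp, use g_bounds in eventually_elim, simp)
  have dint: "integrable M (total (\<lambda>n \<omega>. \<theta> * x n \<omega> - h n \<omega>) t)" if "0 \<le> t" for t
    by (rule dominated_total_integrable[of _ \<theta>, OF _ _ that])
       (simp, use h_bounds in eventually_elim, simp)
  have "eventually (\<lambda>t. c < expectation (total g t) / t) at_top"
  proof (rule renewal_reward_lower_bound[OF lam_pos T_measurable T_strict T_rate, where K=K])
    show "(\<lambda>n. expectation (g n)) \<longlonglongrightarrow> expectation (y K 1) - m"
    proof (rule Lim_transform_eventually)
      show "(\<lambda>n. expectation (y K 1) - expectation (h n)) \<longlonglongrightarrow> expectation (y K 1) - m"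
        by (intro tendsto_intros h_mean)
      show "eventually (\<lambda>n. expectation (y K 1) - expectation (h n) = expectation (g n)) sequentially"
        using eventually_ge_at_top[of 1]
      proof eventually_elim
        case (elim n)
        have "expectation (g n) = expectation (y K n) - expectation (h n)"
          unfolding g_def by (rule Bochner_Integration.integral_diff[OF yint[OF elim] hint[OF elim]])
        then show ?case unfolding ey[OF elim] by simp
      qed
    qed
    show "AE \<omega> in M. \<forall>n\<ge>1. 0 \<le> g n \<omega> \<and> g n \<omega> \<le> K" using g_bounds by eventually_elim blast
  qed (use gint K in auto)
  then show ?thesis
    using eventually_gt_at_top[of 0]
  proof eventually_elim
    case (elim t)
    have "expectation (total g t) \<le> expectation (total (\<lambda>n \<omega>. \<theta> * x n \<omega> - h n \<omega>) t)"
    proof (rule integral_mono_AE)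
      show "AE \<omega> in M. total g t \<omega> \<le> total (\<lambda>n \<omega>. \<theta> * x n \<omega> - h n \<omega>) t \<omega>"
        using g_bounds by eventually_elim (intro sum_mono, simp)
    qed (use gint dint elim in auto)
    then have "expectation (total g t) / t \<le> expectation (total (\<lambda>n \<omega>. \<theta> * x n \<omega> - h n \<omega>) t) / t"
      using elim by (intro divide_right_mono) auto
    then show ?case using elim by linarith
  qed
qed

lemma total_lower_bound:
  assumes "c < lam * expectation (x 1)"
  shows "eventually (\<lambda>t. c < expectation (total x t) / t) at_top"
  using reward_complement_lower_bound[of 1 "\<lambda>_ _. 0" 0 c] assms x_nonneg by simp

text \<open>Once the total size grows exactly at the rate \<open>lam * E (x 1)\<close>, the lower bounds for \<open>h\<close> and for its
  complement \<open>\<theta> x - h\<close> add up to the true rate of their sum, so both are attained.\<close>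

lemma dominated_reward_rate:
  assumes th: "0 \<le> \<theta>" and h: "\<And>n. 1 \<le> n \<Longrightarrow> h n \<in> borel_measurable M"
    and h_bounds: "AE \<omega> in M. \<forall>n\<ge>1. 0 \<le> h n \<omega> \<and> h n \<omega> \<le> \<theta> * x n \<omega> \<and> h n \<omega> \<le> 1"
    and h_mean: "(\<lambda>n. expectation (h n)) \<longlonglongrightarrow> m"
    and rate: "((\<lambda>t. expectation (total x t) / t) \<longlongrightarrow> lam * expectation (x 1)) at_top"
  shows "((\<lambda>t. expectation (total h t) / t) \<longlongrightarrow> lam * m) at_top"
proof (rule two_part_squeeze(1))
  let ?d = "\<lambda>n \<omega>. \<theta> * x n \<omega> - h n \<omega>"
  have hint: "integrable M (total h t)" if "0 \<le> t" for t
    by (rule dominated_total_integrable[of _ \<theta>, OF _ _ that])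
       (rule h, assumption, use h_bounds in eventually_elim, simp)
  have dint: "integrable M (total ?d t)" if "0 \<le> t" for t
    by (rule dominated_total_integrable[of _ \<theta>, OF _ _ that])
       (intro borel_measurable_diff borel_measurable_times borel_measurable_const x_measurable h, assumption+,
        use h_bounds in eventually_elim, simp)
  show "((\<lambda>t. expectation (total h t) / t + expectation (total ?d t) / t) \<longlongrightarrow>
      lam * m + lam * (\<theta> * expectation (x 1) - m)) at_top"
  proof (rule Lim_transform_eventually)
    have "((\<lambda>t. \<theta> * (expectation (total x t) / t)) \<longlongrightarrow> \<theta> * (lam * expectation (x 1))) at_top"
      by (intro tendsto_intros rate)
    then show "((\<lambda>t. \<theta> * (expectation (total x t) / t)) \<longlongrightarrow> lam * m + lam * (\<theta> * expectation (x 1) - m)) at_top"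
      by (simp add: algebra_simps)
    show "eventually (\<lambda>t. \<theta> * (expectation (total x t) / t) =
        expectation (total h t) / t + expectation (total ?d t) / t) at_top"
      using eventually_ge_at_top[of 0]
    proof eventually_elim
      case (elim t)
      have "expectation (total h t) + expectation (total ?d t) = expectation (\<lambda>\<omega>. total h t \<omega> + total ?d t \<omega>)"
        using hint[OF elim] dint[OF elim] by simp
      also have "(\<lambda>\<omega>. total h t \<omega> + total ?d t \<omega>) = (\<lambda>\<omega>. \<theta> * total x t \<omega>)"
        by (simp add: sum_subtractf sum_distrib_left)
      finally show ?case by (simp add: add_divide_distrib[symmetric])
    qed
  qed
  show "eventually (\<lambda>t. c < expectation (total h t) / t) at_top" if "c < lam * m" for c
  proof (rule renewal_reward_lower_bound[OF lam_pos T_measurable T_strict T_rate h _ h_mean hint that, of 1])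
    show "AE \<omega> in M. \<forall>n\<ge>1. 0 \<le> h n \<omega> \<and> h n \<omega> \<le> 1"
      using h_bounds by eventually_elim blast
  qed
  show "eventually (\<lambda>t. c < expectation (total ?d t) / t) at_top" if "c < lam * (\<theta> * expectation (x 1) - m)" for c
    by (rule reward_complement_lower_bound[OF th h h_bounds h_mean that])
qed

end

section \<open>The net input process and the balance equation\<close>

text \<open>The change of \<open>exp (- \<theta> v)\<close> between \<open>s\<close> and \<open>u\<close> that is not due to the increment of \<open>y\<close>.\<close>

definition cell_jump :: "real \<Rightarrow> (real \<Rightarrow> real) \<Rightarrow> (real \<Rightarrow> real) \<Rightarrow> real \<Rightarrow> real \<Rightarrow> real" where
  "cell_jump \<theta> v y s u = exp (- \<theta> * v u) - exp (- \<theta> * (v s + (y u - y s)))"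

text \<open>The part of the model that the waiting time and the reflected process share.\<close>

locale net_input_process = filtered_prob_space M F
  for M :: "'a measure" and F :: "ennreal \<Rightarrow> 'a measure" +
  fixes X :: "real \<Rightarrow> 'a \<Rightarrow> real" and a :: real and \<nu> :: "real measure" and r :: real
  assumes subordinator_X: "subordinator M F X"
    and laplace_X: "\<lbrakk>0 \<le> t; 0 \<le> \<theta>\<rbrakk> \<Longrightarrow>
      expectation (\<lambda>\<omega>. exp (- \<theta> * X t \<omega>)) = exp (t * sub_exponent a \<nu> \<theta>)"
    and rho_less: "- right_deriv_0 (sub_exponent a \<nu>) < r"
    and net_input_integrable: "0 \<le> t \<Longrightarrow> integrable M (net_input X r t)"
begin

abbreviation "Y \<equiv> net_input X r"
abbreviation "\<phi> \<equiv> net_exponent a \<nu> r"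
abbreviation "drift \<equiv> right_deriv_0 \<phi>"

lemma measurable_from_F: "f \<in> borel_measurable (F t) \<Longrightarrow> f \<in> borel_measurable M"
  using measurable_mono[of borel borel "F t" M] subalg[of t] space_F[of t] by auto

text \<open>Null sets belong to every \<open>F t\<close> by the usual conditions, so adaptedness may be checked on an almost
  surely equal version.\<close>

lemma adapted_AE_cong:
  fixes f g :: "'a \<Rightarrow> real"
  assumes g: "g \<in> borel_measurable (F t)" and eq: "AE \<omega> in M. f \<omega> = g \<omega>"
  shows "f \<in> borel_measurable (F t)"
proof (rule measurableI)
  fix A :: "real set" assume A: "A \<in> sets borel"
  let ?f = "f -` A \<inter> space M" and ?g = "g -` A \<inter> space M"
  have null: "N \<in> sets (F t)" if "N \<in> null_sets M" for N
    using that null_sets_initial sets_F_mono[of 0 t] by auto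
  have "AE \<omega> in M. \<omega> \<notin> ?f - ?g" "AE \<omega> in M. \<omega> \<notin> ?g - ?f"
    using eq by (eventually_elim, simp)+
  then have "?f - ?g \<in> null_sets M" "?g - ?f \<in> null_sets M"
    unfolding null_sets_iff_AE by auto
  moreover have "?g \<in> sets (F t)"
    using measurable_sets[OF g A] by (simp add: space_F)
  ultimately have "(?g \<union> (?f - ?g)) - (?g - ?f) \<in> sets (F t)"
    by (meson null sets.Diff sets.Un)
  also have "(?g \<union> (?f - ?g)) - (?g - ?f) = ?f" by auto
  finally show "f -` A \<inter> space (F t) \<in> sets (F t)" by (simp add: space_F)
qed simp

lemma levy_X: "levy_process M F X"
  using subordinator_X by (simp add: subordinator_def)

lemma X_adapted: "0 \<le> t \<Longrightarrow> X t \<in> borel_measurable (F (ennreal t))"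
  using levy_X by (simp add: levy_process_def)

lemma X_measurable: "0 \<le> t \<Longrightarrow> X t \<in> borel_measurable M"
  by (rule measurable_from_F[OF X_adapted])

lemma X_zero: "AE \<omega> in M. X 0 \<omega> = 0"
  using levy_X by (simp add: levy_process_def)

lemma X_mono: "AE \<omega> in M. \<forall>s t. 0 \<le> s \<and> s \<le> t \<longrightarrow> X s \<omega> \<le> X t \<omega>"
  using subordinator_X by (simp add: subordinator_def)

lemma X_cadlag: "AE \<omega> in M. cadlag (\<lambda>t. X t \<omega>)"
  using levy_X by (simp add: levy_process_def)

lemma X_nonneg: "AE \<omega> in M. \<forall>t\<ge>0. 0 \<le> X t \<omega>"
  using X_zero X_mono by eventually_elim (metis order_refl)

lemma X_integrable: "0 \<le> t \<Longrightarrow> integrable M (X t)"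
  using Bochner_Integration.integrable_add[OF net_input_integrable[of t] integrable_const[of "r * t"]]
  by (simp add: net_input_def[abs_def])

lemma X_increment_distr:
  "0 \<le> s \<Longrightarrow> 0 \<le> h \<Longrightarrow> distr M borel (\<lambda>\<omega>. X (s + h) \<omega> - X s \<omega>) = distr M borel (X h)"
  using levy_X by (simp add: levy_process_def)

lemma X_increment_indep:
  assumes s: "0 \<le> s" "0 \<le> h" and V: "V \<in> borel_measurable (F (ennreal s))"
  shows "indep_var borel (\<lambda>\<omega>. X (s + h) \<omega> - X s \<omega>) borel V"
proof -
  let ?D = "\<lambda>\<omega>. X (s + h) \<omega> - X s \<omega>"
  have [measurable]: "?D \<in> borel_measurable M" using s by (intro borel_measurable_diff X_measurable) auto
  have [measurable]: "V \<in> borel_measurable M" using V by (rule measurable_from_F)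
  have ind: "indep_set (sets (vimage_algebra (space M) ?D borel)) (sets (F (ennreal s)))"
    using levy_X s by (simp add: levy_process_def)
  have "indep_set (sigma_sets (space M) {?D -` A \<inter> space M | A. A \<in> sets borel})
      (sigma_sets (space M) {V -` A \<inter> space M | A. A \<in> sets borel})"
    unfolding indep_set_def
  proof (rule indep_sets_mono_sets[OF ind[unfolded indep_set_def]])
    have "sigma_sets (space M) {V -` A \<inter> space M | A. A \<in> sets borel} \<subseteq> sets (F (ennreal s))"
      using measurable_sets[OF V] sets.sigma_sets_subset[of "{V -` A \<inter> space M | A. A \<in> sets borel}" "F (ennreal s)"]
      by (auto simp: space_F)
    then show "(case i of True \<Rightarrow> sigma_sets (space M) {?D -` A \<inter> space M | A. A \<in> sets borel}
        | False \<Rightarrow> sigma_sets (space M) {V -` A \<inter> space M | A. A \<in> sets borel})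
      \<subseteq> (case i of True \<Rightarrow> sets (vimage_algebra (space M) ?D borel) | False \<Rightarrow> sets (F (ennreal s)))" for i
      by (auto simp only: sets_vimage_algebra split: bool.split)
  qed
  then show ?thesis by (simp add: indep_var_eq)
qed

lemma X_increment_mean:
  assumes "0 \<le> s" "0 \<le> h"
  shows "integrable M (\<lambda>\<omega>. X (s + h) \<omega> - X s \<omega>)" "expectation (\<lambda>\<omega>. X (s + h) \<omega> - X s \<omega>) = expectation (X h)"
proof -
  show "integrable M (\<lambda>\<omega>. X (s + h) \<omega> - X s \<omega>)" using assms by (auto intro!: X_integrable)
  have [measurable]: "X (s + h) \<in> borel_measurable M" "X s \<in> borel_measurable M" "X h \<in> borel_measurable M"
    using assms by (auto intro: X_measurable)
  have "expectation (\<lambda>\<omega>. X (s + h) \<omega> - X s \<omega>) = integral\<^sup>L (distr M borel (\<lambda>\<omega>. X (s + h) \<omega> - X s \<omega>)) (\<lambda>x. x)"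
    by (subst integral_distr) auto
  also have "\<dots> = expectation (X h)" unfolding X_increment_distr[OF assms] by (subst integral_distr) auto
  finally show "expectation (\<lambda>\<omega>. X (s + h) \<omega> - X s \<omega>) = expectation (X h)" .
qed

text \<open>The increment of \<open>Y\<close> is independent of the past, so the transform picks up the factor
  \<open>E exp (- \<theta> Y\<^sub>h)\<close>.\<close>

lemma laplace_step:
  assumes s: "0 \<le> s" "0 \<le> h" and th: "0 \<le> \<theta>"
    and V: "V \<in> borel_measurable (F (ennreal s))"
    and nn: "AE \<omega> in M. 0 \<le> V \<omega>"
  shows "expectation (\<lambda>\<omega>. exp (- \<theta> * (V \<omega> + (Y (s + h) \<omega> - Y s \<omega>)))) =
    expectation (\<lambda>\<omega>. exp (- \<theta> * V \<omega>)) * exp (h * \<phi> \<theta>)"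
proof -
  let ?D = "\<lambda>\<omega>. X (s + h) \<omega> - X s \<omega>"
  have [measurable]: "X (s + h) \<in> borel_measurable M" "X s \<in> borel_measurable M" "X h \<in> borel_measurable M"
    using s by (auto intro: X_measurable)
  have [measurable]: "V \<in> borel_measurable M" using V by (rule measurable_from_F)
  have "indep_var borel ((\<lambda>x. exp (- \<theta> * x)) \<circ> ?D) borel ((\<lambda>x. exp (- \<theta> * x)) \<circ> V)"
    by (rule indep_var_compose[OF X_increment_indep[OF s V]]) auto
  then have ind: "indep_var borel (\<lambda>\<omega>. exp (- \<theta> * ?D \<omega>)) borel (\<lambda>\<omega>. exp (- \<theta> * V \<omega>))"
    by (simp add: comp_def)
  have D0: "AE \<omega> in M. 0 \<le> ?D \<omega>" using X_mono s by (auto elim!: eventually_mono)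
  have i1: "integrable M (\<lambda>\<omega>. exp (- \<theta> * ?D \<omega>))"
    by (rule integrable_const_bound[where B=1]) (use D0 th in \<open>auto elim!: eventually_mono\<close>)
  have i2: "integrable M (\<lambda>\<omega>. exp (- \<theta> * V \<omega>))"
    by (rule integrable_const_bound[where B=1]) (use nn th in \<open>auto elim!: eventually_mono\<close>)
  have eD: "expectation (\<lambda>\<omega>. exp (- \<theta> * ?D \<omega>)) = exp (h * sub_exponent a \<nu> \<theta>)"
  proof -
    have "expectation (\<lambda>\<omega>. exp (- \<theta> * ?D \<omega>)) = integral\<^sup>L (distr M borel ?D) (\<lambda>x. exp (- \<theta> * x))"
      by (subst integral_distr) auto
    also have "\<dots> = expectation (\<lambda>\<omega>. exp (- \<theta> * X h \<omega>))"
      unfolding X_increment_distr[OF s] by (subst integral_distr) auto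
    finally show ?thesis using laplace_X[of h \<theta>] s th by simp
  qed
  have "h * \<phi> \<theta> = \<theta> * r * h + h * sub_exponent a \<nu> \<theta>"
    by (simp add: net_exponent_def algebra_simps)
  then have eh: "exp (h * \<phi> \<theta>) = exp (\<theta> * r * h) * exp (h * sub_exponent a \<nu> \<theta>)"
    by (simp only: exp_add)
  have "expectation (\<lambda>\<omega>. exp (- \<theta> * (V \<omega> + (Y (s + h) \<omega> - Y s \<omega>)))) =
    expectation (\<lambda>\<omega>. exp (\<theta> * r * h) * (exp (- \<theta> * ?D \<omega>) * exp (- \<theta> * V \<omega>)))"
  proof (rule Bochner_Integration.integral_cong)
    fix \<omega>
    have "- \<theta> * (V \<omega> + (Y (s + h) \<omega> - Y s \<omega>)) = \<theta> * r * h + (- \<theta> * ?D \<omega> + - \<theta> * V \<omega>)"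
      by (simp add: net_input_def algebra_simps)
    then show "exp (- \<theta> * (V \<omega> + (Y (s + h) \<omega> - Y s \<omega>))) = exp (\<theta> * r * h) * (exp (- \<theta> * ?D \<omega>) * exp (- \<theta> * V \<omega>))"
      by (simp only: exp_add)
  qed simp
  also have "\<dots> = exp (\<theta> * r * h) * (expectation (\<lambda>\<omega>. exp (- \<theta> * ?D \<omega>)) * expectation (\<lambda>\<omega>. exp (- \<theta> * V \<omega>)))"
    using indep_var_lebesgue_integral[OF ind i1 i2] by simp
  finally show ?thesis
    unfolding eD eh by (simp only: mult_ac)
qed

text \<open>As \<open>t\<close> times the exponent is the logarithm of \<open>E exp (- \<theta> X\<^sub>t)\<close>, \<open>t\<close> times its derivative at \<open>0\<close>
  is \<open>- E X\<^sub>t\<close>.\<close>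

lemma sub_exponent_right_derivative:
  assumes "0 < t"
  shows "(sub_exponent a \<nu> has_real_derivative - expectation (X t) / t) (at 0 within {0..})"
proof -
  let ?m = "\<lambda>\<theta>. expectation (\<lambda>\<omega>. exp (- \<theta> * X t \<omega>))"
  have nn: "AE \<omega> in M. 0 \<le> X t \<omega>" using X_nonneg by eventually_elim (use assms in simp)
  have m0: "?m 0 = 1" by (simp add: prob_space)
  have dm: "(?m has_real_derivative - expectation (X t)) (at 0 within {0..})"
    by (rule laplace_transform_right_derivative[OF X_integrable nn]) (use assms in simp)
  have dl: "(ln has_real_derivative 1) (at (?m 0))"
    using DERIV_ln_divide[of 1] m0 by simp
  have "((\<lambda>\<theta>. ln (?m \<theta>) / t) has_real_derivative 1 * - expectation (X t) / t) (at 0 within {0..})"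
    by (rule DERIV_cdivide[OF DERIV_chain2[OF dl dm]])
  then have "((\<lambda>\<theta>. ln (?m \<theta>) / t) has_real_derivative - expectation (X t) / t) (at 0 within {0..})"
    by (simp only: mult_1)
  then show ?thesis
  proof (rule has_field_derivative_transform_within[where d=1])
    fix \<theta> :: real assume "\<theta> \<in> {0..}"
    then show "ln (?m \<theta>) / t = sub_exponent a \<nu> \<theta>"
      using laplace_X[of t \<theta>] assms by (simp del: minus_mult_left)
  qed simp_all
qed

lemma right_deriv_0_eqI:
  assumes "(f has_real_derivative d) (at 0 within {0..})"
  shows "right_deriv_0 f = d"
  unfolding right_deriv_0_def
  by (rule vector_derivative_within)
     (use assms in \<open>auto simp: has_real_derivative_iff_has_vector_derivative at_within_Ici_at_right\<close>)

lemma net_exponent_right_derivative: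
  assumes "0 < t" shows "(\<phi> has_real_derivative r - expectation (X t) / t) (at 0 within {0..})"
  unfolding net_exponent_def[abs_def] using sub_exponent_right_derivative[OF assms]
  by (auto intro!: derivative_eq_intros)

lemma net_input_mean: "0 \<le> t \<Longrightarrow> expectation (Y t) = - t * drift"
proof (cases "t = 0")
  case True
  have "expectation (X 0) = expectation (\<lambda>_. 0)"
    by (rule integral_cong_AE) (use X_zero X_measurable in auto)
  with True show ?thesis by (simp add: net_input_def[abs_def])
next
  case False
  assume t: "0 \<le> t"
  have "drift = r - expectation (X t) / t"
    by (rule right_deriv_0_eqI[OF net_exponent_right_derivative]) (use t False in simp)
  then have "expectation (X t) = (r - drift) * t" using False by simp
  moreover have "expectation (Y t) = expectation (X t) - r * t"
    unfolding net_input_def using X_integrable[OF t] by (simp add: prob_space)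
  ultimately show ?thesis by (simp add: left_diff_distrib)
qed

lemma drift_pos: "0 < drift"
  using right_deriv_0_eqI[OF net_exponent_right_derivative[of 1]]
    right_deriv_0_eqI[OF sub_exponent_right_derivative[of 1]] rho_less by simp

lemma r_pos: "0 < r"
proof -
  have "0 \<le> expectation (X 1)"
    by (rule integral_nonneg_AE) (use X_nonneg in \<open>eventually_elim, simp\<close>)
  then show ?thesis
    using right_deriv_0_eqI[OF sub_exponent_right_derivative[of 1]] rho_less by simp
qed

lemma net_exponent_over_theta: "((\<lambda>\<theta>. \<phi> \<theta> / \<theta>) \<longlongrightarrow> drift) (at_right 0)"
proof -
  have "(\<phi> has_real_derivative drift) (at 0 within {0..})"
    using net_exponent_right_derivative[of 1] right_deriv_0_eqI[OF net_exponent_right_derivative[of 1]] by simp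
  then show ?thesis by (simp add: has_field_derivative_iff at_within_Ici_at_right net_exponent_def sub_exponent_def)
qed

text \<open>Over a time \<open>h\<close> the net input falls by at most \<open>r h\<close>, so both exponentials are bounded.\<close>

lemma
  assumes s: "0 \<le> s" "0 \<le> h" and th: "0 \<le> \<theta>"
    and nn: "\<And>s. 0 \<le> s \<Longrightarrow> AE \<omega> in M. 0 \<le> V s \<omega>"
    and ad: "\<And>s. 0 \<le> s \<Longrightarrow> V s \<in> borel_measurable (F (ennreal s))"
  shows cell_jump_integrable: "integrable M (\<lambda>\<omega>. cell_jump \<theta> (\<lambda>s. V s \<omega>) (\<lambda>s. Y s \<omega>) s (s + h))"
    and cell_jump_mean: "expectation (\<lambda>\<omega>. cell_jump \<theta> (\<lambda>s. V s \<omega>) (\<lambda>s. Y s \<omega>) s (s + h)) =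
      expectation (\<lambda>\<omega>. exp (- \<theta> * V (s + h) \<omega>)) - expectation (\<lambda>\<omega>. exp (- \<theta> * V s \<omega>)) * exp (h * \<phi> \<theta>)"
proof -
  have sh: "0 \<le> s + h" "s \<le> s + h" using s by auto
  note [measurable] = measurable_from_F[OF ad[OF s(1)]] measurable_from_F[OF ad[OF sh(1)]]
    borel_measurable_integrable[OF net_input_integrable[OF s(1)]]
    borel_measurable_integrable[OF net_input_integrable[OF sh(1)]]
  have i1: "integrable M (\<lambda>\<omega>. exp (- \<theta> * V (s + h) \<omega>))"
    by (rule integrable_const_bound[where B=1]) (use nn[OF sh(1)] in \<open>eventually_elim, use th in simp\<close>, measurable)
  have i2: "integrable M (\<lambda>\<omega>. exp (- \<theta> * (V s \<omega> + (Y (s + h) \<omega> - Y s \<omega>))))"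
  proof (rule integrable_const_bound[where B="exp (\<theta> * (r * h))"])
    show "AE \<omega> in M. norm (exp (- \<theta> * (V s \<omega> + (Y (s + h) \<omega> - Y s \<omega>)))) \<le> exp (\<theta> * (r * h))"
      using nn[OF s(1)] X_mono
    proof eventually_elim
      case (elim \<omega>)
      then have "X s \<omega> \<le> X (s + h) \<omega>" using s(1) sh(2) by blast
      then have "- (r * h) \<le> V s \<omega> + (Y (s + h) \<omega> - Y s \<omega>)"
        using elim(1) by (simp add: net_input_def algebra_simps)
      then have "\<theta> * - (r * h) \<le> \<theta> * (V s \<omega> + (Y (s + h) \<omega> - Y s \<omega>))"
        using th by (intro mult_left_mono) auto
      then show ?case by simp
    qed
  qed measurable
  show "integrable M (\<lambda>\<omega>. cell_jump \<theta> (\<lambda>s. V s \<omega>) (\<lambda>s. Y s \<omega>) s (s + h))"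
    unfolding cell_jump_def by (intro Bochner_Integration.integrable_diff i1 i2)
  show "expectation (\<lambda>\<omega>. cell_jump \<theta> (\<lambda>s. V s \<omega>) (\<lambda>s. Y s \<omega>) s (s + h)) =
      expectation (\<lambda>\<omega>. exp (- \<theta> * V (s + h) \<omega>)) - expectation (\<lambda>\<omega>. exp (- \<theta> * V s \<omega>)) * exp (h * \<phi> \<theta>)"
    unfolding cell_jump_def Bochner_Integration.integral_diff[OF i1 i2]
      laplace_step[OF s th ad[OF s(1)] nn[OF s(1)]] ..
qed

text \<open>Telescope \<open>g s = E exp (- \<theta> V\<^sub>s)\<close> over the grid of mesh \<open>t / n\<close>. The assumption \<open>jumps\<close> concerns the
  part of each increment that is not due to \<open>Y\<close>; the rest is \<open>exp (t \<phi> \<theta> / n) - 1\<close> times the sum of \<open>g\<close> over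
  the grid. Since \<open>g s\<close> is within \<open>\<epsilon>\<close> of \<open>w\<close> after some time \<open>T\<close>, the average of \<open>g\<close> over the grid is within
  \<open>\<epsilon> + T / t + 1 / n\<close> of \<open>w\<close>. First \<open>n \<rightarrow> \<infinity>\<close> and then \<open>t \<rightarrow> \<infinity>\<close>.\<close>

lemma laplace_balance:
  fixes V :: "real \<Rightarrow> 'a \<Rightarrow> real" and B :: "real \<Rightarrow> real"
  assumes th: "0 \<le> \<theta>"
    and nn: "\<And>s. 0 \<le> s \<Longrightarrow> AE \<omega> in M. 0 \<le> V s \<omega>"
    and ad: "\<And>s. 0 \<le> s \<Longrightarrow> V s \<in> borel_measurable (F (ennreal s))"
    and lim: "((\<lambda>t. expectation (\<lambda>\<omega>. exp (- \<theta> * V t \<omega>))) \<longlongrightarrow> w) at_top"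
    and jumps: "\<And>t. 0 < t \<Longrightarrow> (\<lambda>n. \<Sum>k<n. expectation (\<lambda>\<omega>. cell_jump \<theta> (\<lambda>s. V s \<omega>) (\<lambda>s. Y s \<omega>) (real k * (t / n)) (real (Suc k) * (t / n))))
       \<longlonglongrightarrow> B t"
  shows "((\<lambda>t. B t / t) \<longlongrightarrow> - (\<phi> \<theta> * w)) at_top"
proof -
  define g where "g s = expectation (\<lambda>\<omega>. exp (- \<theta> * V s \<omega>))" for s
  have gb: "0 \<le> g s" "g s \<le> 1" if "0 \<le> s" for s
  proof -
    show "0 \<le> g s" unfolding g_def by (rule integral_nonneg_AE) auto
    have "g s \<le> expectation (\<lambda>_. 1)" unfolding g_def
      by (rule integral_mono_AE') (use nn[OF that] th in \<open>auto elim!: eventually_mono\<close>)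
    then show "g s \<le> 1" by (simp add: prob_space)
  qed
  have gw: "(g \<longlongrightarrow> w) at_top" using lim by (simp add: g_def[abs_def])
  have "eventually (\<lambda>t. 0 \<le> g t) at_top" "eventually (\<lambda>t. g t \<le> 1) at_top"
    using eventually_ge_at_top[of "0::real"] by (eventually_elim, use gb in blast)+
  then have w: "0 \<le> w" "w \<le> 1"
    using tendsto_lowerbound[OF gw, of 0] tendsto_upperbound[OF gw, of 1] by auto
  define S where "S t n = (\<Sum>k<n. g (real k * (t / n)))" for t and n :: nat
  define q where "q t n = real n * (exp (t / n * \<phi> \<theta>) - 1)" for t and n :: nat
  have q: "q t \<longlonglongrightarrow> t * \<phi> \<theta>" for t
    unfolding q_def by real_asymp
  have J: "(\<lambda>n. g t - g 0 - q t n * (S t n / n)) \<longlonglongrightarrow> B t" if "0 < t" for t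
  proof (rule Lim_transform_eventually[OF jumps[OF that]])
    show "\<forall>\<^sub>F n in sequentially. (\<Sum>k<n. expectation (\<lambda>\<omega>. cell_jump \<theta> (\<lambda>s. V s \<omega>) (\<lambda>s. Y s \<omega>) (real k * (t / n)) (real (Suc k) * (t / n))))
       = g t - g 0 - q t n * (S t n / n)"
      using eventually_gt_at_top[of 0]
    proof eventually_elim
      case (elim n)
      let ?h = "t / real n"
      have "expectation (\<lambda>\<omega>. cell_jump \<theta> (\<lambda>s. V s \<omega>) (\<lambda>s. Y s \<omega>) (real k * ?h) (real (Suc k) * ?h)) =
        (g (real (Suc k) * ?h) - g (real k * ?h)) - (exp (?h * \<phi> \<theta>) - 1) * g (real k * ?h)" for k
      proof -
        have k0: "0 \<le> real k * ?h" "0 \<le> ?h" using \<open>0 < t\<close> by auto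
        have su: "real (Suc k) * ?h = real k * ?h + ?h" by (simp add: distrib_right add_divide_distrib)
        show ?thesis
          unfolding su by (subst cell_jump_mean) (use k0 th nn ad in \<open>auto simp: g_def left_diff_distrib mult.commute\<close>)
      qed
      then have "(\<Sum>k<n. expectation (\<lambda>\<omega>. cell_jump \<theta> (\<lambda>s. V s \<omega>) (\<lambda>s. Y s \<omega>) (real k * (t / n)) (real (Suc k) * (t / n))))
       = (\<Sum>k<n. (g (real (Suc k) * ?h) - g (real k * ?h)) - (exp (?h * \<phi> \<theta>) - 1) * g (real k * ?h))"
        by (simp only:)
      also have "\<dots> = (\<Sum>k<n. (g (real (Suc k) * ?h) - g (real k * ?h))) - (exp (?h * \<phi> \<theta>) - 1) * S t n"
        by (simp add: sum_subtractf sum_distrib_left S_def)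
      also have "(\<Sum>k<n. (g (real (Suc k) * ?h) - g (real k * ?h))) = g t - g 0"
        using sum_lessThan_telescope[of "\<lambda>k. g (real k * ?h)" n] elim by simp
      also have "(exp (?h * \<phi> \<theta>) - 1) * S t n = q t n * (S t n / n)"
        using elim by (simp add: q_def)
      finally show ?case .
    qed
  qed
  show ?thesis
  proof (rule tendstoI)
    fix e :: real assume e: "0 < e"
    define \<epsilon> where "\<epsilon> = e / (2 * (\<bar>\<phi> \<theta>\<bar> + 1))"
    have ep: "0 < \<epsilon>" using e by (simp add: \<epsilon>_def)
    have "eventually (\<lambda>t. \<bar>g t - w\<bar> < \<epsilon>) at_top"
      using tendstoD[OF gw ep] by (simp add: dist_real_def)
    then obtain T0 where T0: "\<And>s. T0 \<le> s \<Longrightarrow> \<bar>g s - w\<bar> \<le> \<epsilon>"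
      by (auto simp: eventually_at_top_linorder intro: less_imp_le)
    define T where "T = max 0 T0"
    have T: "0 \<le> T" "\<And>s. T \<le> s \<Longrightarrow> \<bar>g s - w\<bar> \<le> \<epsilon>" using T0 by (auto simp: T_def)
    have avg: "\<bar>S t n / n - w\<bar> \<le> \<epsilon> + T / t + 1 / n" if "0 < t" "0 < n" for t and n :: nat
    proof -
      let ?L = "{k\<in>{..<n}. real k * (t / n) < T}"
      have "?L \<subseteq> {k. k < nat \<lceil>T * n / t\<rceil>}"
      proof safe
        fix k assume "real k * (t / n) < T"
        then have "real k < T * n / t" using that by (simp add: field_simps)
        then show "k < nat \<lceil>T * n / t\<rceil>" by linarith
      qed
      then have "card ?L \<le> nat \<lceil>T * n / t\<rceil>"
        using card_mono[of "{k. k < nat \<lceil>T * n / t\<rceil>}" ?L] by simp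
      moreover have "0 \<le> T * n / t" using T that by simp
      ultimately have cL: "real (card ?L) \<le> T * n / t + 1"
        by linarith
      have "\<bar>S t n - n * w\<bar> = \<bar>\<Sum>k<n. g (real k * (t / n)) - w\<bar>"
        by (simp add: S_def sum_subtractf)
      also have "\<dots> \<le> (\<Sum>k<n. \<bar>g (real k * (t / n)) - w\<bar>)" by (rule sum_abs)
      also have "\<dots> \<le> (\<Sum>k<n. \<epsilon> + (if real k * (t / n) < T then 1 else 0))"
      proof (rule sum_mono)
        fix k
        have "\<bar>g (real k * (t / n)) - w\<bar> \<le> 1" using gb[of "real k * (t / n)"] w that by auto
        then show "\<bar>g (real k * (t / n)) - w\<bar> \<le> \<epsilon> + (if real k * (t / n) < T then 1 else 0)"
          using T(2)[of "real k * (t / n)"] ep by auto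
      qed
      also have "\<dots> = n * \<epsilon> + card ?L"
        by (simp add: sum.distrib sum.If_cases Int_def)
      also have "\<dots> \<le> n * \<epsilon> + (T * n / t + 1)" using cL by simp
      finally have "\<bar>S t n - n * w\<bar> / n \<le> (n * \<epsilon> + (T * n / t + 1)) / n"
        by (rule divide_right_mono) simp
      moreover have "\<bar>S t n - n * w\<bar> / n = \<bar>S t n / n - w\<bar>"
        using that by (simp add: field_simps flip: abs_divide) (simp add: abs_divide field_simps)
      ultimately show ?thesis using that by (simp add: field_simps)
    qed
    have key: "\<bar>B t / t + \<phi> \<theta> * w\<bar> \<le> 1 / t + \<bar>\<phi> \<theta>\<bar> * (\<epsilon> + T / t)" if t: "0 < t" for t
    proof -
      have 1: "(\<lambda>n. \<bar>g t - g 0 - q t n * (S t n / n) + q t n * w\<bar>) \<longlonglongrightarrow> \<bar>B t + t * \<phi> \<theta> * w\<bar>"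
        by (intro tendsto_intros J[OF t] q)
      have 2: "(\<lambda>n. 1 + \<bar>q t n\<bar> * (\<epsilon> + T / t + 1 / n)) \<longlonglongrightarrow> 1 + \<bar>t * \<phi> \<theta>\<bar> * (\<epsilon> + T / t + 0)"
        by (intro tendsto_intros q lim_1_over_n)
      have "\<bar>B t + t * \<phi> \<theta> * w\<bar> \<le> 1 + \<bar>t * \<phi> \<theta>\<bar> * (\<epsilon> + T / t + 0)"
      proof (rule tendsto_le[OF _ 2 1])
        show "\<forall>\<^sub>F n in sequentially. \<bar>g t - g 0 - q t n * (S t n / n) + q t n * w\<bar> \<le> 1 + \<bar>q t n\<bar> * (\<epsilon> + T / t + 1 / n)"
          using eventually_gt_at_top[of 0]
        proof eventually_elim
          case (elim n)
          have "g t - g 0 - q t n * (S t n / n) + q t n * w = (g t - g 0) - q t n * (S t n / n - w)"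
            by (simp add: right_diff_distrib)
          then have "\<bar>g t - g 0 - q t n * (S t n / n) + q t n * w\<bar> \<le> \<bar>g t - g 0\<bar> + \<bar>q t n * (S t n / n - w)\<bar>"
            by (simp only: abs_triangle_ineq4)
          also have "\<bar>g t - g 0\<bar> \<le> 1" using gb[of t] gb[of 0] t by auto
          also have "\<bar>q t n * (S t n / n - w)\<bar> \<le> \<bar>q t n\<bar> * (\<epsilon> + T / t + 1 / n)"
            unfolding abs_mult using avg[OF t elim] by (intro mult_left_mono) auto
          finally show ?case by simp
        qed
      qed simp
      then have "\<bar>B t + t * \<phi> \<theta> * w\<bar> / t \<le> (1 + \<bar>t * \<phi> \<theta>\<bar> * (\<epsilon> + T / t + 0)) / t"
        using t by (intro divide_right_mono) auto
      moreover have "\<bar>B t + t * \<phi> \<theta> * w\<bar> / t = \<bar>B t / t + \<phi> \<theta> * w\<bar>"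
      proof -
        have "\<bar>B t + t * \<phi> \<theta> * w\<bar> / t = \<bar>(B t + t * \<phi> \<theta> * w) / t\<bar>" using t by (simp add: abs_divide)
        also have "(B t + t * \<phi> \<theta> * w) / t = B t / t + \<phi> \<theta> * w" using t by (simp add: field_simps)
        finally show ?thesis .
      qed
      moreover have "(1 + \<bar>t * \<phi> \<theta>\<bar> * (\<epsilon> + T / t + 0)) / t = 1 / t + \<bar>\<phi> \<theta>\<bar> * (\<epsilon> + T / t)"
        using t by (simp add: abs_mult add_divide_distrib)
      ultimately show ?thesis by simp
    qed
    have "((\<lambda>t. 1 / t + \<bar>\<phi> \<theta>\<bar> * (\<epsilon> + T / t)) \<longlongrightarrow> \<bar>\<phi> \<theta>\<bar> * \<epsilon>) at_top"
      by real_asymp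
    moreover have "\<bar>\<phi> \<theta>\<bar> * \<epsilon> < e"
    proof -
      have "0 \<le> \<bar>\<phi> \<theta>\<bar> * e" using e by simp
      moreover have "e * (2 * (\<bar>\<phi> \<theta>\<bar> + 1)) = 2 * (\<bar>\<phi> \<theta>\<bar> * e) + 2 * e" by (simp add: algebra_simps)
      ultimately have "\<bar>\<phi> \<theta>\<bar> * e < e * (2 * (\<bar>\<phi> \<theta>\<bar> + 1))" using e by linarith
      moreover have "0 < 2 * (\<bar>\<phi> \<theta>\<bar> + 1)" by simp
      ultimately show ?thesis unfolding \<epsilon>_def times_divide_eq_right by (simp only: pos_divide_less_eq)
    qed
    ultimately have "eventually (\<lambda>t. 1 / t + \<bar>\<phi> \<theta>\<bar> * (\<epsilon> + T / t) < e) at_top"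
      by (rule order_tendstoD)
    then show "eventually (\<lambda>t. dist (B t / t) (- (\<phi> \<theta> * w)) < e) at_top"
      using eventually_gt_at_top[of 0]
      by eventually_elim (use key in \<open>auto simp: dist_real_def intro: le_less_trans\<close>)
  qed
qed

end

section \<open>The reflected process\<close>

text \<open>Second-order bound for one grid cell of the reflected process: \<open>v\<close> is the level at the start of the
  cell, \<open>u\<close> the input, \<open>c\<close> the service capacity and \<open>d\<close> the growth of the regulator. Growth is possible
  only if \<open>v\<close> is at most \<open>c\<close>; then all levels that occur have modulus at most \<open>c + u\<close>, where
  \<open>exp (- \<theta> z)\<close> is close to \<open>1\<close>.\<close>

lemma exp_push_error:
  fixes \<theta> c d u v :: real
  assumes th: "0 \<le> \<theta>" and c: "0 \<le> c" and d: "0 \<le> d" and u: "0 \<le> u" and v: "0 \<le> v"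
    and small: "0 < d \<Longrightarrow> d \<le> c - v"
  shows "\<bar>exp (- \<theta> * (v + u - c + d)) - exp (- \<theta> * (v + u - c)) + \<theta> * d\<bar> \<le> \<theta>\<^sup>2 * c * (c + u) * exp (\<theta> * c)"
proof (cases "d = 0")
  case True
  then show ?thesis using assms by simp
next
  case False
  then have d: "0 < d" using d by simp
  let ?x = "v + u - c"
  have "((\<lambda>z. exp (- \<theta> * z)) has_real_derivative - \<theta> * exp (- \<theta> * z)) (at z)" for z
    by (auto intro!: derivative_eq_intros)
  from MVT2[of ?x "?x + d", OF _ this] d
  obtain z where z: "?x < z" "z < ?x + d"
    and eq: "exp (- \<theta> * (?x + d)) - exp (- \<theta> * ?x) = d * (- \<theta> * exp (- \<theta> * z))"
    by auto
  have zb: "- c \<le> z" "\<bar>z\<bar> \<le> c + u" using z small[OF d] v u c by auto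
  have "\<bar>1 - exp (- \<theta> * z)\<bar> \<le> \<theta> * \<bar>z\<bar> * exp (\<theta> * c)"
  proof (cases "0 \<le> z")
    case True
    have "1 - exp (- \<theta> * z) \<le> \<theta> * z" using exp_ge_add_one_self[of "- \<theta> * z"] by simp
    moreover have "0 \<le> 1 - exp (- \<theta> * z)" using True th by simp
    moreover have "\<theta> * z * 1 \<le> \<theta> * z * exp (\<theta> * c)" using True th c by (intro mult_left_mono) auto
    ultimately show ?thesis using True by simp
  next
    case False
    let ?w = "\<theta> * (- z)"
    have w: "0 \<le> ?w" using False th by (intro mult_nonneg_nonneg) auto
    have "exp ?w * (1 - ?w) \<le> exp ?w * exp (- ?w)"
      using exp_ge_add_one_self[of "- ?w"] by (intro mult_left_mono) auto
    then have "exp ?w - 1 \<le> ?w * exp ?w" by (simp add: algebra_simps exp_minus flip: exp_add)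
    also have "\<dots> \<le> ?w * exp (\<theta> * c)"
      using w mult_left_mono[of "- z" c \<theta>] zb th by (intro mult_left_mono) auto
    finally show ?thesis using False w by simp
  qed
  also have "\<dots> \<le> \<theta> * (c + u) * exp (\<theta> * c)"
    using zb th by (intro mult_right_mono mult_left_mono) auto
  finally have 1: "\<bar>1 - exp (- \<theta> * z)\<bar> \<le> \<theta> * (c + u) * exp (\<theta> * c)" .
  have "\<bar>exp (- \<theta> * (?x + d)) - exp (- \<theta> * ?x) + \<theta> * d\<bar> = \<bar>(\<theta> * d) * (1 - exp (- \<theta> * z))\<bar>"
    unfolding eq by (simp add: algebra_simps)
  also have "\<dots> = (\<theta> * d) * \<bar>1 - exp (- \<theta> * z)\<bar>"
    using th d by (simp add: abs_mult)
  also have "\<dots> \<le> (\<theta> * c) * (\<theta> * (c + u) * exp (\<theta> * c))"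
    using 1 small[OF d] v th c by (intro mult_mono mult_left_mono) auto
  finally show ?thesis by (simp add: power2_eq_square mult_ac)
qed

text \<open>A countable index set makes the running infimum measurable. The right endpoint \<open>s\<close> has to be added
  because approximating it from the right would leave the interval.\<close>

lemma INF_right_continuous_eq:
  fixes y :: "real \<Rightarrow> real"
  assumes s: "0 \<le> s" and rc: "\<And>u. 0 \<le> u \<Longrightarrow> continuous (at_right u) y"
    and bdd: "bdd_below (y ` {0..s})"
  shows "(INF u\<in>{0..s}. y u) = (INF u\<in>insert s (\<rat> \<inter> {0..s}). y u)"
proof (rule antisym)
  let ?Q = "insert s (\<rat> \<inter> {0..s})"
  show "(INF u\<in>{0..s}. y u) \<le> (INF u\<in>?Q. y u)"
    using s bdd by (intro cINF_superset_mono) auto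
  have bQ: "bdd_below (y ` ?Q)" using bdd s by (rule_tac bdd_below_mono[OF bdd]) auto
  show "(INF u\<in>?Q. y u) \<le> (INF u\<in>{0..s}. y u)"
  proof (rule cINF_greatest)
    fix u assume u: "u \<in> {0..s}"
    show "(INF u\<in>?Q. y u) \<le> y u"
    proof (cases "u = s")
      case True
      then show ?thesis by (intro cINF_lower[OF bQ]) auto
    next
      case False
      then have us: "u < s" using u by simp
      show ?thesis
      proof (rule field_le_epsilon)
        fix e :: real assume "0 < e"
        have "(y \<longlongrightarrow> y u) (at_right u)"
          using rc[of u] u by (simp add: continuous_within)
        then have "eventually (\<lambda>q. y q < y u + e) (at_right u)"
          using \<open>0 < e\<close> by (intro order_tendstoD) auto
        then obtain b where b: "u < b" "\<And>q. u < q \<Longrightarrow> q < b \<Longrightarrow> y q < y u + e"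
          by (auto simp: eventually_at_right_field)
        obtain q where q: "q \<in> \<rat>" "u < q" "q < min b s"
          using Rats_dense_in_real[of u "min b s"] b(1) us by auto
        then have "(INF u\<in>?Q. y u) \<le> y q" using u by (intro cINF_lower[OF bQ]) auto
        with b(2)[of q] q show "(INF u\<in>?Q. y u) \<le> y u + e" by simp
      qed
    qed
  qed (use s in auto)
qed

text \<open>The process \<open>I\<close> of the reflection, for a path \<open>y\<close> and initial content \<open>c\<close>.\<close>

definition regulator :: "(real \<Rightarrow> real) \<Rightarrow> real \<Rightarrow> real \<Rightarrow> real" where
  "regulator y c s = max 0 (- (INF u\<in>{0..s}. y u) - c)"

lemma reflected_eq_regulator: "reflected Y R0 t \<omega> = R0 \<omega> + Y t \<omega> + regulator (\<lambda>s. Y s \<omega>) (R0 \<omega>) t"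
  by (simp add: reflected_def regulator_def)

lemma
  fixes x y :: "real \<Rightarrow> real"
  assumes mono: "\<And>s t. 0 \<le> s \<Longrightarrow> s \<le> t \<Longrightarrow> x s \<le> x t" and x0: "0 \<le> x 0"
    and y: "\<And>s. y s = x s - r * s" and r: "0 \<le> r" and s: "0 \<le> s" "s \<le> s'"
  shows net_path_bdd_below: "bdd_below (y ` {0..s})"
    and regulator_mono: "regulator y c s \<le> regulator y c s'"
    and regulator_le: "0 \<le> c \<Longrightarrow> regulator y c s \<le> r * s"
    and regulator_nonneg: "0 \<le> c + y s + regulator y c s"
    and regulator_push: "regulator y c s < regulator y c s' \<Longrightarrow>
       regulator y c s' - regulator y c s \<le> r * (s' - s) - (c + y s + regulator y c s)"
proof -
  have low: "- (r * t) \<le> y u" if "0 \<le> u" "u \<le> t" for u t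
    using mono[of 0 u] x0 y[of u] mult_left_mono[OF that(2) r] that by simp
  have bdd: "bdd_below (y ` {0..t})" for t
    using low by (auto intro!: bdd_belowI2[where m="- (r * t)"])
  then show "bdd_below (y ` {0..s})" .
  have "(INF u\<in>{0..s'}. y u) \<le> (INF u\<in>{0..s}. y u)"
    using s by (intro cINF_superset_mono bdd) auto
  then show "regulator y c s \<le> regulator y c s'" by (simp add: regulator_def)
  have "- (r * s) \<le> (INF u\<in>{0..s}. y u)"
    using s low by (intro cINF_greatest) auto
  then show "0 \<le> c \<Longrightarrow> regulator y c s \<le> r * s" using r s by (simp add: regulator_def)
  have "(INF u\<in>{0..s}. y u) \<le> y s" using s by (intro cINF_lower bdd) auto
  then show "0 \<le> c + y s + regulator y c s" by (simp add: regulator_def)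
  assume less: "regulator y c s < regulator y c s'"
  have "min (INF u\<in>{0..s}. y u) (y s - r * (s' - s)) \<le> (INF u\<in>{0..s'}. y u)"
  proof (rule cINF_greatest)
    fix u assume u: "u \<in> {0..s'}"
    show "min (INF u\<in>{0..s}. y u) (y s - r * (s' - s)) \<le> y u"
    proof (cases "u \<le> s")
      case True
      then have "(INF u\<in>{0..s}. y u) \<le> y u" using u by (intro cINF_lower bdd) auto
      then show ?thesis by simp
    next
      case False
      then have "x s \<le> x u" "r * (u - s) \<le> r * (s' - s)"
        using mono[of s u] s u r by (auto intro!: mult_left_mono)
      then have "y s - r * (s' - s) \<le> y u" by (simp add: y algebra_simps)
      then show ?thesis by simp
    qed
  qed (use s in auto)
  then show "regulator y c s' - regulator y c s \<le> r * (s' - s) - (c + y s + regulator y c s)"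
    using less by (auto simp: regulator_def max_def min_def split: if_splits)
qed

context net_input_process begin

lemma filtration_mono_measurable:
  assumes f: "f \<in> borel_measurable (F s)" and le: "s \<le> t" shows "f \<in> borel_measurable (F t)"
  using measurable_mono[of borel borel "F s" "F t"] sets_F_mono[OF le] f by (auto simp: space_F)

lemma reflected_adapted:
  assumes R0: "R0 \<in> borel_measurable (F 0)" and s: "0 \<le> s"
  shows "reflected Y R0 s \<in> borel_measurable (F (ennreal s))"
proof (rule adapted_AE_cong)
  let ?Q = "insert s (\<rat> \<inter> {0..s})"
  let ?g = "\<lambda>\<omega>. R0 \<omega> + Y s \<omega> + max 0 (- (INF u\<in>?Q. Y u \<omega>) - R0 \<omega>)"
  have [measurable]: "R0 \<in> borel_measurable (F (ennreal s))"
    by (rule filtration_mono_measurable[OF R0]) simp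
  have Y: "Y u \<in> borel_measurable (F (ennreal s))" if "0 \<le> u" "u \<le> s" for u
  proof -
    have [measurable]: "X u \<in> borel_measurable (F (ennreal s))"
      by (rule filtration_mono_measurable[OF X_adapted]) (use that in \<open>auto intro: ennreal_leI\<close>)
    show ?thesis unfolding net_input_def[abs_def] by measurable
  qed
  have [measurable]: "(\<lambda>\<omega>. INF u\<in>?Q. Y u \<omega>) \<in> borel_measurable (F (ennreal s))"
    by (intro borel_measurable_cINF_real Y) (use s countable_rat in auto)
  have [measurable]: "Y s \<in> borel_measurable (F (ennreal s))" using Y s by auto
  show "?g \<in> borel_measurable (F (ennreal s))" by measurable
  show "AE \<omega> in M. reflected Y R0 s \<omega> = ?g \<omega>"
    using X_cadlag X_mono X_zero
  proof eventually_elim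
    case (elim \<omega>)
    have "(INF u\<in>{0..s}. Y u \<omega>) = (INF u\<in>?Q. Y u \<omega>)"
    proof (rule INF_right_continuous_eq[OF s])
      show "continuous (at_right u) (\<lambda>u. Y u \<omega>)" if "0 \<le> u" for u
        unfolding net_input_def using elim(1) that by (auto simp: cadlag_def intro!: continuous_intros)
      show "bdd_below ((\<lambda>u. Y u \<omega>) ` {0..s})"
        by (rule net_path_bdd_below[of "\<lambda>u. X u \<omega>" _ r s s]) (use elim r_pos s in \<open>auto simp: net_input_def\<close>)
    qed
    then show ?case by (simp add: reflected_def)
  qed
qed

text \<open>Apply \<open>laplace_balance\<close> to the reflected process. In each cell the regulator grows by at most
  \<open>r t / n\<close>, and by \<open>exp_push_error\<close> the sum over the cells differs from \<open>- \<theta>\<close> times the mean growth by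
  \<open>O (1 / n)\<close>. So the mean growth rate is \<open>\<phi> \<theta> w \<theta> / \<theta>\<close> for every \<open>\<theta> > 0\<close>. This constant is found by
  letting \<open>\<theta> \<rightarrow> 0\<close>, where \<open>\<phi> \<theta> / \<theta> \<rightarrow> \<phi>' 0\<close> and \<open>w \<theta> \<rightarrow> 1\<close>.\<close>

lemma generalized_Pollaczek_Khinchine:
  assumes R0: "R0 \<in> borel_measurable (F 0)" "AE \<omega> in M. 0 \<le> R0 \<omega>"
    and N: "prob_space N" and R: "R \<in> borel_measurable N"
    and conv: "converges_in_distribution M (reflected Y R0) at_top N R"
  shows "AE x in N. 0 \<le> R x"
    and "0 < \<theta> \<Longrightarrow> \<phi> \<theta> * (\<integral>x. exp (- \<theta> * R x) \<partial>N) = \<theta> * drift"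
proof -
  interpret N: prob_space N by fact
  define V where "V = reflected Y R0"
  define D where "D s \<omega> = regulator (\<lambda>u. Y u \<omega>) (R0 \<omega>) s" for s \<omega>
  have V: "V s \<omega> = R0 \<omega> + Y s \<omega> + D s \<omega>" for s \<omega>
    by (simp add: V_def D_def reflected_eq_regulator)
  define good where "good \<omega> \<longleftrightarrow> (\<forall>s t. 0 \<le> s \<longrightarrow> s \<le> t \<longrightarrow> X s \<omega> \<le> X t \<omega>) \<and> X 0 \<omega> = 0 \<and> 0 \<le> R0 \<omega>" for \<omega>
  have good: "AE \<omega> in M. good \<omega>"
    using X_mono X_zero R0(2) by eventually_elim (auto simp: good_def)
  have path: "D s \<omega> \<le> D s' \<omega>" "D s \<omega> \<le> r * s" "0 \<le> V s \<omega>"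
      "D s \<omega> < D s' \<omega> \<Longrightarrow> D s' \<omega> - D s \<omega> \<le> r * (s' - s) - V s \<omega>" "0 \<le> D s \<omega>"
    if g: "good \<omega>" and s: "0 \<le> s" "s \<le> s'" for \<omega> s s'
  proof -
    have X: "X s \<omega> \<le> X t \<omega>" if "0 \<le> s" "s \<le> t" for s t using g that by (auto simp: good_def)
    have X0: "0 \<le> X 0 \<omega>" and R0': "0 \<le> R0 \<omega>" using g by (auto simp: good_def)
    have yeq: "Y s \<omega> = X s \<omega> - r * s" for s by (simp add: net_input_def)
    show "D s \<omega> \<le> D s' \<omega>" unfolding D_def
      by (rule regulator_mono[of "\<lambda>u. X u \<omega>" "\<lambda>u. Y u \<omega>" r]) (use X X0 yeq r_pos s in auto)
    show "D s \<omega> \<le> r * s" unfolding D_def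
      by (rule regulator_le[of "\<lambda>u. X u \<omega>" "\<lambda>u. Y u \<omega>" r s s]) (use X X0 yeq r_pos s R0' in auto)
    show "0 \<le> V s \<omega>" unfolding V D_def
      by (rule regulator_nonneg[of "\<lambda>u. X u \<omega>" "\<lambda>u. Y u \<omega>" r s s]) (use X X0 yeq r_pos s in auto)
    show "D s \<omega> < D s' \<omega> \<Longrightarrow> D s' \<omega> - D s \<omega> \<le> r * (s' - s) - V s \<omega>" unfolding V D_def
      by (rule regulator_push[of "\<lambda>u. X u \<omega>" "\<lambda>u. Y u \<omega>" r s s']) (use X X0 yeq r_pos s in auto)
    show "0 \<le> D s \<omega>" by (simp add: D_def regulator_def)
  qed
  have Vad: "V s \<in> borel_measurable (F (ennreal s))" if "0 \<le> s" for s
    unfolding V_def by (rule reflected_adapted[OF R0(1) that])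
  have Vm: "V s \<in> borel_measurable M" if "0 \<le> s" for s by (rule measurable_from_F[OF Vad[OF that]])
  have Vnn: "AE \<omega> in M. 0 \<le> V s \<omega>" if "0 \<le> s" for s
    using good by eventually_elim (use path(3) that in auto)
  have [measurable]: "R0 \<in> borel_measurable M" by (rule measurable_from_F[OF R0(1)])
  have Ym: "Y s \<in> borel_measurable M" if "0 \<le> s" for s
    using X_measurable[OF that] unfolding net_input_def[abs_def] by measurable
  have Dm: "D s \<in> borel_measurable M" if "0 \<le> s" for s
  proof -
    have "(\<lambda>\<omega>. V s \<omega> - R0 \<omega> - Y s \<omega>) \<in> borel_measurable M"
      using Vm[OF that] Ym[OF that] by measurable
    then show ?thesis by (simp add: V)
  qed
  have Dint: "integrable M (D s)" if "0 \<le> s" for s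
    by (rule integrable_const_bound[where B="r * s", OF _ Dm[OF that]])
       (use good in eventually_elim, use path(2,5)[OF _ that order_refl] in auto)
  have evV: "eventually (\<lambda>s. V s \<in> borel_measurable M \<and> (AE \<omega> in M. 0 \<le> V s \<omega>)) at_top"
    using eventually_ge_at_top[of 0] by eventually_elim (use Vm Vnn in auto)
  have convV: "converges_in_distribution M V at_top N R" using conv by (simp add: V_def)
  show Rnn: "AE x in N. 0 \<le> R x"
    by (rule converges_in_distribution_nonneg[OF N R convV])
       (use evV in \<open>auto elim: eventually_mono\<close>)
  define w where "w \<theta> = (\<integral>x. exp (- \<theta> * R x) \<partial>N)" for \<theta>
  define \<mu> where "\<mu> = r - drift"
  let ?J = "\<lambda>\<theta> s u. expectation (\<lambda>\<omega>. cell_jump \<theta> (\<lambda>s. V s \<omega>) (\<lambda>s. Y s \<omega>) s u)"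
  have EX: "expectation (X h) = \<mu> * h" if "0 \<le> h" for h
  proof -
    have "expectation (Y h) = expectation (X h) - r * h"
      unfolding net_input_def using X_integrable[OF that] by (simp add: prob_space)
    then show ?thesis using net_input_mean[OF that] by (simp add: \<mu>_def algebra_simps)
  qed
  have rate: "((\<lambda>t. (expectation (D t) - expectation (D 0)) / t) \<longlongrightarrow> \<phi> \<theta> * w \<theta> / \<theta>) at_top"
    if th: "0 < \<theta>" for \<theta>
  proof -
    have "((\<lambda>t. (- \<theta> * (expectation (D t) - expectation (D 0))) / t) \<longlongrightarrow> - (\<phi> \<theta> * w \<theta>)) at_top"
    proof (rule laplace_balance[where V=V])
      show "((\<lambda>t. expectation (\<lambda>\<omega>. exp (- \<theta> * V t \<omega>))) \<longlongrightarrow> w \<theta>) at_top"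
        unfolding w_def by (rule converges_in_distribution_laplace[OF N R convV _ evV]) (use th in auto)
      fix t :: real assume t: "0 < t"
      let ?E = "\<lambda>n k. ?J \<theta> (real k * (t / real n)) (real (Suc k) * (t / real n))"
      let ?C = "\<lambda>n. real n * (\<theta>\<^sup>2 * (r * (t / n)) * (r * (t / n) + \<mu> * (t / n)) * exp (\<theta> * (r * (t / n))))"
      \<comment> \<open>Each of the \<open>n\<close> cells contributes an error of order \<open>1 / n\<^sup>2\<close>.\<close>
      have bound: "\<bar>(\<Sum>k<n. ?E n k) - (- \<theta> * (expectation (D t) - expectation (D 0)))\<bar> \<le> ?C n" if n: "0 < n" for n
      proof -
        define h where "h = t / real n"
        have h: "0 \<le> h" using t by (simp add: h_def)
        have one: "\<bar>?J \<theta> s (s + h)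
            + \<theta> * (expectation (D (s + h)) - expectation (D s))\<bar>
            \<le> \<theta>\<^sup>2 * (r * h) * (r * h + \<mu> * h) * exp (\<theta> * (r * h))" if s: "0 \<le> s" for s
        proof -
          have sh: "0 \<le> s + h" "s \<le> s + h" using s h by auto
          have ic: "integrable M (\<lambda>\<omega>. cell_jump \<theta> (\<lambda>s. V s \<omega>) (\<lambda>s. Y s \<omega>) s (s + h))"
            using th by (intro cell_jump_integrable s h Vnn Vad) simp
          let ?G = "\<lambda>\<omega>. cell_jump \<theta> (\<lambda>s. V s \<omega>) (\<lambda>s. Y s \<omega>) s (s + h) + \<theta> * (D (s + h) \<omega> - D s \<omega>)"
          let ?K = "\<lambda>\<omega>. \<theta>\<^sup>2 * (r * h) * exp (\<theta> * (r * h)) * (r * h + (X (s + h) \<omega> - X s \<omega>))"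
          have iG: "integrable M ?G"
            by (intro Bochner_Integration.integrable_add Bochner_Integration.integrable_diff integrable_mult_right ic Dint s sh)
          have iK: "integrable M ?K"
            using X_increment_mean(1)[OF s h] by (intro integrable_mult_right Bochner_Integration.integrable_add) auto
          have "AE \<omega> in M. \<bar>?G \<omega>\<bar> \<le> ?K \<omega>"
            using good
          proof eventually_elim
            case (elim \<omega>)
            let ?d = "D (s + h) \<omega> - D s \<omega>" and ?u = "X (s + h) \<omega> - X s \<omega>"
            have u: "0 \<le> ?u" using elim s h by (auto simp: good_def)
            have e1: "V s \<omega> + (Y (s + h) \<omega> - Y s \<omega>) = V s \<omega> + ?u - r * h"
              by (simp add: net_input_def algebra_simps)
            have e2: "V (s + h) \<omega> = V s \<omega> + ?u - r * h + ?d"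
              by (simp add: V net_input_def algebra_simps)
            have "\<bar>exp (- \<theta> * (V s \<omega> + ?u - r * h + ?d)) - exp (- \<theta> * (V s \<omega> + ?u - r * h)) + \<theta> * ?d\<bar>
              \<le> \<theta>\<^sup>2 * (r * h) * (r * h + ?u) * exp (\<theta> * (r * h))"
              by (rule exp_push_error) (use th r_pos h u path[OF elim s sh(2)] in auto)
            then show ?case unfolding cell_jump_def e1 e2 by (simp only: mult_ac)
          qed
          then have "expectation (\<lambda>\<omega>. \<bar>?G \<omega>\<bar>) \<le> expectation ?K"
            using iG iK by (intro integral_mono_AE) auto
          then have "\<bar>expectation ?G\<bar> \<le> expectation ?K"
            using integral_abs_bound[of M ?G] by linarith
          also have "expectation ?K = \<theta>\<^sup>2 * (r * h) * exp (\<theta> * (r * h)) * (r * h + \<mu> * h)"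
            using X_increment_mean[OF s h] EX[OF h] by (simp add: prob_space)
          also have "expectation ?G = ?J \<theta> s (s + h)
            + \<theta> * (expectation (D (s + h)) - expectation (D s))"
            using ic Dint[OF s] Dint[OF sh(1)] by simp
          finally show ?thesis by (simp only: mult_ac)
        qed
        let ?K = "\<theta>\<^sup>2 * (r * h) * (r * h + \<mu> * h) * exp (\<theta> * (r * h))"
        have tel: "(\<Sum>k<n. \<theta> * (expectation (D (real (Suc k) * h)) - expectation (D (real k * h)))) = \<theta> * (expectation (D t) - expectation (D 0))"
          using sum_lessThan_telescope[of "\<lambda>k. expectation (D (real k * h))" n] n
          by (simp add: h_def flip: sum_distrib_left)
        have "\<bar>(\<Sum>k<n. ?E n k + \<theta> * (expectation (D (real (Suc k) * h)) - expectation (D (real k * h))))\<bar> \<le> (\<Sum>k<n. ?K)"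
        proof (rule order_trans[OF sum_abs], rule sum_mono)
          fix k
          have k: "real (Suc k) * h = real k * h + h" by (simp add: distrib_right)
          show "\<bar>?E n k + \<theta> * (expectation (D (real (Suc k) * h)) - expectation (D (real k * h)))\<bar> \<le> ?K"
            using one[of "real k * h"] h unfolding h_def[symmetric] k by simp
        qed
        then show ?thesis
          unfolding sum.distrib tel by (simp add: h_def)
      qed
      have "?C \<longlonglongrightarrow> 0" by real_asymp
      then have "(\<lambda>n. (\<Sum>k<n. ?E n k) - (- \<theta> * (expectation (D t) - expectation (D 0)))) \<longlonglongrightarrow> 0"
        by (rule Lim_null_comparison[rotated])
           (use eventually_gt_at_top[of "0::nat"] in eventually_elim, use bound in simp)
      then show "(\<lambda>n. \<Sum>k<n. ?E n k) \<longlonglongrightarrow> - \<theta> * (expectation (D t) - expectation (D 0))"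
        by (simp only: LIM_zero_iff)
    qed (use th Vnn Vad in auto)
    then have "((\<lambda>t. (- \<theta> * (expectation (D t) - expectation (D 0))) / t / (- \<theta>)) \<longlongrightarrow> - (\<phi> \<theta> * w \<theta>) / (- \<theta>)) at_top"
      by (rule tendsto_divide) (use th in auto)
    moreover have "(- \<theta> * (expectation (D t) - expectation (D 0))) / t / (- \<theta>) = (expectation (D t) - expectation (D 0)) / t" for t
      using th by (cases "t = 0") (simp_all add: field_simps)
    moreover have "- (\<phi> \<theta> * w \<theta>) / (- \<theta>) = \<phi> \<theta> * w \<theta> / \<theta>" by simp
    ultimately show ?thesis by (simp only:)
  qed
  \<comment> \<open>The common value for all \<open>\<theta>\<close>, read off at \<open>\<theta> = 1\<close>.\<close>
  define c where "c = \<phi> 1 * w 1 / 1"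
  have const: "\<phi> \<theta> * w \<theta> / \<theta> = c" if "0 < \<theta>" for \<theta>
    unfolding c_def by (rule tendsto_unique[OF _ rate[OF that] rate]) auto
  have "((\<lambda>\<theta>. \<phi> \<theta> / \<theta> * w \<theta>) \<longlongrightarrow> drift * 1) (at_right 0)"
    unfolding w_def by (intro tendsto_mult net_exponent_over_theta N.laplace_transform_at_0 R Rnn)
  moreover have "eventually (\<lambda>\<theta>. \<phi> \<theta> / \<theta> * w \<theta> = c) (at_right 0)"
    using eventually_at_right_less[of 0] by eventually_elim (use const in simp)
  ultimately have "((\<lambda>\<theta>::real. c) \<longlongrightarrow> drift * 1) (at_right 0)"
    by (rule Lim_transform_eventually)
  then have "c = drift" by (simp add: tendsto_const_iff)
  then show "0 < \<theta> \<Longrightarrow> \<phi> \<theta> * (\<integral>x. exp (- \<theta> * R x) \<partial>N) = \<theta> * drift"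
    using const[of \<theta>] by (simp add: w_def field_simps)
qed

end

section \<open>Sample paths of the waiting time\<close>

text \<open>Once the mesh is finer than the gaps between the jump times, every cell contains at most one of them.
  The sum then has one nonzero term per jump, evaluated at the right endpoint of its cell, and these
  endpoints decrease to the jump time.\<close>

lemma jump_sum_limit:
  fixes V :: "real \<Rightarrow> real" and G :: "real \<Rightarrow> real" and loc sz :: "'k \<Rightarrow> real"
  assumes t: "0 < t" and K: "finite K" and inj: "inj_on loc K"
    and loc: "\<And>\<kappa>. \<kappa> \<in> K \<Longrightarrow> 0 < loc \<kappa> \<and> loc \<kappa> \<le> t"
    and V: "\<And>u. 0 \<le> u \<Longrightarrow> continuous (at_right u) V" and G: "continuous_on UNIV G"
  shows "(\<lambda>n. \<Sum>k<n. G (V (real (Suc k) * (t / n))) - G (V (real (Suc k) * (t / n)) -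
        (\<Sum>\<kappa>\<in>{\<kappa>\<in>K. real k * (t / n) < loc \<kappa> \<and> loc \<kappa> \<le> real (Suc k) * (t / n)}. sz \<kappa>)))
      \<longlonglongrightarrow> (\<Sum>\<kappa>\<in>K. G (V (loc \<kappa>)) - G (V (loc \<kappa>) - sz \<kappa>))"
proof -
  \<comment> \<open>The cell number of \<open>u\<close>; cells are open on the left and closed on the right.\<close>
  define c where "c n u = nat (\<lceil>u * real n / t\<rceil> - 1)" for n :: nat and u
  define f where "f n k A = G (V (real (Suc k) * (t / n))) - G (V (real (Suc k) * (t / n)) - (\<Sum>\<kappa>\<in>A. sz \<kappa>))"
    for n k :: nat and A
  let ?A = "\<lambda>n k. {\<kappa>\<in>K. real k * (t / real n) < loc \<kappa> \<and> loc \<kappa> \<le> real (Suc k) * (t / real n)}"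
  let ?L = "\<Sum>\<kappa>\<in>K. G (V (loc \<kappa>)) - G (V (loc \<kappa>) - sz \<kappa>)"
  have cell: "real k * (t / n) < u \<and> u \<le> real (Suc k) * (t / n) \<longleftrightarrow> k = c n u" if "0 < n" "0 < u" for n k u
  proof -
    let ?z = "u * real n / t"
    have z: "0 < ?z" using that t by simp
    have "real k * (t / n) < u \<longleftrightarrow> real k < ?z" "u \<le> real (Suc k) * (t / n) \<longleftrightarrow> ?z \<le> real k + 1"
      using that t by (simp_all add: pos_less_divide_eq pos_divide_less_eq pos_le_divide_eq pos_divide_le_eq add.commute)
    then have "real k * (t / n) < u \<and> u \<le> real (Suc k) * (t / n) \<longleftrightarrow> real k < ?z \<and> ?z \<le> real k + 1"
      by simp
    also have "\<dots> \<longleftrightarrow> \<lceil>?z\<rceil> = int k + 1" by (subst ceiling_eq_iff) auto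
    also have "\<dots> \<longleftrightarrow> k = c n u"
    proof -
      have "1 \<le> \<lceil>?z\<rceil>" using z by linarith
      then show ?thesis unfolding c_def by linarith
    qed
    finally show ?thesis .
  qed
  have c_less: "c n u < n" if "0 < n" "0 < u" "u \<le> t" for n u
  proof -
    have "real (c n u) * (t / n) < u" using cell[OF that(1,2), of "c n u"] by simp
    also have "u \<le> real n * (t / n)" using that by simp
    finally have "real (c n u) * (t / n) < real n * (t / n)" .
    moreover have "0 < t / n" using t that by simp
    ultimately have "real (c n u) < real n" by (simp only: mult_less_cancel_right_pos)
    then show ?thesis by simp
  qed
  \<comment> \<open>For fine meshes different jump times lie in different cells.\<close>
  have sep: "eventually (\<lambda>n. \<forall>\<kappa>\<in>K. \<forall>\<kappa>'\<in>K. \<kappa> \<noteq> \<kappa>' \<longrightarrow> t / real n < \<bar>loc \<kappa> - loc \<kappa>'\<bar>) sequentially"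
  proof (intro eventually_ball_finite K ballI)
    fix \<kappa> \<kappa>' assume "\<kappa> \<in> K" "\<kappa>' \<in> K"
    show "eventually (\<lambda>n. \<kappa> \<noteq> \<kappa>' \<longrightarrow> t / real n < \<bar>loc \<kappa> - loc \<kappa>'\<bar>) sequentially"
    proof (cases "\<kappa> = \<kappa>'")
      case False
      then have "0 < \<bar>loc \<kappa> - loc \<kappa>'\<bar>" using inj \<open>\<kappa> \<in> K\<close> \<open>\<kappa>' \<in> K\<close> by (auto dest: inj_onD)
      moreover have "(\<lambda>n. t / real n) \<longlonglongrightarrow> 0" by real_asymp
      ultimately have "eventually (\<lambda>n. t / real n < \<bar>loc \<kappa> - loc \<kappa>'\<bar>) sequentially" by (intro order_tendstoD)
      then show ?thesis by eventually_elim simp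
    qed simp
  qed
  have "eventually (\<lambda>n. (\<Sum>\<kappa>\<in>K. f n (c n (loc \<kappa>)) {\<kappa>}) =
      (\<Sum>k<n. f n k (?A n k))) sequentially"
    using sep eventually_gt_at_top[of "0::nat"]
  proof eventually_elim
    case (elim n)
    have A: "(?A n k) = {\<kappa>\<in>K. k = c n (loc \<kappa>)}" for k
    proof (intro Collect_cong conj_cong refl)
      fix \<kappa> assume "\<kappa> \<in> K"
      then show "real k * (t / n) < loc \<kappa> \<and> loc \<kappa> \<le> real (Suc k) * (t / n) \<longleftrightarrow> k = c n (loc \<kappa>)"
        using loc by (intro cell[OF elim(2)]) simp
    qed
    have cinj: "inj_on (\<lambda>\<kappa>. c n (loc \<kappa>)) K"
    proof (rule inj_onI, rule ccontr)
      fix \<kappa> \<kappa>' assume K': "\<kappa> \<in> K" "\<kappa>' \<in> K" "c n (loc \<kappa>) = c n (loc \<kappa>')" "\<kappa> \<noteq> \<kappa>'"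
      let ?k = "c n (loc \<kappa>)"
      have "real ?k * (t / n) < loc \<kappa> \<and> loc \<kappa> \<le> real (Suc ?k) * (t / n)"
        "real ?k * (t / n) < loc \<kappa>' \<and> loc \<kappa>' \<le> real (Suc ?k) * (t / n)"
        using iffD2[OF cell[OF elim(2), of "loc \<kappa>"]] iffD2[OF cell[OF elim(2), of "loc \<kappa>'"]] loc[OF K'(1)] loc[OF K'(2)] K'(3)
        by blast+
      moreover have "real (Suc ?k) * (t / n) = real ?k * (t / n) + t / n"
        by (simp add: distrib_right add_divide_distrib)
      ultimately have "\<bar>loc \<kappa> - loc \<kappa>'\<bar> \<le> t / n" by linarith
      moreover have "t / n < \<bar>loc \<kappa> - loc \<kappa>'\<bar>" using elim(1)[rule_format, OF K'(1,2,4)] .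
      ultimately show False by linarith
    qed
    have "(\<Sum>k<n. f n k {\<kappa>\<in>K. k = c n (loc \<kappa>)}) = (\<Sum>k\<in>(\<lambda>\<kappa>. c n (loc \<kappa>)) ` K. f n k {\<kappa>\<in>K. k = c n (loc \<kappa>)})"
    proof (rule sum.mono_neutral_right)
      show "(\<lambda>\<kappa>. c n (loc \<kappa>)) ` K \<subseteq> {..<n}"
      proof (intro image_subsetI)
        fix \<kappa> assume "\<kappa> \<in> K"
        from loc[OF this] show "c n (loc \<kappa>) \<in> {..<n}" using c_less[OF elim(2), of "loc \<kappa>"] by simp
      qed
      show "\<forall>k\<in>{..<n} - (\<lambda>\<kappa>. c n (loc \<kappa>)) ` K. f n k {\<kappa> \<in> K. k = c n (loc \<kappa>)} = 0"
      proof
        fix k assume "k \<in> {..<n} - (\<lambda>\<kappa>. c n (loc \<kappa>)) ` K"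
        then have "{\<kappa> \<in> K. k = c n (loc \<kappa>)} = {}" by blast
        then show "f n k {\<kappa> \<in> K. k = c n (loc \<kappa>)} = 0" by (simp only: f_def sum.empty diff_zero diff_self)
      qed
    qed simp
    also have "\<dots> = (\<Sum>\<kappa>\<in>K. f n (c n (loc \<kappa>)) {\<kappa>'\<in>K. c n (loc \<kappa>) = c n (loc \<kappa>')})"
      by (simp add: sum.reindex[OF cinj])
    also have "\<dots> = (\<Sum>\<kappa>\<in>K. f n (c n (loc \<kappa>)) {\<kappa>})"
    proof (rule sum.cong[OF refl])
      fix \<kappa> assume "\<kappa> \<in> K"
      then have "{\<kappa>'\<in>K. c n (loc \<kappa>) = c n (loc \<kappa>')} = {\<kappa>}" using cinj by (auto dest: inj_onD)
      then show "f n (c n (loc \<kappa>)) {\<kappa>'\<in>K. c n (loc \<kappa>) = c n (loc \<kappa>')} = f n (c n (loc \<kappa>)) {\<kappa>}" by simp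
    qed
    finally show ?case unfolding A by simp
  qed
  moreover have "(\<lambda>n. \<Sum>\<kappa>\<in>K. f n (c n (loc \<kappa>)) {\<kappa>}) \<longlonglongrightarrow> ?L"
  proof (rule tendsto_sum)
    fix \<kappa> assume \<kappa>: "\<kappa> \<in> K"
    let ?u = "loc \<kappa>"
    define q where "q n = (if n = 0 then ?u else real (Suc (c n ?u)) * (t / real n))" for n
    have qb: "?u \<le> q n" "q n \<le> ?u + t / real n" for n
      using cell[of n ?u "c n ?u"] loc[OF \<kappa>]
      by (auto simp: q_def distrib_right add_divide_distrib)
    have "(\<lambda>n. ?u + t / real n) \<longlonglongrightarrow> ?u" by real_asymp
    with tendsto_const have "q \<longlonglongrightarrow> ?u"
      by (rule tendsto_sandwich[rotated 2]) (simp_all add: qb)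
    moreover have "continuous (at ?u within {?u..}) V"
      using V[of ?u] loc[OF \<kappa>] by (simp add: at_within_Ici_at_right)
    ultimately have "(\<lambda>n. V (q n)) \<longlonglongrightarrow> V ?u"
      using qb by (intro continuous_within_tendsto_compose'[of ?u "{?u..}" V q]) auto
    then have "(\<lambda>n. G (V (q n)) - G (V (q n) - sz \<kappa>)) \<longlonglongrightarrow> G (V ?u) - G (V ?u - sz \<kappa>)"
      by (intro tendsto_diff continuous_on_tendsto_compose[OF G] tendsto_const) auto
    moreover have "eventually (\<lambda>n. G (V (q n)) - G (V (q n) - sz \<kappa>) = f n (c n ?u) {\<kappa>}) sequentially"
      using eventually_gt_at_top[of "0::nat"] by eventually_elim (simp add: f_def q_def)
    ultimately show "(\<lambda>n. f n (c n ?u) {\<kappa>}) \<longlonglongrightarrow> G (V ?u) - G (V ?u - sz \<kappa>)"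
      by (rule Lim_transform_eventually)
  qed
  ultimately have "(\<lambda>n. \<Sum>k<n. f n k (?A n k))
      \<longlonglongrightarrow> ?L"
    by (rule Lim_transform_eventually[rotated])
  then show ?thesis unfolding f_def .
qed

text \<open>A sample path of the queue that satisfies all requirements of the model that hold almost surely.\<close>

locale queue_path =
  R: arrival_times \<tau> \<omega> + Vac: arrival_times \<sigma> \<omega>
  for X :: "real \<Rightarrow> 'a \<Rightarrow> real" and r :: real and W0 :: "'a \<Rightarrow> real"
    and \<tau> :: "nat \<Rightarrow> 'a \<Rightarrow> ennreal" and \<xi> :: "nat \<Rightarrow> 'a \<Rightarrow> real"
    and \<sigma> :: "nat \<Rightarrow> 'a \<Rightarrow> ennreal" and \<eta> :: "nat \<Rightarrow> 'a \<Rightarrow> real" and \<omega> :: 'a +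
  assumes X_mono: "0 \<le> s \<Longrightarrow> s \<le> t \<Longrightarrow> X s \<omega> \<le> X t \<omega>" and X_start: "0 \<le> X 0 \<omega>"
    and X_right_cont: "0 \<le> t \<Longrightarrow> continuous (at_right t) (\<lambda>t. X t \<omega>)"
    and r_pos: "0 < r" and W0_nonneg: "0 \<le> W0 \<omega>"
    and repair_pos: "1 \<le> i \<Longrightarrow> 0 < \<xi> i \<omega>" and vacation_pos: "1 \<le> i \<Longrightarrow> 0 < \<eta> i \<omega>"
    and hitting: "1 \<le> n \<Longrightarrow> \<sigma> n \<omega> = Inf {ennreal t | t. 0 \<le> t \<and>
        W0 \<omega> + X t \<omega> - r * t + (\<Sum>i=1..num_until \<tau> t \<omega>. \<xi> i \<omega>) + (\<Sum>i=1..n-1. \<eta> i \<omega>) = 0}"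
begin

text \<open>The waiting time with only the first \<open>j - 1\<close> vacations, for \<open>j \<ge> 1\<close>: vacation \<open>j\<close> starts when this
  path first hits \<open>0\<close>.\<close>

definition before_vacation :: "nat \<Rightarrow> real \<Rightarrow> real" where
  "before_vacation j t = W0 \<omega> + X t \<omega> - r * t + (\<Sum>i=1..R.cnt t. \<xi> i \<omega>) + (\<Sum>i=1..j-1. \<eta> i \<omega>)"

abbreviation "Wait t \<equiv> waiting_time X r W0 \<tau> \<xi> \<sigma> \<eta> t \<omega>"

lemma Wait_eq: "Wait t = before_vacation (Suc (Vac.cnt t)) t"
  by (simp add: waiting_time_def before_vacation_def)

lemma repairs_mono: "m \<le> n \<Longrightarrow> (\<Sum>i=1..m. \<xi> i \<omega>) \<le> (\<Sum>i=1..n. \<xi> i \<omega>)"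
proof (rule sum_mono2)
  fix i assume "i \<in> {1..n} - {1..m}"
  then have "1 \<le> i" by simp
  then show "0 \<le> \<xi> i \<omega>" by (rule less_imp_le[OF repair_pos])
qed auto

lemma vacations_mono: "m \<le> n \<Longrightarrow> (\<Sum>i=1..m. \<eta> i \<omega>) \<le> (\<Sum>i=1..n. \<eta> i \<omega>)"
proof (rule sum_mono2)
  fix i assume "i \<in> {1..n} - {1..m}"
  then have "1 \<le> i" by simp
  then show "0 \<le> \<eta> i \<omega>" by (rule less_imp_le[OF vacation_pos])
qed auto

lemma before_vacation_start: "0 \<le> before_vacation j 0"
  using W0_nonneg X_start repairs_mono[of 0 "R.cnt 0"] vacations_mono[of 0 "j - 1"]
  by (simp add: before_vacation_def)

lemma before_vacation_decrease:
  assumes "0 \<le> s" "s \<le> t" shows "before_vacation j s - r * (t - s) \<le> before_vacation j t"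
proof -
  have "(\<Sum>i=1..R.cnt s. \<xi> i \<omega>) \<le> (\<Sum>i=1..R.cnt t. \<xi> i \<omega>)"
    by (rule repairs_mono[OF R.cnt_mono[OF assms(2)]])
  then show ?thesis using X_mono[OF assms] by (simp add: before_vacation_def algebra_simps)
qed

lemma before_vacation_right_cont:
  assumes t: "0 \<le> t" shows "(before_vacation j \<longlongrightarrow> before_vacation j t) (at_right t)"
proof -
  have "((\<lambda>s. W0 \<omega> + X s \<omega> - r * s + (\<Sum>i=1..R.cnt t. \<xi> i \<omega>) + (\<Sum>i=1..j-1. \<eta> i \<omega>)) \<longlongrightarrow> before_vacation j t) (at_right t)"
    unfolding before_vacation_def using X_right_cont[OF t]
    by (intro tendsto_intros) (simp add: continuous_within)
  then show ?thesis
    by (rule Lim_transform_eventually)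
       (use R.cnt_right_constant[OF t] in eventually_elim, simp add: before_vacation_def)
qed

lemma Wait_right_cont:
  assumes t: "0 \<le> t" shows "continuous (at_right t) Wait"
proof -
  have "(Wait \<longlongrightarrow> Wait t) (at_right t)"
    by (rule Lim_transform_eventually[OF before_vacation_right_cont[OF t, of "Suc (Vac.cnt t)"], folded Wait_eq])
       (use Vac.cnt_right_constant[OF t] in eventually_elim, simp add: Wait_eq)
  then show ?thesis by (simp add: continuous_within)
qed

lemma not_before_hitting: "1 \<le> j \<Longrightarrow> 0 \<le> t \<Longrightarrow> before_vacation j t = 0 \<Longrightarrow> \<sigma> j \<omega> \<le> ennreal t"
  unfolding hitting[of j] before_vacation_def by (rule Inf_lower) auto

text \<open>Let \<open>s\<close> tend to \<open>u\<close>. The premise holds for the value at \<open>u\<close> of a path that was nonnegative before,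
  since service removes at most \<open>r (u - s)\<close> between \<open>s\<close> and \<open>u\<close>.\<close>

lemma limit_from_left_nonneg:
  assumes u: "0 < u" and s: "\<And>s. 0 \<le> s \<Longrightarrow> s < u \<Longrightarrow> - (r * (u - s)) \<le> (y::real)"
  shows "0 \<le> y"
proof (rule field_le_epsilon)
  fix e :: real assume e: "0 < e"
  let ?s = "max 0 (u - e / r)"
  have "u - ?s \<le> e / r" by simp
  then have "r * (u - ?s) \<le> e" using r_pos by (simp add: field_simps)
  moreover have "- (r * (u - ?s)) \<le> y" using u e r_pos by (intro s) auto
  ultimately show "0 \<le> y + e" by simp
qed

text \<open>The path moves down only continuously, by the service, so before becoming negative it must hit \<open>0\<close>,
  and the first time when this happens is the start of vacation \<open>j\<close>.\<close>

lemma before_vacation_nonneg: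
  assumes j: "1 \<le> j" and t: "0 \<le> t" "ennreal t \<le> \<sigma> j \<omega>" shows "0 \<le> before_vacation j t"
proof (rule ccontr)
  assume neg: "\<not> 0 \<le> before_vacation j t"
  let ?B = "{s. 0 \<le> s \<and> s \<le> t \<and> before_vacation j s < 0}"
  \<comment> \<open>The path is \<open>0\<close> at the time \<open>u\<close> when it first becomes negative: it is nonnegative by its slow decrease and nonpositive by right-continuity.\<close>
  define u where "u = Inf ?B"
  have tB: "t \<in> ?B" using neg t by simp
  have bdd: "bdd_below ?B" by (rule bdd_belowI[of _ 0]) auto
  have u: "0 \<le> u" "u \<le> t"
    unfolding u_def using tB by (auto intro!: cInf_greatest cInf_lower bdd)
  have before: "0 \<le> before_vacation j s" if "0 \<le> s" "s < u" for s
    using cInf_lower[OF _ bdd, of s] that u unfolding u_def[symmetric] by (force simp: not_le)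
  have ge: "0 \<le> before_vacation j u"
  proof (cases "u = 0")
    case False
    then show ?thesis
      using u before before_vacation_decrease[of _ u j] by (intro limit_from_left_nonneg[of u]) force+
  qed (use before_vacation_start in simp)
  moreover have "\<not> 0 < before_vacation j u"
  proof
    assume pos: "0 < before_vacation j u"
    then have "eventually (\<lambda>s. 0 < before_vacation j s) (at_right u)"
      by (rule order_tendstoD(1)[OF before_vacation_right_cont[OF u(1)]])
    then obtain b where b: "u < b" "\<And>s. u < s \<Longrightarrow> s < b \<Longrightarrow> 0 < before_vacation j s"
      by (auto simp: eventually_at_right_field)
    have "b \<le> Inf ?B"
    proof (rule cInf_greatest)
      fix s assume s: "s \<in> ?B"
      then have "u \<le> s" unfolding u_def by (intro cInf_lower bdd)
      show "b \<le> s"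
      proof (rule ccontr)
        assume "\<not> b \<le> s"
        then have "0 < before_vacation j s" using b(2)[of s] pos \<open>u \<le> s\<close> by (cases "s = u") simp_all
        with s show False by simp
      qed
    qed (use tB in auto)
    then show False using b(1) by (simp add: u_def)
  qed
  ultimately have zero: "before_vacation j u = 0" by simp
  have "ennreal t \<le> ennreal u" using t(2) not_before_hitting[OF j u(1) zero] by (rule order_trans)
  then have "u = t" using u t by (simp add: ennreal_le_iff)
  then show False using zero neg by simp
qed

text \<open>The start of a vacation is an infimum of times; by right-continuity the path is \<open>0\<close> there and not
  merely at times shortly after.\<close>

lemma before_vacation_hits:
  assumes j: "1 \<le> j" shows "before_vacation j (enn2real (\<sigma> j \<omega>)) = 0"
proof (rule ccontr)
  let ?s = "enn2real (\<sigma> j \<omega>)"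
  assume ne: "before_vacation j ?s \<noteq> 0"
  have s0: "0 \<le> ?s" by simp
  have fin: "ennreal ?s = \<sigma> j \<omega>" by (rule Vac.finite_time[OF j])
  have "eventually (\<lambda>u. before_vacation j u \<noteq> 0) (at_right ?s)"
    by (rule tendsto_imp_eventually_ne[OF before_vacation_right_cont[OF s0] ne])
  then obtain b where b: "?s < b" "\<And>u. ?s < u \<Longrightarrow> u < b \<Longrightarrow> before_vacation j u \<noteq> 0"
    by (auto simp: eventually_at_right_field)
  have "ennreal ?s < ennreal b" using b(1) s0 by (intro ennreal_lessI) linarith+
  then have "\<exists>x\<in>{ennreal t | t. 0 \<le> t \<and> before_vacation j t = 0}. x < ennreal b"
    unfolding fin by (simp only: hitting[OF j] Inf_less_iff before_vacation_def)
  then obtain u where u: "0 \<le> u" "before_vacation j u = 0" "ennreal u < ennreal b"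
    by blast
  have "ennreal ?s \<le> ennreal u" unfolding fin by (rule not_before_hitting[OF j u(1,2)])
  then have "?s \<le> u" using u(1) by (simp add: ennreal_le_iff)
  moreover have "u < b" using u by (simp add: ennreal_less_iff)
  ultimately show False using b(2)[of u] ne u(2) by (cases "u = ?s") auto
qed

text \<open>Just before the failure the path is nonnegative, and at the failure it jumps up by at least the repair
  time.\<close>

lemma failure_before_vacation:
  assumes i: "1 \<le> i" and j: "1 \<le> j" and le: "\<tau> i \<omega> \<le> \<sigma> j \<omega>"
  shows "\<xi> i \<omega> \<le> before_vacation j (enn2real (\<tau> i \<omega>))"
proof -
  let ?u = "enn2real (\<tau> i \<omega>)"
  have u: "ennreal ?u = \<tau> i \<omega>" by (rule R.finite_time[OF i])
  have cu: "R.cnt ?u = i" by (rule R.cnt_at[OF i])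
  have split: "(\<Sum>k=1..R.cnt ?u. \<xi> k \<omega>) = (\<Sum>k=1..i-1. \<xi> k \<omega>) + \<xi> i \<omega>"
    unfolding cu using i by (cases i) auto
  have "0 \<le> before_vacation j ?u - \<xi> i \<omega>"
  proof (cases "?u = 0")
    case True
    have "0 \<le> (\<Sum>k=1..i-1. \<xi> k \<omega>)" "0 \<le> (\<Sum>k=1..j-1. \<eta> k \<omega>)"
      using repairs_mono[of 0 "i - 1"] vacations_mono[of 0 "j - 1"] by simp_all
    then show ?thesis using split True W0_nonneg X_start by (simp add: before_vacation_def)
  next
    case False
    then have u0: "0 < ?u" using enn2real_nonneg[of "\<tau> i \<omega>"] by linarith
    show ?thesis
    proof (rule limit_from_left_nonneg[OF u0])
      fix s assume s: "0 \<le> s" "s < ?u"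
      then have "ennreal s < ennreal ?u" by (intro ennreal_lessI) auto
      then have su: "ennreal s < \<tau> i \<omega>" unfolding u .
      then have "0 \<le> before_vacation j s"
        using le by (intro before_vacation_nonneg[OF j s(1)]) auto
      moreover have "\<not> i \<le> R.cnt s" using R.cnt_ge_iff[OF i, of s] su by simp
      then have "(\<Sum>k=1..R.cnt s. \<xi> k \<omega>) \<le> (\<Sum>k=1..i-1. \<xi> k \<omega>)"
        by (intro repairs_mono) simp
      moreover have "X s \<omega> \<le> X ?u \<omega>" using X_mono s by auto
      ultimately show "- (r * (?u - s)) \<le> before_vacation j ?u - \<xi> i \<omega>"
        using split by (simp add: before_vacation_def right_diff_distrib)
    qed
  qed
  then show ?thesis by simp
qed

lemma Wait_nonneg: assumes "0 \<le> t" shows "0 \<le> Wait t"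
  unfolding Wait_eq
  by (rule before_vacation_nonneg) (use assms Vac.next_after[of t] in auto)

lemma Wait_before_repair_nonneg: assumes i: "1 \<le> i" shows "\<xi> i \<omega> \<le> Wait (enn2real (\<tau> i \<omega>))"
  unfolding Wait_eq
  by (rule failure_before_vacation[OF i])
     (use Vac.next_after[of "enn2real (\<tau> i \<omega>)"] R.finite_time[OF i] in auto)

lemma Wait_at_vacation: assumes j: "1 \<le> j" shows "Wait (enn2real (\<sigma> j \<omega>)) = \<eta> j \<omega>"
proof -
  have "before_vacation (Suc j) (enn2real (\<sigma> j \<omega>)) = before_vacation j (enn2real (\<sigma> j \<omega>)) + \<eta> j \<omega>"
    using j by (cases j) (auto simp: before_vacation_def)
  then show ?thesis using before_vacation_hits[OF j] Vac.cnt_at[OF j] by (simp add: Wait_eq)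
qed

text \<open>A repair time is positive, so the path cannot be at \<open>0\<close> at a failure. Hence no jump time carries both
  a repair and a vacation, and their contributions separate.\<close>

lemma failure_not_at_vacation:
  assumes i: "1 \<le> i" and j: "1 \<le> j" shows "\<tau> i \<omega> \<noteq> \<sigma> j \<omega>"
proof
  assume "\<tau> i \<omega> = \<sigma> j \<omega>"
  then have "\<xi> i \<omega> \<le> before_vacation j (enn2real (\<sigma> j \<omega>))"
    using failure_before_vacation[OF i j] by simp
  then show False using before_vacation_hits[OF j] repair_pos[OF i] by simp
qed

definition repair_gap :: "real \<Rightarrow> nat \<Rightarrow> real" where
  "repair_gap \<theta> i = exp (- \<theta> * (Wait (enn2real (\<tau> i \<omega>)) - \<xi> i \<omega>)) - exp (- \<theta> * Wait (enn2real (\<tau> i \<omega>)))"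

definition work :: "real \<Rightarrow> real" where
  "work t = (\<Sum>i=1..R.cnt t. \<xi> i \<omega>) + (\<Sum>i=1..Vac.cnt t. \<eta> i \<omega>)"

lemma Wait_work: "Wait t = W0 \<omega> + net_input X r t \<omega> + work t"
  by (simp add: waiting_time_def work_def net_input_def)

lemma work_mono: "s \<le> t \<Longrightarrow> work s \<le> work t"
  unfolding work_def by (intro add_mono repairs_mono vacations_mono R.cnt_mono Vac.cnt_mono)

text \<open>The pathwise limit of the jump sums in \<open>laplace_balance\<close>. Events at time \<open>0\<close> are part of the initial
  state \<open>Wait 0\<close> and do not belong to any cell, which explains the subtracted sums up to \<open>0\<close>. A vacation
  lifts the path from \<open>0\<close> to \<open>\<eta> j\<close>.\<close>

lemma jumps_limit:
  assumes t: "0 < t"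
  shows "(\<lambda>n. \<Sum>k<n. cell_jump \<theta> Wait (\<lambda>s. net_input X r s \<omega>) (real k * (t / n)) (real (Suc k) * (t / n)))
    \<longlonglongrightarrow> - (((\<Sum>i=1..R.cnt t. repair_gap \<theta> i) - (\<Sum>i=1..R.cnt 0. repair_gap \<theta> i)) +
         ((\<Sum>j=1..Vac.cnt t. 1 - exp (- \<theta> * \<eta> j \<omega>)) - (\<Sum>j=1..Vac.cnt 0. 1 - exp (- \<theta> * \<eta> j \<omega>))))"
proof -
  let ?A = "\<lambda>s t. {i. 1 \<le> i \<and> ennreal s < \<tau> i \<omega> \<and> \<tau> i \<omega> \<le> ennreal t}"
  let ?B = "\<lambda>s t. {i. 1 \<le> i \<and> ennreal s < \<sigma> i \<omega> \<and> \<sigma> i \<omega> \<le> ennreal t}"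
  have A: "{1..R.cnt t} - {1..R.cnt s} = ?A s t" for s t
    unfolding set_eq_iff Diff_iff R.in_range_iff mem_Collect_eq not_le[symmetric] by blast
  have B: "{1..Vac.cnt t} - {1..Vac.cnt s} = ?B s t" for s t
    unfolding set_eq_iff Diff_iff Vac.in_range_iff mem_Collect_eq not_le[symmetric] by blast
  have finA: "finite (?A s t)" and finB: "finite (?B s t)" for s t
    unfolding A[symmetric] B[symmetric] by auto
  have diffA: "(\<Sum>i=1..R.cnt t. f i) - (\<Sum>i=1..R.cnt s. f i) = sum f (?A s t)" if "s \<le> t" for f :: "nat \<Rightarrow> real" and s t
    unfolding A[symmetric] using R.cnt_mono[OF that] by (subst sum_diff) auto
  have diffB: "(\<Sum>i=1..Vac.cnt t. f i) - (\<Sum>i=1..Vac.cnt s. f i) = sum f (?B s t)" if "s \<le> t" for f :: "nat \<Rightarrow> real" and s t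
    unfolding B[symmetric] using Vac.cnt_mono[OF that] by (subst sum_diff) auto
  \<comment> \<open>Repairs and vacations in \<open>(0, t]\<close> as one family of jumps with locations and sizes.\<close>
  define K where "K = ?A 0 t <+> ?B 0 t"
  define loc where "loc = case_sum (\<lambda>i. enn2real (\<tau> i \<omega>)) (\<lambda>j. enn2real (\<sigma> j \<omega>))"
  define sz where "sz = case_sum (\<lambda>i. \<xi> i \<omega>) (\<lambda>j. \<eta> j \<omega>)"
  let ?cell = "\<lambda>s u. {\<kappa>\<in>K. s < loc \<kappa> \<and> loc \<kappa> \<le> u}"
  have time_iff: "(ennreal s < x \<and> x \<le> ennreal u) \<longleftrightarrow> (s < enn2real x \<and> enn2real x \<le> u)"
    if "ennreal (enn2real x) = x" "0 \<le> s" "0 \<le> u" for x s u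
    using that enn2real_nonneg[of x] by (metis ennreal_le_iff ennreal_less_iff)
  have loc_iff: "(ennreal s < \<tau> i \<omega> \<and> \<tau> i \<omega> \<le> ennreal u) \<longleftrightarrow> (s < loc (Inl i) \<and> loc (Inl i) \<le> u)"
      "(ennreal s < \<sigma> i \<omega> \<and> \<sigma> i \<omega> \<le> ennreal u) \<longleftrightarrow> (s < loc (Inr i) \<and> loc (Inr i) \<le> u)"
    if "1 \<le> i" "0 \<le> s" "0 \<le> u" for i s u
    unfolding loc_def old.sum.simps
    by (rule time_iff[OF R.finite_time[OF that(1)] that(2,3)], rule time_iff[OF Vac.finite_time[OF that(1)] that(2,3)])
  have inj: "inj_on loc K"
  proof (rule inj_onI)
    fix \<kappa> \<kappa>' assume K': "\<kappa> \<in> K" "\<kappa>' \<in> K" and eq: "loc \<kappa> = loc \<kappa>'"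
    have no: "loc (Inl i) \<noteq> loc (Inr j)" if "1 \<le> i" "1 \<le> j" for i j
      using failure_not_at_vacation[OF that] R.finite_time[OF that(1)] Vac.finite_time[OF that(2)]
      unfolding loc_def old.sum.simps by metis
    have l: "i = i'" if "loc (Inl i) = loc (Inl i')" "1 \<le> i" "1 \<le> i'" for i i'
      by (rule inj_onD[OF R.inj]) (use that in \<open>simp_all add: loc_def\<close>)
    have r: "i = i'" if "loc (Inr i) = loc (Inr i')" "1 \<le> i" "1 \<le> i'" for i i'
      by (rule inj_onD[OF Vac.inj]) (use that in \<open>simp_all add: loc_def\<close>)
    have pos: "1 \<le> i" if "Inl i \<in> K \<or> Inr i \<in> K" for i using that by (auto simp: K_def)
    show "\<kappa> = \<kappa>'"
    proof (cases \<kappa>; cases \<kappa>')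
      fix i i' assume "\<kappa> = Inl i" "\<kappa>' = Inl i'"
      then show ?thesis using l[of i i'] pos eq K' by blast
    next
      fix i i' assume "\<kappa> = Inr i" "\<kappa>' = Inr i'"
      then show ?thesis using r[of i i'] pos eq K' by blast
    next
      fix i j assume "\<kappa> = Inl i" "\<kappa>' = Inr j"
      then show ?thesis using no[of i j] pos eq K' by blast
    next
      fix j i assume "\<kappa> = Inr j" "\<kappa>' = Inl i"
      then show ?thesis using no[of i j] pos eq[symmetric] K' by blast
    qed
  qed
  have size: "(\<Sum>\<kappa>\<in>(?cell s u). sz \<kappa>) = work u - work s" if su: "0 \<le> s" "s \<le> u" "u \<le> t" for s u
  proof -
    have "(?cell s u) = ?A s u <+> ?B s u"
    proof -
      have 1: "ennreal 0 < x \<and> x \<le> ennreal t" if "ennreal s < x" "x \<le> ennreal u" for x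
        using that su by (meson ennreal_leI le_less_trans order_trans)
      have u0: "0 \<le> u" using su by simp
      have Plus_iff: "Inl i \<in> A <+> B \<longleftrightarrow> i \<in> A" "Inr i \<in> A <+> B \<longleftrightarrow> i \<in> B" for i :: nat and A B
        by auto
      show ?thesis
      proof (intro set_eqI)
        fix \<kappa>
        show "\<kappa> \<in> (?cell s u) \<longleftrightarrow> \<kappa> \<in> ?A s u <+> ?B s u"
        proof (cases \<kappa>)
          case (Inl i)
          have "\<kappa> \<in> (?cell s u) \<longleftrightarrow> 1 \<le> i \<and> (ennreal 0 < \<tau> i \<omega> \<and> \<tau> i \<omega> \<le> ennreal t) \<and> (s < loc (Inl i) \<and> loc (Inl i) \<le> u)"
            by (simp add: K_def Inl Plus_iff)
          also have "\<dots> \<longleftrightarrow> 1 \<le> i \<and> ennreal s < \<tau> i \<omega> \<and> \<tau> i \<omega> \<le> ennreal u"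
            using loc_iff(1)[OF _ su(1) u0, of i] 1[of "\<tau> i \<omega>"] by blast
          finally show ?thesis by (simp add: Inl Plus_iff)
        next
          case (Inr i)
          have "\<kappa> \<in> (?cell s u) \<longleftrightarrow> 1 \<le> i \<and> (ennreal 0 < \<sigma> i \<omega> \<and> \<sigma> i \<omega> \<le> ennreal t) \<and> (s < loc (Inr i) \<and> loc (Inr i) \<le> u)"
            by (simp add: K_def Inr Plus_iff)
          also have "\<dots> \<longleftrightarrow> 1 \<le> i \<and> ennreal s < \<sigma> i \<omega> \<and> \<sigma> i \<omega> \<le> ennreal u"
            using loc_iff(2)[OF _ su(1) u0, of i] 1[of "\<sigma> i \<omega>"] by blast
          finally show ?thesis by (simp add: Inr Plus_iff)
        qed
      qed
    qed
    then have "(\<Sum>\<kappa>\<in>(?cell s u). sz \<kappa>) = (\<Sum>i\<in>?A s u. \<xi> i \<omega>) + (\<Sum>j\<in>?B s u. \<eta> j \<omega>)"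
      using finA finB by (simp add: sum.Plus sz_def)
    also have "\<dots> = work u - work s"
      using diffA[OF su(2), of "\<lambda>i. \<xi> i \<omega>"] diffB[OF su(2), of "\<lambda>i. \<eta> i \<omega>"] by (simp add: work_def)
    finally show ?thesis .
  qed
  have lim: "(\<lambda>n. \<Sum>k<n. exp (- \<theta> * Wait (real (Suc k) * (t / n))) - exp (- \<theta> * (Wait (real (Suc k) * (t / n)) -
        (\<Sum>\<kappa>\<in>(?cell (real k * (t / n)) (real (Suc k) * (t / n))). sz \<kappa>))))
      \<longlonglongrightarrow> (\<Sum>\<kappa>\<in>K. exp (- \<theta> * Wait (loc \<kappa>)) - exp (- \<theta> * (Wait (loc \<kappa>) - sz \<kappa>)))"
  proof (rule jump_sum_limit[OF t _ inj, where G="\<lambda>w. exp (- \<theta> * w)"])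
    show "finite K" unfolding K_def using finA finB by (intro finite_Plus)
    show "0 < loc \<kappa> \<and> loc \<kappa> \<le> t" if "\<kappa> \<in> K" for \<kappa>
      using that loc_iff[OF _ order_refl less_imp_le[OF t]] unfolding K_def by (elim PlusE) blast+
  qed (auto intro!: Wait_right_cont continuous_intros)
  have split: "(\<Sum>\<kappa>\<in>K. exp (- \<theta> * Wait (loc \<kappa>)) - exp (- \<theta> * (Wait (loc \<kappa>) - sz \<kappa>))) =
      (\<Sum>i\<in>?A 0 t. - repair_gap \<theta> i) + (\<Sum>j\<in>?B 0 t. - (1 - exp (- \<theta> * \<eta> j \<omega>)))"
  proof -
    have "(\<Sum>\<kappa>\<in>K. exp (- \<theta> * Wait (loc \<kappa>)) - exp (- \<theta> * (Wait (loc \<kappa>) - sz \<kappa>))) =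
      (\<Sum>i\<in>?A 0 t. exp (- \<theta> * Wait (loc (Inl i))) - exp (- \<theta> * (Wait (loc (Inl i)) - sz (Inl i)))) +
      (\<Sum>j\<in>?B 0 t. exp (- \<theta> * Wait (loc (Inr j))) - exp (- \<theta> * (Wait (loc (Inr j)) - sz (Inr j))))"
      by (simp only: K_def sum.Plus[OF finA finB] comp_def)
    moreover have "exp (- \<theta> * Wait (loc (Inl i))) - exp (- \<theta> * (Wait (loc (Inl i)) - sz (Inl i))) = - repair_gap \<theta> i" for i
      by (simp add: loc_def sz_def repair_gap_def)
    moreover have "exp (- \<theta> * Wait (loc (Inr j))) - exp (- \<theta> * (Wait (loc (Inr j)) - sz (Inr j))) = - (1 - exp (- \<theta> * \<eta> j \<omega>))"
      if "j \<in> ?B 0 t" for j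
      using Wait_at_vacation[of j] that by (simp add: loc_def sz_def)
    ultimately show ?thesis by simp
  qed
  have total: "\<dots> = - (((\<Sum>i=1..R.cnt t. repair_gap \<theta> i) - (\<Sum>i=1..R.cnt 0. repair_gap \<theta> i)) +
         ((\<Sum>j=1..Vac.cnt t. 1 - exp (- \<theta> * \<eta> j \<omega>)) - (\<Sum>j=1..Vac.cnt 0. 1 - exp (- \<theta> * \<eta> j \<omega>))))"
    unfolding sum_negf diffA[OF less_imp_le[OF t]] diffB[OF less_imp_le[OF t]] by simp
  have cells: "(\<lambda>n. \<Sum>k<n. exp (- \<theta> * Wait (real (Suc k) * (t / n))) - exp (- \<theta> * (Wait (real (Suc k) * (t / n)) -
        (\<Sum>\<kappa>\<in>(?cell (real k * (t / n)) (real (Suc k) * (t / n))). sz \<kappa>)))) =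
     (\<lambda>n. \<Sum>k<n. cell_jump \<theta> Wait (\<lambda>s. net_input X r s \<omega>) (real k * (t / n)) (real (Suc k) * (t / n)))"
  proof (intro ext sum.cong refl)
    fix n k :: nat assume "k \<in> {..<n}"
    then have k: "0 < n" "Suc k \<le> n" by auto
    let ?s = "real k * (t / n)" and ?u = "real (Suc k) * (t / n)"
    have su: "0 \<le> ?s" "?s \<le> ?u" using t by (auto intro!: divide_right_mono mult_right_mono)
    have "?u \<le> real n * (t / n)" using k t by (intro mult_right_mono) auto
    then have "?u \<le> t" using k by simp
    from size[OF su this]
    have "Wait ?u - (\<Sum>\<kappa>\<in>(?cell ?s ?u). sz \<kappa>) = Wait ?s + (net_input X r ?u \<omega> - net_input X r ?s \<omega>)"
      by (simp only: Wait_work)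
    then show "exp (- \<theta> * Wait ?u) - exp (- \<theta> * (Wait ?u - (\<Sum>\<kappa>\<in>(?cell ?s ?u). sz \<kappa>))) =
       cell_jump \<theta> Wait (\<lambda>s. net_input X r s \<omega>) ?s ?u"
      by (simp only: cell_jump_def)
  qed
  show ?thesis using lim unfolding cells split total .
qed


text \<open>An integrable bound that is uniform in the grid. Within a cell the path may fall below \<open>0\<close> before the
  vacation time is added, but by no more than \<open>r t\<close>; this is the origin of the factor
  \<open>exp (\<theta> r t)\<close>.\<close>

lemma jumps_bound:
  assumes t: "0 < t" and th: "0 \<le> \<theta>" and n: "0 < n"
  shows "\<bar>\<Sum>k<n. cell_jump \<theta> Wait (\<lambda>s. net_input X r s \<omega>) (real k * (t / n)) (real (Suc k) * (t / n))\<bar> \<le> \<theta> * exp (\<theta> * (r * t)) * work t"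
proof -
  let ?y = "\<lambda>s. net_input X r s \<omega>" and ?h = "t / real n" and ?C = "\<theta> * exp (\<theta> * (r * t))"
  have C: "0 \<le> ?C" using th by simp
  have one: "\<bar>cell_jump \<theta> Wait ?y s u\<bar> \<le> ?C * (work u - work s)" if su: "0 \<le> s" "s \<le> u" "u \<le> t" for s u
  proof -
    let ?b = "Wait s + (?y u - ?y s)" and ?d = "work u - work s"
    have d: "0 \<le> \<theta> * ?d" using work_mono[OF su(2)] th by simp
    have "r * (u - s) \<le> r * t" using su r_pos by (intro mult_left_mono) auto
    then have "- (r * t) \<le> ?b"
      using Wait_nonneg[OF su(1)] X_mono[OF su(1,2)] by (simp add: net_input_def right_diff_distrib)
    from mult_left_mono[OF this th] have e: "exp (- \<theta> * ?b) \<le> exp (\<theta> * (r * t))" by simp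
    have "Wait u = ?b + ?d" by (simp only: Wait_work)
    then have "exp (- \<theta> * Wait u) = exp (- \<theta> * ?b) * exp (- (\<theta> * ?d))"
      by (simp only: distrib_left exp_add) simp
    then have "\<bar>cell_jump \<theta> Wait ?y s u\<bar> = \<bar>exp (- \<theta> * ?b) * (exp (- (\<theta> * ?d)) - 1)\<bar>"
      by (simp only: cell_jump_def right_diff_distrib mult_1_right)
    also have "\<dots> = exp (- \<theta> * ?b) * (1 - exp (- (\<theta> * ?d)))"
      using d by (simp add: abs_mult)
    also have "\<dots> \<le> exp (\<theta> * (r * t)) * (\<theta> * ?d)"
      by (rule mult_mono[OF e one_minus_exp_bounds(2)[OF d] _ one_minus_exp_bounds(1)[OF d]]) simp
    finally show ?thesis by (simp only: mult_ac)
  qed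
  have "\<bar>\<Sum>k<n. cell_jump \<theta> Wait ?y (real k * ?h) (real (Suc k) * ?h)\<bar>
    \<le> (\<Sum>k<n. ?C * (work (real (Suc k) * ?h) - work (real k * ?h)))"
  proof (rule order_trans[OF sum_abs], rule sum_mono)
    fix k assume "k \<in> {..<n}"
    then have k: "Suc k \<le> n" by simp
    have su: "0 \<le> real k * ?h" "real k * ?h \<le> real (Suc k) * ?h" using t by (auto intro!: divide_right_mono mult_right_mono)
    have "real (Suc k) * ?h \<le> real n * ?h" using k t by (intro mult_right_mono) auto
    then have "real (Suc k) * ?h \<le> t" using n by simp
    from one[OF su this]
    show "\<bar>cell_jump \<theta> Wait ?y (real k * ?h) (real (Suc k) * ?h)\<bar> \<le> ?C * (work (real (Suc k) * ?h) - work (real k * ?h))" .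
  qed
  also have "\<dots> = ?C * (work (real n * ?h) - work 0)"
    using sum_lessThan_telescope[of "\<lambda>k. work (real k * ?h)" n] by (simp flip: sum_distrib_left)
  also have "\<dots> \<le> ?C * work t"
    using n repairs_mono[of 0 "R.cnt 0"] vacations_mono[of 0 "Vac.cnt 0"]
    by (intro mult_left_mono[OF _ C]) (simp add: work_def)
  finally show ?thesis .
qed

end

section \<open>The queue in steady state\<close>

sublocale fluid_queue \<subseteq> net: net_input_process M F X a \<nu> r
  by unfold_locales (fact subordinator_X laplace_X rho_less net_input_integrable)+

context fluid_queue begin

lemma tau_measurable: "1 \<le> n \<Longrightarrow> \<tau> n \<in> borel_measurable M"
  by (rule measurable_stopping_time[OF tau_stopping subalg space_F])

lemma sigma_measurable: "1 \<le> n \<Longrightarrow> \<sigma> n \<in> borel_measurable M"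
  by (rule measurable_stopping_time[OF sigma_stopping subalg space_F])

text \<open>A variable known at the stopping time \<open>T\<close> is known at time \<open>s\<close> on the event \<open>T \<le> s\<close>. Taking
  \<open>s = \<infinity>\<close> gives measurability with respect to \<open>M\<close>.\<close>

lemma pre_sigma_measurable:
  fixes Z :: "'a \<Rightarrow> real"
  assumes T: "stopping_time F T" and Z: "Z \<in> borel_measurable (pre_sigma T)"
  shows "Z \<in> borel_measurable M"
    and "(\<lambda>\<omega>. if T \<omega> \<le> ennreal s then Z \<omega> else 0) \<in> borel_measurable (F (ennreal s))"
proof -
  have ev: "{\<omega> \<in> space M. c < Z \<omega>} \<in> sets (pre_sigma T)" for c
    using Z by (simp add: borel_measurable_iff_greater space_pre_sigma)
  have "{\<omega> \<in> space M. c < Z \<omega>} \<in> sets M" for c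
    using sets_pre_sigmaD[OF T ev[of c], of top] subalg[of top] by auto
  then show "Z \<in> borel_measurable M" by (simp add: borel_measurable_iff_greater)
  show "(\<lambda>\<omega>. if T \<omega> \<le> ennreal s then Z \<omega> else 0) \<in> borel_measurable (F (ennreal s))"
    unfolding borel_measurable_iff_greater space_F
  proof
    fix c
    have 1: "{\<omega> \<in> {\<omega> \<in> space M. c < Z \<omega>}. T \<omega> \<le> ennreal s} \<in> sets (F (ennreal s))"
      by (rule sets_pre_sigmaD[OF T ev])
    have 2: "{\<omega> \<in> space M. \<not> T \<omega> \<le> ennreal s} \<in> sets (F (ennreal s))"
      using stopping_timeD2[OF T, of "ennreal s"] by (simp add: pred_def space_F not_le)
    show "{\<omega> \<in> space M. c < (if T \<omega> \<le> ennreal s then Z \<omega> else 0)} \<in> sets (F (ennreal s))"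
    proof (cases "c < 0")
      case True
      then have "{\<omega> \<in> space M. c < (if T \<omega> \<le> ennreal s then Z \<omega> else 0)} =
        {\<omega> \<in> {\<omega> \<in> space M. c < Z \<omega>}. T \<omega> \<le> ennreal s} \<union> {\<omega> \<in> space M. \<not> T \<omega> \<le> ennreal s}" by auto
      then show ?thesis using sets.Un[OF 1 2] by simp
    next
      case False
      then have "{\<omega> \<in> space M. c < (if T \<omega> \<le> ennreal s then Z \<omega> else 0)} =
        {\<omega> \<in> {\<omega> \<in> space M. c < Z \<omega>}. T \<omega> \<le> ennreal s}" by auto
      then show ?thesis using 1 by simp
    qed
  qed
qed

lemma xi_M: "1 \<le> n \<Longrightarrow> \<xi> n \<in> borel_measurable M"
  by (rule pre_sigma_measurable(1)[OF tau_stopping xi_measurable])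

lemma eta_M: "1 \<le> n \<Longrightarrow> \<eta> n \<in> borel_measurable M"
  by (rule pre_sigma_measurable(1)[OF sigma_stopping eta_measurable])

lemma W0_M: "W0 \<in> borel_measurable M"
  by (rule net.measurable_from_F[OF W0_measurable])

end

lemma const_over_time_tendsto_0: "((\<lambda>t::real. c / t) \<longlongrightarrow> 0) at_top"
  by real_asymp

context fluid_queue_steady_state begin

lemma AE_queue_path: "AE \<omega> in M. queue_path X r W0 \<tau> \<xi> \<sigma> \<eta> \<omega>"
proof -
  have "AE \<omega> in M. \<forall>t. \<exists>n\<ge>1. ennreal t < \<tau> n \<omega>" "AE \<omega> in M. \<forall>t. \<exists>n\<ge>1. ennreal t < \<sigma> n \<omega>"
    by (rule AE_unbounded_of_rate[OF rates_pos(1) tau_measurable tau_rate], assumption,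
        rule AE_unbounded_of_rate[OF rates_pos(2) sigma_measurable sigma_rate], assumption)
  moreover have "AE \<omega> in M. \<forall>i. 1 \<le> i \<longrightarrow> 0 < \<xi> i \<omega>" "AE \<omega> in M. \<forall>i. 1 \<le> i \<longrightarrow> 0 < \<eta> i \<omega>"
  proof -
    have "AE \<omega> in M. 1 \<le> i \<longrightarrow> 0 < \<xi> i \<omega>" "AE \<omega> in M. 1 \<le> i \<longrightarrow> 0 < \<eta> i \<omega>" for i
      using xi_pos[of i] eta_pos[of i] by (cases "1 \<le> i"; simp)+
    then show "AE \<omega> in M. \<forall>i. 1 \<le> i \<longrightarrow> 0 < \<xi> i \<omega>" "AE \<omega> in M. \<forall>i. 1 \<le> i \<longrightarrow> 0 < \<eta> i \<omega>"
      unfolding AE_all_countable by blast+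
  qed
  ultimately show ?thesis
    using tau_strict sigma_strict sigma_eq W0_nonneg net.X_mono net.X_zero net.X_cadlag
  proof eventually_elim
    case (elim \<omega>)
    show ?case
    proof
      fix n :: nat assume n: "1 \<le> n"
      show "\<tau> n \<omega> < \<tau> (Suc n) \<omega>" using elim(5) n by blast
      show "\<sigma> n \<omega> < \<sigma> (Suc n) \<omega>" using elim(6) n by blast
      show "0 < \<xi> n \<omega>" using elim(3) n by blast
      show "0 < \<eta> n \<omega>" using elim(4) n by blast
      show "\<sigma> n \<omega> = Inf {ennreal t | t. 0 \<le> t \<and> W0 \<omega> + X t \<omega> - r * t +
          (\<Sum>i=1..num_until \<tau> t \<omega>. \<xi> i \<omega>) + (\<Sum>i=1..n-1. \<eta> i \<omega>) = 0}"
        by (rule elim(7)[rule_format, OF n])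
    next
      fix t :: real
      show "\<exists>n\<ge>1. ennreal t < \<tau> n \<omega>" "\<exists>n\<ge>1. ennreal t < \<sigma> n \<omega>"
        by (rule elim(1)[rule_format], rule elim(2)[rule_format])
      assume "0 \<le> t"
      then show "continuous (at_right t) (\<lambda>t. X t \<omega>)" using elim(11) by (simp add: cadlag_def)
    next
      fix s t :: real assume "0 \<le> s" "s \<le> t"
      then show "X s \<omega> \<le> X t \<omega>" using elim(9) by blast
    next
      show "0 < r" by (rule net.r_pos)
      show "0 \<le> W0 \<omega>" by (rule elim(8))
      show "0 \<le> X 0 \<omega>" using elim(10) by simp
    qed
  qed
qed

lemma Wt_adapted:
  assumes s: "0 \<le> s" shows "Wt s \<in> borel_measurable (F (ennreal s))"
proof (rule net.adapted_AE_cong)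
  let ?g = "\<lambda>\<omega>. W0 \<omega> + X s \<omega> - r * s + (\<Sum>i. if \<tau> (Suc i) \<omega> \<le> ennreal s then \<xi> (Suc i) \<omega> else 0)
      + (\<Sum>i. if \<sigma> (Suc i) \<omega> \<le> ennreal s then \<eta> (Suc i) \<omega> else 0)"
  have W0: "W0 \<in> borel_measurable (F (ennreal s))"
    by (rule net.filtration_mono_measurable[OF W0_measurable]) simp
  have R: "(\<lambda>\<omega>. if \<tau> (Suc i) \<omega> \<le> ennreal s then \<xi> (Suc i) \<omega> else 0) \<in> borel_measurable (F (ennreal s))" for i
    by (rule pre_sigma_measurable(2)[OF tau_stopping xi_measurable]) simp_all
  have V: "(\<lambda>\<omega>. if \<sigma> (Suc i) \<omega> \<le> ennreal s then \<eta> (Suc i) \<omega> else 0) \<in> borel_measurable (F (ennreal s))" for i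
    by (rule pre_sigma_measurable(2)[OF sigma_stopping eta_measurable]) simp_all
  show "?g \<in> borel_measurable (F (ennreal s))"
    by (intro borel_measurable_add borel_measurable_diff borel_measurable_const borel_measurable_suminf W0 net.X_adapted[OF s] R V)
  show "AE \<omega> in M. Wt s \<omega> = ?g \<omega>"
    using AE_queue_path
  proof eventually_elim
    case (elim \<omega>)
    then interpret queue_path X r W0 \<tau> \<xi> \<sigma> \<eta> \<omega> .
    show ?case
      unfolding waiting_time_def by (simp only: R.random_sum_as_series Vac.random_sum_as_series)
  qed
qed

lemma Wt_nonneg: "0 \<le> s \<Longrightarrow> AE \<omega> in M. 0 \<le> Wt s \<omega>"
  using AE_queue_path by eventually_elim (rule queue_path.Wait_nonneg)

abbreviation "repairs t \<omega> \<equiv> \<Sum>i=1..num_until \<tau> t \<omega>. \<xi> i \<omega>"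
abbreviation "vacations t \<omega> \<equiv> \<Sum>i=1..num_until \<sigma> t \<omega>. \<eta> i \<omega>"

lemma repairs_vacations_nonneg: "AE \<omega> in M. \<forall>t. 0 \<le> repairs t \<omega> \<and> 0 \<le> vacations t \<omega>"
  using AE_queue_path
proof eventually_elim
  case (elim \<omega>)
  then interpret queue_path X r W0 \<tau> \<xi> \<sigma> \<eta> \<omega> .
  show ?case
  proof
    fix t
    show "0 \<le> repairs t \<omega> \<and> 0 \<le> vacations t \<omega>"
      using repairs_mono[of 0 "R.cnt t"] vacations_mono[of 0 "Vac.cnt t"] by simp
  qed
qed

lemma W0_integrable: "integrable M W0"
proof (rule Bochner_Integration.integrable_bound[OF Wt_integrable[of 0] W0_M])
  show "AE \<omega> in M. norm (W0 \<omega>) \<le> norm (Wt 0 \<omega>)"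
    using repairs_vacations_nonneg W0_nonneg net.X_zero
  proof eventually_elim
    case (elim \<omega>)
    then have "W0 \<omega> \<le> Wt 0 \<omega>" using elim(1)[rule_format, of 0] by (simp add: waiting_time_def)
    then show ?case using elim(2) by simp
  qed
qed simp

lemma Wt_decomposition: "Wt t \<omega> = W0 \<omega> + net_input X r t \<omega> + repairs t \<omega> + vacations t \<omega>"
  by (simp add: waiting_time_def net_input_def)

lemma
  assumes t: "0 \<le> t"
  shows repairs_integrable: "integrable M (repairs t)" and vacations_integrable: "integrable M (vacations t)"
proof -
  have int: "integrable M (\<lambda>\<omega>. Wt t \<omega> - W0 \<omega> - net_input X r t \<omega>)"
    by (intro Bochner_Integration.integrable_diff Wt_integrable W0_integrable net_input_integrable t)
  show "integrable M (repairs t)"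
    by (rule Bochner_Integration.integrable_bound[OF int random_sum_measurable[OF tau_measurable xi_M]])
       (assumption, assumption, use repairs_vacations_nonneg in eventually_elim, simp add: Wt_decomposition)
  show "integrable M (vacations t)"
    by (rule Bochner_Integration.integrable_bound[OF int random_sum_measurable[OF sigma_measurable eta_M]])
       (assumption, assumption, use repairs_vacations_nonneg in eventually_elim, simp add: Wt_decomposition)
qed

sublocale repair: renewal_reward M \<tau> \<xi> lamR
proof
  show "AE \<omega> in M. \<forall>n\<ge>1. 0 \<le> \<xi> n \<omega>"
    using AE_queue_path by eventually_elim (blast intro: less_imp_le queue_path.repair_pos)
qed (fact rates_pos tau_measurable tau_strict tau_rate xi_M xi_ident xi_integrable repairs_integrable)+

sublocale vacation: renewal_reward M \<sigma> \<eta> lamV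
proof
  show "AE \<omega> in M. \<forall>n\<ge>1. 0 \<le> \<eta> n \<omega>"
    using AE_queue_path by eventually_elim (blast intro: less_imp_le queue_path.vacation_pos)
qed (fact rates_pos sigma_measurable sigma_strict sigma_rate eta_M eta_ident eta_integrable vacations_integrable)+

abbreviation "drift \<equiv> right_deriv_0 (net_exponent a \<nu> r)"

text \<open>The constant \<open>p\<close> splits the drift into the rates at which repairs and vacations bring in work.\<close>

lemma repair_work_rate: "lamR * expectation (\<xi> 1) = p * drift"
proof -
  have "expectation (\<xi> 1) \<noteq> 0" using p_lambdaR rates_pos by auto
  then show ?thesis by (subst p_lambdaR) simp
qed

lemma vacation_work_rate: "lamV * expectation (\<eta> 1) = (1 - p) * drift"
proof -
  have "expectation (\<eta> 1) \<noteq> 0" using p_lambdaV rates_pos by auto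
  then show ?thesis by (subst p_lambdaV) simp
qed

text \<open>The two mean works add up to \<open>E W\<^sub>t - E W\<^sub>0 + t \<phi>' 0\<close>, and \<open>E W\<^sub>t / t\<close> vanishes in the limit. The sum
  of the two lower bounds is already \<open>\<phi>' 0\<close>.\<close>

lemma work_rates:
  shows repairs_rate: "((\<lambda>t. expectation (repairs t) / t) \<longlongrightarrow> lamR * expectation (\<xi> 1)) at_top"
    and vacations_rate: "((\<lambda>t. expectation (vacations t) / t) \<longlongrightarrow> lamV * expectation (\<eta> 1)) at_top"
proof -
  have sum: "((\<lambda>t. expectation (repairs t) / t + expectation (vacations t) / t) \<longlongrightarrow>
      lamR * expectation (\<xi> 1) + lamV * expectation (\<eta> 1)) at_top"
  proof (rule Lim_transform_eventually)
    have "((\<lambda>t. expectation (Wt t) / t - expectation W0 / t + drift) \<longlongrightarrow> 0 - 0 + drift) at_top"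
      by (intro tendsto_add tendsto_diff tendsto_const Wt_mean const_over_time_tendsto_0)
    also have "0 - 0 + drift = lamR * expectation (\<xi> 1) + lamV * expectation (\<eta> 1)"
      unfolding repair_work_rate vacation_work_rate by (simp add: algebra_simps)
    finally show "((\<lambda>t. expectation (Wt t) / t - expectation W0 / t + drift) \<longlongrightarrow>
        lamR * expectation (\<xi> 1) + lamV * expectation (\<eta> 1)) at_top" .
    show "eventually (\<lambda>t. expectation (Wt t) / t - expectation W0 / t + drift =
        expectation (repairs t) / t + expectation (vacations t) / t) at_top"
      using eventually_gt_at_top[of 0]
    proof eventually_elim
      case (elim t)
      then have t: "0 \<le> t" by simp
      have "expectation (Wt t) = expectation (\<lambda>\<omega>. W0 \<omega> + net_input X r t \<omega> + repairs t \<omega> + vacations t \<omega>)"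
        by (rule Bochner_Integration.integral_cong[OF refl Wt_decomposition])
      also have "\<dots> = expectation W0 + expectation (net_input X r t) + expectation (repairs t) + expectation (vacations t)"
        using W0_integrable net_input_integrable[OF t] repairs_integrable[OF t] vacations_integrable[OF t] by simp
      also have "expectation (net_input X r t) = - t * drift" by (rule net.net_input_mean[OF t])
      finally show ?case using elim by (simp add: field_simps)
    qed
  qed
  from two_part_squeeze[OF sum repair.total_lower_bound vacation.total_lower_bound]
  show "((\<lambda>t. expectation (repairs t) / t) \<longlongrightarrow> lamR * expectation (\<xi> 1)) at_top"
    "((\<lambda>t. expectation (vacations t) / t) \<longlongrightarrow> lamV * expectation (\<eta> 1)) at_top" by simp_all
qed

abbreviation "after_failure k \<omega> \<equiv> Wt (enn2real (\<tau> k \<omega>)) \<omega>"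

definition repair_loss :: "real \<Rightarrow> nat \<Rightarrow> 'a \<Rightarrow> real" where
  "repair_loss \<theta> k \<omega> = exp (- \<theta> * (after_failure k \<omega> - \<xi> k \<omega>)) - exp (- \<theta> * after_failure k \<omega>)"

definition vacation_loss :: "real \<Rightarrow> nat \<Rightarrow> 'a \<Rightarrow> real" where
  "vacation_loss \<theta> k \<omega> = 1 - exp (- \<theta> * \<eta> k \<omega>)"

lemma after_failure_measurable: "1 \<le> k \<Longrightarrow> after_failure k \<in> borel_measurable M"
  using Wplus_stationary by (cases k) (auto simp: stationary_sequence_def)

lemma before_repair_nonneg: "AE \<omega> in M. \<forall>k\<ge>1. 0 \<le> after_failure k \<omega> - \<xi> k \<omega> \<and> 0 \<le> \<xi> k \<omega> \<and> 0 \<le> \<eta> k \<omega>"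
  using AE_queue_path
proof (eventually_elim, intro allI impI)
  fix \<omega> and k :: nat assume path: "queue_path X r W0 \<tau> \<xi> \<sigma> \<eta> \<omega>" and k: "1 \<le> k"
  show "0 \<le> after_failure k \<omega> - \<xi> k \<omega> \<and> 0 \<le> \<xi> k \<omega> \<and> 0 \<le> \<eta> k \<omega>"
    using queue_path.Wait_before_repair_nonneg[OF path k] queue_path.repair_pos[OF path k] queue_path.vacation_pos[OF path k]
    by simp
qed

lemma repair_loss_measurable: "1 \<le> k \<Longrightarrow> repair_loss \<theta> k \<in> borel_measurable M"
  unfolding repair_loss_def[abs_def]
  by (intro borel_measurable_diff borel_measurable_times borel_measurable_const borel_measurable_exp[THEN measurable_compose[rotated]] after_failure_measurable xi_M)

lemma vacation_loss_measurable: "1 \<le> k \<Longrightarrow> vacation_loss \<theta> k \<in> borel_measurable M"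
  unfolding vacation_loss_def[abs_def]
  by (intro borel_measurable_diff borel_measurable_times borel_measurable_const borel_measurable_exp[THEN measurable_compose[rotated]] eta_M)

lemma loss_bounds:
  assumes th: "0 < \<theta>"
  shows "AE \<omega> in M. \<forall>k\<ge>1. 0 \<le> repair_loss \<theta> k \<omega> \<and> repair_loss \<theta> k \<omega> \<le> \<theta> * \<xi> k \<omega> \<and> repair_loss \<theta> k \<omega> \<le> 1"
    and "AE \<omega> in M. \<forall>k\<ge>1. 0 \<le> vacation_loss \<theta> k \<omega> \<and> vacation_loss \<theta> k \<omega> \<le> \<theta> * \<eta> k \<omega> \<and> vacation_loss \<theta> k \<omega> \<le> 1"
proof -
  show "AE \<omega> in M. \<forall>k\<ge>1. 0 \<le> repair_loss \<theta> k \<omega> \<and> repair_loss \<theta> k \<omega> \<le> \<theta> * \<xi> k \<omega> \<and> repair_loss \<theta> k \<omega> \<le> 1"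
    using before_repair_nonneg
  proof (eventually_elim, intro allI impI)
    fix \<omega> and k :: nat
    assume "\<forall>k\<ge>1. 0 \<le> after_failure k \<omega> - \<xi> k \<omega> \<and> 0 \<le> \<xi> k \<omega> \<and> 0 \<le> \<eta> k \<omega>" "1 \<le> k"
    then have w: "0 \<le> after_failure k \<omega> - \<xi> k \<omega>" and x: "0 \<le> \<theta> * \<xi> k \<omega>" using th by auto
    let ?e = "exp (- \<theta> * (after_failure k \<omega> - \<xi> k \<omega>))"
    have e: "0 \<le> ?e" "?e \<le> 1" using w th by auto
    have eq: "repair_loss \<theta> k \<omega> = ?e * (1 - exp (- (\<theta> * \<xi> k \<omega>)))"
      by (simp add: repair_loss_def right_diff_distrib flip: exp_add)
    note b = one_minus_exp_bounds[OF x]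
    have le: "?e * (1 - exp (- (\<theta> * \<xi> k \<omega>))) \<le> 1 - exp (- (\<theta> * \<xi> k \<omega>))"
      by (rule mult_left_le_one_le[OF b(1) e])
    have "0 \<le> ?e * (1 - exp (- (\<theta> * \<xi> k \<omega>)))" by (rule mult_nonneg_nonneg[OF e(1) b(1)])
    then show "0 \<le> repair_loss \<theta> k \<omega> \<and> repair_loss \<theta> k \<omega> \<le> \<theta> * \<xi> k \<omega> \<and> repair_loss \<theta> k \<omega> \<le> 1"
      unfolding eq using order_trans[OF le b(2)] order_trans[OF le b(3)] by blast
  qed
  show "AE \<omega> in M. \<forall>k\<ge>1. 0 \<le> vacation_loss \<theta> k \<omega> \<and> vacation_loss \<theta> k \<omega> \<le> \<theta> * \<eta> k \<omega> \<and> vacation_loss \<theta> k \<omega> \<le> 1"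
    using before_repair_nonneg
  proof (eventually_elim, intro allI impI)
    fix \<omega> and k :: nat
    assume "\<forall>k\<ge>1. 0 \<le> after_failure k \<omega> - \<xi> k \<omega> \<and> 0 \<le> \<xi> k \<omega> \<and> 0 \<le> \<eta> k \<omega>" "1 \<le> k"
    then have "0 \<le> \<theta> * \<eta> k \<omega>" using th by auto
    from one_minus_exp_bounds[OF this]
    show "0 \<le> vacation_loss \<theta> k \<omega> \<and> vacation_loss \<theta> k \<omega> \<le> \<theta> * \<eta> k \<omega> \<and> vacation_loss \<theta> k \<omega> \<le> 1"
      by (simp add: vacation_loss_def)
  qed
qed

definition mean_repair_loss :: "real \<Rightarrow> real" where
  "mean_repair_loss \<theta> = (\<integral>x. exp (- \<theta> * Wminus x) \<partial>N) - (\<integral>x. exp (- \<theta> * Wplus x) \<partial>N)"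

text \<open>The loss is the difference of a function of the level before the repair and a function of the level
  after it, so its mean converges by the two marginal limits.\<close>

lemma repair_loss_mean:
  assumes th: "0 < \<theta>"
  shows "(\<lambda>k. expectation (repair_loss \<theta> k)) \<longlonglongrightarrow> mean_repair_loss \<theta>"
proof (rule Lim_transform_eventually)
  note conv = converges_in_distribution_continuous_map[OF Wminus_Wplus_limit continuous_on_fst[OF continuous_on_id], unfolded fst_conv]
    converges_in_distribution_continuous_map[OF Wminus_Wplus_limit continuous_on_snd[OF continuous_on_id], unfolded snd_conv]
  have m: "(\<lambda>\<omega>. after_failure k \<omega> - \<xi> k \<omega>) \<in> borel_measurable M" if "1 \<le> k" for k
    using that by (intro borel_measurable_diff after_failure_measurable xi_M)
  have nn1: "AE \<omega> in M. 0 \<le> after_failure k \<omega> - \<xi> k \<omega>" if "1 \<le> k" for k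
    using before_repair_nonneg by eventually_elim (use that in blast)
  have nn2: "AE \<omega> in M. 0 \<le> after_failure k \<omega>" if "1 \<le> k" for k
    using before_repair_nonneg
  proof eventually_elim
    case (elim \<omega>)
    then have "0 \<le> after_failure k \<omega> - \<xi> k \<omega>" "0 \<le> \<xi> k \<omega>" using that by blast+
    then show ?case by simp
  qed
  have ev1: "eventually (\<lambda>k. (\<lambda>\<omega>. after_failure k \<omega> - \<xi> k \<omega>) \<in> borel_measurable M \<and> (AE \<omega> in M. 0 \<le> after_failure k \<omega> - \<xi> k \<omega>)) sequentially"
    using eventually_ge_at_top[of "1::nat"] by eventually_elim (use m nn1 in blast)
  have ev2: "eventually (\<lambda>k. after_failure k \<in> borel_measurable M \<and> (AE \<omega> in M. 0 \<le> after_failure k \<omega>)) sequentially"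
    using eventually_ge_at_top[of "1::nat"] by eventually_elim (use after_failure_measurable nn2 in blast)
  show "(\<lambda>k. expectation (\<lambda>\<omega>. exp (- \<theta> * (after_failure k \<omega> - \<xi> k \<omega>))) - expectation (\<lambda>\<omega>. exp (- \<theta> * after_failure k \<omega>)))
      \<longlonglongrightarrow> mean_repair_loss \<theta>"
    unfolding mean_repair_loss_def
  proof (rule tendsto_diff)
    show "(\<lambda>k. expectation (\<lambda>\<omega>. exp (- \<theta> * (after_failure k \<omega> - \<xi> k \<omega>)))) \<longlonglongrightarrow> (\<integral>x. exp (- \<theta> * Wminus x) \<partial>N)"
      by (rule converges_in_distribution_laplace[OF prob_space_N Wminus_measurable conv(1) _ ev1]) (use th in auto)
    show "(\<lambda>k. expectation (\<lambda>\<omega>. exp (- \<theta> * after_failure k \<omega>))) \<longlonglongrightarrow> (\<integral>x. exp (- \<theta> * Wplus x) \<partial>N)"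
      by (rule converges_in_distribution_laplace[OF prob_space_N Wplus_measurable conv(2) _ ev2]) (use th in auto)
  qed
  show "eventually (\<lambda>k. expectation (\<lambda>\<omega>. exp (- \<theta> * (after_failure k \<omega> - \<xi> k \<omega>))) - expectation (\<lambda>\<omega>. exp (- \<theta> * after_failure k \<omega>))
      = expectation (repair_loss \<theta> k)) sequentially"
    using eventually_ge_at_top[of "1::nat"]
  proof eventually_elim
    case (elim k)
    note [measurable] = m[OF elim] after_failure_measurable[OF elim]
    have "integrable M (\<lambda>\<omega>. exp (- \<theta> * (after_failure k \<omega> - \<xi> k \<omega>)))"
      by (rule integrable_const_bound[where B=1]) (use nn1[OF elim] in eventually_elim, use th in auto)
    moreover have "integrable M (\<lambda>\<omega>. exp (- \<theta> * after_failure k \<omega>))"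
      by (rule integrable_const_bound[where B=1]) (use nn2[OF elim] in eventually_elim, use th in auto)
    ultimately show ?case
      unfolding repair_loss_def by (rule Bochner_Integration.integral_diff[symmetric])
  qed
qed

lemma vacation_loss_mean:
  assumes k: "1 \<le> k" shows "expectation (vacation_loss \<theta> k) = expectation (vacation_loss \<theta> 1)"
proof -
  have [measurable]: "\<eta> k \<in> borel_measurable M" "\<eta> (Suc 0) \<in> borel_measurable M" by (rule eta_M[OF k], rule eta_M, simp)
  have "expectation (vacation_loss \<theta> k) = integral\<^sup>L (distr M borel (\<eta> k)) (\<lambda>z. 1 - exp (- \<theta> * z))"
    unfolding vacation_loss_def by (subst integral_distr) auto
  also have "\<dots> = expectation (vacation_loss \<theta> 1)"
    unfolding vacation_loss_def eta_ident[OF k] by (subst integral_distr) auto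
  finally show ?thesis .
qed

text \<open>The balance equation for the waiting time: \<open>jumps_limit\<close> and dominated convergence identify the jump
  term as the mean total loss up to time \<open>t\<close>, whose growth rate \<open>dominated_reward_rate\<close> computes in a
  second way.\<close>

lemma waiting_time_transform:
  assumes th: "0 < \<theta>"
  shows "net_exponent a \<nu> r \<theta> * (\<integral>x. exp (- \<theta> * W x) \<partial>N) =
    lamR * mean_repair_loss \<theta> + lamV * expectation (vacation_loss \<theta> 1)"
proof -
  let ?w = "\<integral>x. exp (- \<theta> * W x) \<partial>N" and ?\<phi> = "net_exponent a \<nu> r"
  let ?l = "lamR * mean_repair_loss \<theta> + lamV * expectation (vacation_loss \<theta> 1)"
  define HR where "HR t \<omega> = (\<Sum>i=1..num_until \<tau> t \<omega>. repair_loss \<theta> i \<omega>)" for t \<omega>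
  define HV where "HV t \<omega> = (\<Sum>i=1..num_until \<sigma> t \<omega>. vacation_loss \<theta> i \<omega>)" for t \<omega>
  define B where "B t = - ((expectation (HR t) - expectation (HR 0)) + (expectation (HV t) - expectation (HV 0)))" for t
  have HRint: "integrable M (HR t)" if "0 \<le> t" for t
    unfolding HR_def
    by (rule repair.dominated_total_integrable[where g="repair_loss \<theta>" and \<theta>=\<theta>, OF repair_loss_measurable _ that])
       (assumption, use loss_bounds(1)[OF th] in eventually_elim, blast)
  have HVint: "integrable M (HV t)" if "0 \<le> t" for t
    unfolding HV_def
    by (rule vacation.dominated_total_integrable[where g="vacation_loss \<theta>" and \<theta>=\<theta>, OF vacation_loss_measurable _ that])
       (assumption, use loss_bounds(2)[OF th] in eventually_elim, blast)
  have "((\<lambda>t. B t / t) \<longlongrightarrow> - (?\<phi> \<theta> * ?w)) at_top"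
  proof (rule net.laplace_balance[where V=Wt])
    show "((\<lambda>t. expectation (\<lambda>\<omega>. exp (- \<theta> * Wt t \<omega>))) \<longlongrightarrow> ?w) at_top"
    proof (rule converges_in_distribution_laplace[OF prob_space_N W_measurable W_limit])
      show "eventually (\<lambda>t. Wt t \<in> borel_measurable M \<and> (AE \<omega> in M. 0 \<le> Wt t \<omega>)) at_top"
        using eventually_ge_at_top[of 0] by eventually_elim (use Wt_nonneg Wt_integrable in blast)
    qed (use th in auto)
    fix t :: real assume t: "0 < t"
    let ?T = "\<lambda>n k \<omega>. cell_jump \<theta> (\<lambda>s. Wt s \<omega>) (\<lambda>s. net_input X r s \<omega>) (real k * (t / real n)) (real (Suc k) * (t / real n))"
    let ?L = "\<lambda>\<omega>. - ((HR t \<omega> - HR 0 \<omega>) + (HV t \<omega> - HV 0 \<omega>))"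
    have iT: "integrable M (?T n k)" for n k :: nat
    proof -
      have su: "real (Suc k) * (t / real n) = real k * (t / real n) + t / real n"
        by (simp add: distrib_right add_divide_distrib)
      show ?thesis
        unfolding su using t th by (intro net.cell_jump_integrable Wt_nonneg Wt_adapted) auto
    qed
    have "(\<lambda>n. expectation (\<lambda>\<omega>. \<Sum>k<n. ?T n k \<omega>)) \<longlonglongrightarrow> expectation ?L"
    proof (rule integral_dominated_convergence[where w="\<lambda>\<omega>. \<theta> * exp (\<theta> * (r * t)) * (repairs t \<omega> + vacations t \<omega>)"])
      show "?L \<in> borel_measurable M" using HRint HVint t by (auto intro!: borel_measurable_integrable)
      show "(\<lambda>\<omega>. \<Sum>k<n. ?T n k \<omega>) \<in> borel_measurable M" for n
        by (intro borel_measurable_sum borel_measurable_integrable iT)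
      show "integrable M (\<lambda>\<omega>. \<theta> * exp (\<theta> * (r * t)) * (repairs t \<omega> + vacations t \<omega>))"
        using repairs_integrable[of t] vacations_integrable[of t] t
        by (intro integrable_mult_right Bochner_Integration.integrable_add) auto
      show "AE \<omega> in M. (\<lambda>n. \<Sum>k<n. ?T n k \<omega>) \<longlonglongrightarrow> ?L \<omega>"
        using AE_queue_path
      proof eventually_elim
        case (elim \<omega>)
        then interpret queue_path X r W0 \<tau> \<xi> \<sigma> \<eta> \<omega> .
        have "repair_gap \<theta> i = repair_loss \<theta> i \<omega>" for i by (simp add: repair_gap_def repair_loss_def)
        with jumps_limit[OF t, of \<theta>] show ?case
          by (simp only: HR_def HV_def vacation_loss_def)
      qed
      show "AE \<omega> in M. norm (\<Sum>k<n. ?T n k \<omega>) \<le> \<theta> * exp (\<theta> * (r * t)) * (repairs t \<omega> + vacations t \<omega>)" for n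
        using AE_queue_path
      proof eventually_elim
        case (elim \<omega>)
        then interpret queue_path X r W0 \<tau> \<xi> \<sigma> \<eta> \<omega> .
        show ?case
        proof (cases "n = 0")
          case True
          have "0 \<le> work t" using repairs_mono[of 0 "R.cnt t"] vacations_mono[of 0 "Vac.cnt t"] by (simp add: work_def)
          with True th show ?thesis by (simp add: work_def)
        next
          case False
          with jumps_bound[OF t, of \<theta> n] th show ?thesis
            by (simp only: real_norm_def work_def)
        qed
      qed
    qed
    also have "expectation ?L = B t"
      unfolding B_def using HRint[of t] HRint[of 0] HVint[of t] HVint[of 0] t by simp
    also have "(\<lambda>n. expectation (\<lambda>\<omega>. \<Sum>k<n. ?T n k \<omega>)) = (\<lambda>n. \<Sum>k<n. expectation (?T n k))"
      by (rule ext, rule Bochner_Integration.integral_sum) (rule iT)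
    finally show "(\<lambda>n. \<Sum>k<n. expectation (?T n k)) \<longlonglongrightarrow> B t" .
  qed (use th Wt_nonneg Wt_adapted in auto)
  moreover have "((\<lambda>t. B t / t) \<longlongrightarrow> - (?l)) at_top"
  proof (rule Lim_transform_eventually)
    have R: "((\<lambda>t. expectation (HR t) / t) \<longlongrightarrow> lamR * mean_repair_loss \<theta>) at_top"
      unfolding HR_def
      by (rule repair.dominated_reward_rate[OF _ repair_loss_measurable loss_bounds(1)[OF th] repair_loss_mean[OF th] repairs_rate])
         (use th in auto)
    have "(\<lambda>k. expectation (vacation_loss \<theta> k)) \<longlonglongrightarrow> expectation (vacation_loss \<theta> 1)"
      by (rule Lim_transform_eventually[OF tendsto_const])
         (use eventually_ge_at_top[of "1::nat"] in eventually_elim, rule vacation_loss_mean[symmetric])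
    then have V: "((\<lambda>t. expectation (HV t) / t) \<longlongrightarrow> lamV * expectation (vacation_loss \<theta> 1)) at_top"
      unfolding HV_def
      by (rule vacation.dominated_reward_rate[OF _ vacation_loss_measurable loss_bounds(2)[OF th] _ vacations_rate, rotated -1])
         (use th in auto)
    have "((\<lambda>t. (expectation (HR 0) + expectation (HV 0)) / t - (expectation (HR t) / t + expectation (HV t) / t)) \<longlongrightarrow>
        0 - (?l)) at_top"
      by (intro tendsto_diff tendsto_add R V const_over_time_tendsto_0)
    then show "((\<lambda>t. (expectation (HR 0) + expectation (HV 0)) / t - (expectation (HR t) / t + expectation (HV t) / t)) \<longlongrightarrow>
        - (?l)) at_top" by simp
    show "eventually (\<lambda>t. (expectation (HR 0) + expectation (HV 0)) / t - (expectation (HR t) / t + expectation (HV t) / t) = B t / t) at_top"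
      by (simp add: B_def add_divide_distrib[symmetric] diff_divide_distrib[symmetric] algebra_simps)
  qed
  ultimately have "- (?\<phi> \<theta> * ?w) = - (?l)"
    by (rule tendsto_unique[rotated]) simp
  then show ?thesis by simp
qed

lemma W_nonneg: "AE x in N. 0 \<le> W x"
  by (rule converges_in_distribution_nonneg[OF prob_space_N W_measurable W_limit])
     (simp, use eventually_ge_at_top[of "0::real"] in eventually_elim, rule Wt_nonneg)

end

theorem theorem6p1:
  fixes M :: "'a measure" and F :: "ennreal \<Rightarrow> 'a measure"
    and X :: "real \<Rightarrow> 'a \<Rightarrow> real" and a r :: real and \<nu> :: "real measure"
    and W0 R0 :: "'a \<Rightarrow> real"
    and \<tau> \<sigma> :: "nat \<Rightarrow> 'a \<Rightarrow> ennreal" and \<xi> \<eta> :: "nat \<Rightarrow> 'a \<Rightarrow> real"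
    and N :: "'b measure" and W Wminus Wplus R U :: "'b \<Rightarrow> real"
    and lamR lamV p :: real
  assumes queue: "fluid_queue_steady_state M F X a \<nu> r W0 \<tau> \<xi> \<sigma> \<eta> N W Wminus Wplus lamR lamV p"
    and R0: "R0 \<in> borel_measurable (F 0)" "AE \<omega> in M. 0 \<le> R0 \<omega>"
    and R: "R \<in> borel_measurable N"
      "converges_in_distribution M (reflected (net_input X r) R0) at_top N R"
    and U: "U \<in> borel_measurable N" "AE x in N. 0 \<le> U x"
      "\<And>\<theta>. 0 < \<theta> \<Longrightarrow> (\<integral>x. exp (- \<theta> * U x) \<partial>N) =
         ((\<integral>x. exp (- \<theta> * Wminus x) \<partial>N) - (\<integral>x. exp (- \<theta> * Wplus x) \<partial>N))
           / (\<theta> * (\<integral>\<omega>. \<xi> 1 \<omega> \<partial>M))"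
  shows "distr N borel W =
    (distr N borel R \<star> mixture p (distr N borel U) (residual_life M (\<eta> 1)))"
proof -
  interpret fluid_queue_steady_state M F X a \<nu> r W0 \<tau> \<xi> \<sigma> \<eta> N W Wminus Wplus lamR lamV p by fact
  interpret N: prob_space N by (rule prob_space_N)
  note [measurable] = R(1) U(1) W_measurable
  note PK = net.generalized_Pollaczek_Khinchine[OF R0 prob_space_N R]
  let ?R = "distr N borel R" and ?U = "distr N borel U" and ?L = "residual_life M (\<eta> 1)"
  have eta_mean: "0 < expectation (\<eta> 1)" and xi_mean: "0 < expectation (\<xi> 1)"
  proof -
    have "0 \<le> expectation (\<eta> 1)"
      by (rule integral_nonneg_AE) (use eta_pos[OF order_refl] in eventually_elim, simp)
    moreover have "0 \<le> expectation (\<xi> 1)"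
      by (rule integral_nonneg_AE) (use xi_pos[OF order_refl] in eventually_elim, simp)
    moreover have "expectation (\<eta> 1) \<noteq> 0" "expectation (\<xi> 1) \<noteq> 0"
      using p_lambdaR p_lambdaV rates_pos by auto
    ultimately show "0 < expectation (\<eta> 1)" "0 < expectation (\<xi> 1)" by auto
  qed
  have eta_nonneg: "AE \<omega> in M. 0 \<le> \<eta> 1 \<omega>" using eta_pos[OF order_refl] by eventually_elim simp
  note res = prob_space_residual_life[OF eta_integrable eta_nonneg eta_mean]
    residual_life_nonneg[OF eta_integrable eta_nonneg eta_mean]
    laplace_residual_life[OF eta_integrable eta_nonneg eta_mean]
  have pR: "prob_space ?R" and pU: "prob_space ?U" and pW: "prob_space (distr N borel W)"
    by (auto intro: N.prob_space_distr)
  have nR: "AE x in ?R. 0 \<le> x" and nU: "AE x in ?U. 0 \<le> x" and nW: "AE x in distr N borel W. 0 \<le> x"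
    using PK(1) U(2) W_nonneg by (auto simp: AE_distr_iff)
  note mix = prob_space_mixture[OF pU _ res(1) sets_residual_life p_range]
    mixture_nonneg[OF pU _ res(1) sets_residual_life p_range _ res(2)]
    laplace_mixture[OF pU _ res(1) sets_residual_life p_range _ res(2)]
  have sm: "sets (mixture p ?U ?L) = sets borel" by (rule sets_mixture) (auto simp: sets_residual_life)
  show ?thesis
  proof (rule Laplace_transform_unique)
    show "prob_space (?R \<star> mixture p ?U ?L)"
      by (rule prob_space_convolution[OF pR _ mix(1) sm]) auto
    show "AE x in ?R \<star> mixture p ?U ?L. 0 \<le> x"
      by (rule convolution_nonneg[OF pR _ nR mix(1) sm mix(2)]) (use nU in auto)
    fix k :: nat assume "k \<noteq> 0"
    define \<theta> where "\<theta> = real k"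
    have th: "0 < \<theta>" using \<open>k \<noteq> 0\<close> by (simp add: \<theta>_def)
    let ?\<phi> = "net_exponent a \<nu> r \<theta>"
    have LR: "?\<phi> * (\<integral>x. exp (- \<theta> * R x) \<partial>N) = \<theta> * drift" by (rule PK(2)[OF th])
    \<comment> \<open>The drift is positive, so the Pollaczek--Khinchine formula shows that the exponent does not vanish.\<close>
    then have phi: "?\<phi> \<noteq> 0" using th net.drift_pos by auto
    have LU: "mean_repair_loss \<theta> = \<theta> * expectation (\<xi> 1) * (\<integral>x. exp (- \<theta> * U x) \<partial>N)"
      using U(3)[OF th] th xi_mean by (simp add: mean_repair_loss_def)
    have LV: "expectation (vacation_loss \<theta> 1) = \<theta> * expectation (\<eta> 1) * (\<integral>x. exp (- \<theta> * x) \<partial>?L)"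
    proof -
      have [measurable]: "\<eta> (Suc 0) \<in> borel_measurable M" by (rule eta_M) simp
      have "integrable M (\<lambda>\<omega>. exp (- \<theta> * \<eta> 1 \<omega>))"
        by (rule integrable_const_bound[where B=1]) (use eta_nonneg in eventually_elim, use th in auto)
      then have "expectation (vacation_loss \<theta> 1) = 1 - expectation (\<lambda>\<omega>. exp (- \<theta> * \<eta> 1 \<omega>))"
        unfolding vacation_loss_def by (simp add: prob_space)
      then show ?thesis using res(3)[OF th] th eta_mean by simp
    qed
    have "?\<phi> * (\<integral>x. exp (- \<theta> * W x) \<partial>N) = lamR * mean_repair_loss \<theta> + lamV * expectation (vacation_loss \<theta> 1)"
      by (rule waiting_time_transform[OF th])
    also have "\<dots> = (lamR * expectation (\<xi> 1)) * \<theta> * (\<integral>x. exp (- \<theta> * U x) \<partial>N)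
        + (lamV * expectation (\<eta> 1)) * \<theta> * (\<integral>x. exp (- \<theta> * x) \<partial>?L)"
      unfolding LU LV by (simp only: mult_ac)
    also have "\<dots> = \<theta> * drift * (p * (\<integral>x. exp (- \<theta> * U x) \<partial>N) + (1 - p) * (\<integral>x. exp (- \<theta> * x) \<partial>?L))"
      unfolding repair_work_rate vacation_work_rate by (simp add: algebra_simps)
    also have "\<dots> = ?\<phi> * ((\<integral>x. exp (- \<theta> * R x) \<partial>N) * (p * (\<integral>x. exp (- \<theta> * U x) \<partial>N) + (1 - p) * (\<integral>x. exp (- \<theta> * x) \<partial>?L)))"
      unfolding LR[symmetric] by (simp only: mult_ac)
    finally have main: "(\<integral>x. exp (- \<theta> * W x) \<partial>N) =
        (\<integral>x. exp (- \<theta> * R x) \<partial>N) * (p * (\<integral>x. exp (- \<theta> * U x) \<partial>N) + (1 - p) * (\<integral>x. exp (- \<theta> * x) \<partial>?L))"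
      using phi by simp
    have push: "(\<integral>x. exp (- \<theta> * x) \<partial>distr N borel Z) = (\<integral>x. exp (- \<theta> * Z x) \<partial>N)"
      if [measurable]: "Z \<in> borel_measurable N" for Z
      by (subst integral_distr) auto
    have "(\<integral>x. exp (- \<theta> * x) \<partial>(?R \<star> mixture p ?U ?L)) =
        (\<integral>x. exp (- \<theta> * x) \<partial>?R) * (\<integral>x. exp (- \<theta> * x) \<partial>mixture p ?U ?L)"
      by (rule laplace_convolution[OF pR _ mix(1) sm]) auto
    also have "(\<integral>x. exp (- \<theta> * x) \<partial>mixture p ?U ?L) =
        p * (\<integral>x. exp (- \<theta> * x) \<partial>?U) + (1 - p) * (\<integral>x. exp (- \<theta> * x) \<partial>?L)"
      by (rule mix(3)) (use nU th in auto)
    finally show "(\<integral>x. exp (- real k * x) \<partial>distr N borel W) = (\<integral>x. exp (- real k * x) \<partial>(?R \<star> mixture p ?U ?L))"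
      unfolding \<theta>_def[symmetric] push[OF R(1)] push[OF U(1)] push[OF W_measurable] main by (rule sym)
  qed (use pW nW in auto)
qed

end
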